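(* Let $K$ be an algebraically closed field of arbitrary characteristic and let $f\in\mathfrak m\subset K[[\mathbf x]]=K[[x_1,\dots,x_n]]$ be such that $\mu(f)<\infty$ (resp. $\tau(f)<\infty$). Let $g_1,\dots,g_l\in K[\mathbf x]$ be a system of $K$-generators of $\mathfrak m/\mathfrak m\cdot j(f)$ (resp. of $\mathfrak m/(\langle f\rangle+\mathfrak m\cdot j(f))$), with $j(f)$ the jacobian ideal of $f$. Then the unfolding (with trivial section) of $f$ at $0$ over $\mathbb A^l$, $$F(\mathbf x,t)=f(\mathbf x)+\sum_{i=1}^l t_i g_i(\mathbf x)\in K[\mathbf t][[\mathbf x]],\qquad \mathbf t=(t_1,\dots,t_l),$$ is (an algebraic representative of) a formally versal deformation of $f$ with trivial section with respect to right (resp. contact) equivalence, which is semi-universal if the system $\{g_i\}$ is a basis. This unfolding is right (resp. contact) complete.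
   Context: $\mathfrak m$ is the maximal ideal of $K[[\mathbf x]]$, $j(f)$ the ideal generated by the partial derivatives of $f$, $\mu(f)=\dim_KK[[\mathbf x]]/j(f)$, $\tau(f)=\dim_KK[[\mathbf x]]/(\langle f\rangle+j(f))$. "System of $K$-generators" means $g_i\in\mathfrak m$ and their residue classes generate the $K$-vector space. The right group $\mathcal R=\mathrm{Aut}_K(K[[\mathbf x]])$ acts by $(\Phi,f)\mapsto\Phi(f)$; the contact group $\mathcal K$, the semidirect product of $\mathcal R$ with $K[[\mathbf x]]^*$, acts by $((\Phi,u),f)\mapsto u\cdot\Phi(f)$. For $G=\mathcal R$ or $\mathcal K$, $G$-equivalent means in the same $G$-orbit. Varieties are separated schemes of finite type over $K$, points are closed points. An unfolding of $f$ at $t_0\in T$ over an affine variety $T$ is $F(\mathbf x,t)=\sum a_\alpha\mathbf x^\alpha\in\mathcal O(T)[[\mathbf x]]$ such that $f_t(\mathbf x)=F(\mathbf x,t):=\sum a_\alpha(t)\mathbf x^\alpha$ satisfies $f_{t_0}=f$ and $f_t\in\mathfrak m$ for all $t\in T$. An étale neighbourhood $\varphi:W,w_0\to S,s_0$ is an étale morphism of varieties with $\varphi(w_0)=s_0$. An unfolding $H(\mathbf x,s)$ of $f$ at $s_0$ over an affine variety $S$ is an étale $G$-pullback of an unfolding $F(\mathbf x,t)$ of $f$ at $t_0$ over $T$ if there exist an étale neighbourhood $\varphi:W,w_0\to S,s_0$ and a morphism $\psi:W,w_0\to T,t_0$ (with $\psi(w_0)=t_0$) such that $H(\mathbf x,\varphi(w))$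 is $G$-equivalent to $F(\mathbf x,\psi(w))$ for all $w\in W$. $F$ is right (resp. contact) complete, i.e. $G$-complete for $G=\mathcal R$ (resp. $G=\mathcal K$), if any unfolding of $f$ (over any affine variety) is an étale $G$-pullback of $F$. Formal deformations: for a complete Noetherian local $K$-algebra $A$ with residue field $K$, a deformation of $f$ with trivial section over $A$ is $F_A\in\langle\mathbf x\rangle A[[\mathbf x]]$ reducing to $f$ modulo $\mathfrak m_A$. Two such are right equivalent if one is mapped to the other by an $A$-automorphism of $A[[\mathbf x]]$ preserving $\langle\mathbf x\rangle$ and reducing to the identity modulo $\mathfrak m_A$; contact equivalent if this holds up to multiplication by a unit of $A[[\mathbf x]]$ reducing to $1$ modulo $\mathfrak m_A$. $F_A$ is formally versal if for every surjection $B\to C$ of such algebras, every deformation $H_B$ over $B$, and every local homomorphism $A\to C$ together with an equivalence over $C$ between the deformation induced from $F_A$ and that induced from $H_B$, the homomorphism and the equivalence lift to a local homomorphism $A\to B$ and an equivalence over $B$ between the deformation induced from $F_A$ and $H_B$. It is semi-universal if moreover for $B=K[\varepsilon]/\langle\varepsilon^2\rangle$ the homomorphism $A\to B$ is uniquely determined by the equivalence class of the deformation over $B$. Here $F$ is regarded as a deformation over $A=K[[t_1,\dots,t_l]]$. *)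

theory Defs
  imports
    "HOL-Library.Poly_Mapping"
    "HOL-Library.Extended_Nat"
    "HOL-Computational_Algebra.Polynomial"
begin

section \<open>Formal power series in several variables\<close>

text \<open>Monomials are finitely supported exponent vectors. The index type \<open>'v\<close> of the variables is
  finite for the variables \<open>x\<close>. It is \<open>nat\<close> for the parameters \<open>t\<close>, of which only the first \<open>l\<close>
  are used (so that \<open>l = 0\<close> is included).\<close>

typedef ('a, 'v) mps = "UNIV :: (('v \<Rightarrow>\<^sub>0 nat) \<Rightarrow> 'a) set"
  morphisms mps_coeff Abs_mps by simp

setup_lifting type_definition_mps

lemma mps_eqI: "(\<And>m. mps_coeff F m = mps_coeff G m) \<Longrightarrow> F = G"
  by transfer auto

lemma finite_monom_splits: "finite {(a, b). a + b = (m :: 'v \<Rightarrow>\<^sub>0 nat)}"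
proof -
  let ?B = "{f. \<forall>x. (x \<in> Poly_Mapping.keys m \<longrightarrow>
      f x \<in> {..Max (Poly_Mapping.lookup m ` Poly_Mapping.keys m)}) \<and>
      (x \<notin> Poly_Mapping.keys m \<longrightarrow> f x = (0::nat))}"
  have fin: "finite ?B"
    by (rule finite_set_of_finite_funs) auto
  have "Poly_Mapping.lookup ` (fst ` {(a, b). a + b = m}) \<subseteq> ?B"
  proof (clarsimp, safe)
    fix a b :: "'v \<Rightarrow>\<^sub>0 nat" and x
    assume m: "m = a + b"
    show "Poly_Mapping.lookup a x \<le> Max (Poly_Mapping.lookup (a + b) ` Poly_Mapping.keys (a + b))"
      if "x \<in> Poly_Mapping.keys (a + b)"
    proof -
      have "Poly_Mapping.lookup a x \<le> Poly_Mapping.lookup (a + b) x" by (simp add: lookup_add)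
      also have "\<dots> \<le> Max (Poly_Mapping.lookup (a + b) ` Poly_Mapping.keys (a + b))" using that by simp
      finally show ?thesis .
    qed
    show "Poly_Mapping.lookup a x = 0" if "x \<notin> Poly_Mapping.keys (a + b)"
      using that by (simp add: in_keys_iff lookup_add)
  qed
  then have "finite (Poly_Mapping.lookup ` (fst ` {(a, b). a + b = m}))"
    using fin finite_subset by blast
  then have f1: "finite (fst ` {(a, b). a + b = m})"
    by (rule finite_imageD) (simp add: inj_on_def lookup_inject)
  have "inj_on fst {(a, b). a + b = m}"
    by (auto simp: inj_on_def)
  with f1 show ?thesis by (rule finite_imageD)
qed

instantiation mps :: (comm_ring_1, type) comm_ring_1
begin

lift_definition zero_mps :: "('a, 'b) mps" is "\<lambda>_. 0" .
lift_definition one_mps :: "('a, 'b) mps" is "\<lambda>m. if m = 0 then 1 else 0" .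
lift_definition plus_mps :: "('a, 'b) mps \<Rightarrow> ('a, 'b) mps \<Rightarrow> ('a, 'b) mps"
  is "\<lambda>F G m. F m + G m" .
lift_definition minus_mps :: "('a, 'b) mps \<Rightarrow> ('a, 'b) mps \<Rightarrow> ('a, 'b) mps"
  is "\<lambda>F G m. F m - G m" .
lift_definition uminus_mps :: "('a, 'b) mps \<Rightarrow> ('a, 'b) mps"
  is "\<lambda>F m. - F m" .
lift_definition times_mps :: "('a, 'b) mps \<Rightarrow> ('a, 'b) mps \<Rightarrow> ('a, 'b) mps"
  is "\<lambda>F G m. \<Sum>(a, b) \<in> {(a, b). a + b = m}. F a * G b" .

instance
proof
  fix F G H :: "('a, 'b) mps"
  show "F + G + H = F + (G + H)" by transfer (simp add: add.assoc)
  show "F + G = G + F" by transfer (simp add: add.commute)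
  show "0 + F = F" by transfer simp
  show "- F + F = 0" by transfer simp
  show "F - G = F + - G" by transfer simp
  show "(0 :: ('a, 'b) mps) \<noteq> 1" by transfer (auto simp: fun_eq_iff)
  show "F * G = G * F"
  proof (transfer, rule ext)
    fix F G :: "('b \<Rightarrow>\<^sub>0 nat) \<Rightarrow> 'a" and m
    show "(\<Sum>(a, b) \<in> {(a, b). a + b = m}. F a * G b) = (\<Sum>(a, b) \<in> {(a, b). a + b = m}. G a * F b)"
      by (rule sum.reindex_bij_witness[of _ prod.swap prod.swap])
        (auto simp: add.commute mult.commute)
  qed
  show "1 * F = F"
  proof (transfer, rule ext)
    fix F :: "('b \<Rightarrow>\<^sub>0 nat) \<Rightarrow> 'a" and m
    have "(\<Sum>(a, b) \<in> {(a, b). a + b = m}. (if a = 0 then 1 else 0) * F b) =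
      (\<Sum>(a, b) \<in> {(0 :: 'b \<Rightarrow>\<^sub>0 nat, m)}. (if a = 0 then 1 else 0) * F b)"
      by (rule sum.mono_neutral_right[OF finite_monom_splits]) (auto split: if_splits)
    then show "(\<Sum>(a, b) \<in> {(a, b). a + b = m}. (if a = 0 then 1 else 0) * F b) = F m"
      by simp
  qed
  show "(F + G) * H = F * H + G * H"
    by transfer (simp add: ring_distribs sum.distrib case_prod_unfold)
  show "F * G * H = F * (G * H)"
  proof (transfer, rule ext)
    fix F G H :: "('b \<Rightarrow>\<^sub>0 nat) \<Rightarrow> 'a" and m
    let ?S = "\<lambda>m :: 'b \<Rightarrow>\<^sub>0 nat. {(a, b). a + b = m}"
    have "(\<Sum>(a, b) \<in> ?S m. (\<Sum>(c, d) \<in> ?S a. F c * G d) * H b) =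
      (\<Sum>p \<in> ?S m. \<Sum>q \<in> ?S (fst p). F (fst q) * G (snd q) * H (snd p))"
      by (simp add: sum_distrib_right case_prod_unfold)
    also have "\<dots> = (\<Sum>(p, q) \<in> (SIGMA p:?S m. ?S (fst p)). F (fst q) * G (snd q) * H (snd p))"
      by (rule sum.Sigma) (auto simp: finite_monom_splits)
    also have "\<dots> = (\<Sum>(p, q) \<in> (SIGMA p:?S m. ?S (snd p)). F (fst p) * (G (fst q) * H (snd q)))"
      by (rule sum.reindex_bij_witness[of _
          "\<lambda>(p, q). ((fst p + fst q, snd q), (fst p, fst q))"
          "\<lambda>(p, q). ((fst q, snd q + snd p), (snd q, snd p))"])
        (auto simp: add.assoc mult.assoc)
    also have "\<dots> = (\<Sum>p \<in> ?S m. \<Sum>q \<in> ?S (snd p). F (fst p) * (G (fst q) * H (snd q)))"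
      by (rule sum.Sigma[symmetric]) (auto simp: finite_monom_splits)
    also have "\<dots> = (\<Sum>(a, b) \<in> ?S m. F a * (\<Sum>(c, d) \<in> ?S b. G c * H d))"
      by (simp add: sum_distrib_left case_prod_unfold)
    finally show "(\<Sum>(a, b) \<in> ?S m. (\<Sum>(c, d) \<in> ?S a. F c * G d) * H b) =
      (\<Sum>(a, b) \<in> ?S m. F a * (\<Sum>(c, d) \<in> ?S b. G c * H d))" .
  qed
qed

end

lift_definition mps_const :: "'a :: zero \<Rightarrow> ('a, 'v) mps"
  is "\<lambda>c m. if m = 0 then c else 0" .

lift_definition mps_map :: "('a \<Rightarrow> 'b) \<Rightarrow> ('a, 'v) mps \<Rightarrow> ('b, 'v) mps"
  is "\<lambda>h F m. h (F m)" .

definition mps_of_mpoly :: "(('v \<Rightarrow>\<^sub>0 nat) \<Rightarrow>\<^sub>0 'a :: zero) \<Rightarrow> ('a, 'v) mps" where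
  "mps_of_mpoly p = Abs_mps (Poly_Mapping.lookup p)"

lift_definition mps_pderiv :: "'v \<Rightarrow> ('a :: comm_ring_1, 'v) mps \<Rightarrow> ('a, 'v) mps"
  is "\<lambda>i F m. of_nat (Poly_Mapping.lookup m i + 1) * F (m + Poly_Mapping.single i 1)" .

text \<open>The ideal \<open>\<langle>x\<rangle>\<close> of \<open>A[[x]]\<close>; for a field \<open>A\<close> this is the maximal ideal. (For finitely many
  variables, vanishing of the constant term is the same as being generated by the variables.)\<close>

definition mps_max :: "('a :: comm_ring_1, 'v) mps set" where
  "mps_max = {F. mps_coeff F 0 = 0}"

section \<open>Ideals, and quotients of vector spaces\<close>

abbreviation ideal_gen :: "'a :: comm_ring_1 set \<Rightarrow> 'a set" where
  "ideal_gen \<equiv> module.span (*)"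

abbreviation is_ideal :: "'a :: comm_ring_1 set \<Rightarrow> bool" where
  "is_ideal \<equiv> module.subspace (*)"

definition ideal_prod :: "'a :: comm_ring_1 set \<Rightarrow> 'a set \<Rightarrow> 'a set" where
  "ideal_prod I J = ideal_gen {a * b | a b. a \<in> I \<and> b \<in> J}"

primrec ideal_power :: "'a :: comm_ring_1 set \<Rightarrow> nat \<Rightarrow> 'a set" where
  "ideal_power I 0 = UNIV"
| "ideal_power I (Suc n) = ideal_prod I (ideal_power I n)"

text \<open>For \<open>K\<close>-subspaces \<open>U \<subseteq> V\<close> of \<open>K[[x]]\<close>: the classes of \<open>g 0, \<dots>, g (l - 1)\<close> generate, resp. are
  a basis of, \<open>V / U\<close>, and the dimension of \<open>V / U\<close>.\<close>

definition quot_generators ::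
    "('k :: field, 'v) mps set \<Rightarrow> ('k, 'v) mps set \<Rightarrow> nat \<Rightarrow> (nat \<Rightarrow> ('k, 'v) mps) \<Rightarrow> bool" where
  "quot_generators V U l g \<longleftrightarrow>
     (\<forall>i<l. g i \<in> V) \<and> (\<forall>h\<in>V. \<exists>c. h - (\<Sum>i<l. mps_const (c i) * g i) \<in> U)"

definition quot_basis ::
    "('k :: field, 'v) mps set \<Rightarrow> ('k, 'v) mps set \<Rightarrow> nat \<Rightarrow> (nat \<Rightarrow> ('k, 'v) mps) \<Rightarrow> bool" where
  "quot_basis V U l g \<longleftrightarrow> quot_generators V U l g \<and>
     (\<forall>c. (\<Sum>i<l. mps_const (c i) * g i) \<in> U \<longrightarrow> (\<forall>i<l. c i = 0))"

definition quot_dim :: "('k :: field, 'v) mps set \<Rightarrow> ('k, 'v) mps set \<Rightarrow> enat" where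
  "quot_dim V U = Inf {enat l | l. \<exists>g. quot_basis V U l g}"

definition jacobian_ideal :: "('k :: field, 'v) mps \<Rightarrow> ('k, 'v) mps set" where
  "jacobian_ideal f = ideal_gen (range (\<lambda>i. mps_pderiv i f))"

definition milnor_number :: "('k :: field, 'v) mps \<Rightarrow> enat" where
  "milnor_number f = quot_dim UNIV (jacobian_ideal f)"

definition tjurina_number :: "('k :: field, 'v) mps \<Rightarrow> enat" where
  "tjurina_number f = quot_dim UNIV (ideal_gen ({f} \<union> jacobian_ideal f))"

section \<open>Right and contact equivalence\<close>

datatype equiv_kind = Right_Equiv | Contact_Equiv

definition mps_auts :: "(('a :: comm_ring_1, 'v) mps \<Rightarrow> ('a, 'v) mps) set" where
  "mps_auts = {\<Phi>. bij \<Phi> \<and> (\<forall>F G. \<Phi> (F + G) = \<Phi> F + \<Phi> G) \<and> (\<forall>F G. \<Phi> (F * G) = \<Phi> F * \<Phi> G) \<and>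
     (\<forall>a. \<Phi> (mps_const a) = mps_const a)}"

text \<open>The right group is embedded in the contact group as the pairs \<open>(\<Phi>, 1)\<close>.\<close>

definition G_equivalent :: "equiv_kind \<Rightarrow> ('k :: field, 'v) mps \<Rightarrow> ('k, 'v) mps \<Rightarrow> bool" where
  "G_equivalent G f g \<longleftrightarrow>
     (\<exists>\<Phi>\<in>mps_auts. \<exists>u. u dvd 1 \<and> (G = Right_Equiv \<longrightarrow> u = 1) \<and> g = u * \<Phi> f)"

section \<open>Affine varieties, morphisms and etale morphisms\<close>

type_synonym 'k mpoly = "(nat \<Rightarrow>\<^sub>0 nat) \<Rightarrow>\<^sub>0 'k"

definition mpoly_const :: "'k :: zero \<Rightarrow> 'k mpoly" where
  "mpoly_const c = Poly_Mapping.single 0 c"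

definition mpoly_var :: "nat \<Rightarrow> 'k :: zero_neq_one mpoly" where
  "mpoly_var i = Poly_Mapping.single (Poly_Mapping.single i 1) 1"

text \<open>The subring \<open>K[y\<^sub>0, \<dots>, y\<^sub>N\<^sub>-\<^sub>1]\<close>.\<close>

definition mpolys :: "nat \<Rightarrow> 'k :: zero mpoly set" where
  "mpolys N = {p. \<forall>m\<in>Poly_Mapping.keys p. Poly_Mapping.keys m \<subseteq> {..<N}}"

definition mpoly_eval :: "('k \<Rightarrow> 'r) \<Rightarrow> (nat \<Rightarrow> 'r) \<Rightarrow> 'k :: zero mpoly \<Rightarrow> 'r :: comm_ring_1" where
  "mpoly_eval \<iota> a p = (\<Sum>m\<in>Poly_Mapping.keys p.
     \<iota> (Poly_Mapping.lookup p m) * (\<Prod>i\<in>Poly_Mapping.keys m. a i ^ Poly_Mapping.lookup m i))"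

abbreviation mpoly_at :: "(nat \<Rightarrow> 'k) \<Rightarrow> 'k :: comm_ring_1 mpoly \<Rightarrow> 'k" where
  "mpoly_at \<equiv> mpoly_eval (\<lambda>c. c)"

abbreviation mpoly_subst :: "(nat \<Rightarrow> 'k mpoly) \<Rightarrow> 'k :: comm_ring_1 mpoly \<Rightarrow> 'k mpoly" where
  "mpoly_subst \<equiv> mpoly_eval mpoly_const"

text \<open>An affine scheme of finite type over \<open>K\<close> (not necessarily reduced) is given as a closed
  subscheme of some affine space, i.e. by an ideal of \<open>K[y\<^sub>0, \<dots>, y\<^sub>N\<^sub>-\<^sub>1]\<close>; its coordinate ring is the
  residue class ring. As \<open>K\<close> is algebraically closed, the closed points are the common zeros in
  \<open>K\<^sup>N\<close> of the ideal (coordinates with index \<open>\<ge> N\<close> are set to 0).\<close>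

record (overloaded) 'k affine =
  adim :: nat
  aideal :: "'k mpoly set"

definition affine_variety :: "'k :: field affine \<Rightarrow> bool" where
  "affine_variety T \<longleftrightarrow> aideal T \<subseteq> mpolys (adim T) \<and> 0 \<in> aideal T \<and>
     (\<forall>p\<in>aideal T. \<forall>q\<in>aideal T. p + q \<in> aideal T) \<and>
     (\<forall>p\<in>aideal T. \<forall>q\<in>mpolys (adim T). q * p \<in> aideal T)"

definition affine_space :: "nat \<Rightarrow> 'k :: field affine" where
  "affine_space N = \<lparr>adim = N, aideal = {0}\<rparr>"

definition points :: "'k :: field affine \<Rightarrow> (nat \<Rightarrow> 'k) set" where
  "points T = {a. (\<forall>i\<ge>adim T. a i = 0) \<and> (\<forall>p\<in>aideal T. mpoly_at a p = 0)}"

text \<open>A morphism \<open>S \<rightarrow> T\<close>, i.e. a \<open>K\<close>-algebra homomorphism of the coordinate rings from \<open>T\<close> to \<open>S\<close>,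
  is given by representatives \<open>P i\<close> of the images of the coordinate functions of \<open>T\<close>. Two tuples
  define the same morphism iff they agree modulo the ideal of \<open>S\<close>.\<close>

definition morphism :: "'k :: field affine \<Rightarrow> 'k affine \<Rightarrow> (nat \<Rightarrow> 'k mpoly) \<Rightarrow> bool" where
  "morphism S T P \<longleftrightarrow> (\<forall>i<adim T. P i \<in> mpolys (adim S)) \<and>
     (\<forall>p\<in>aideal T. mpoly_subst P p \<in> aideal S)"

definition same_morphism ::
    "'k :: field affine \<Rightarrow> 'k affine \<Rightarrow> (nat \<Rightarrow> 'k mpoly) \<Rightarrow> (nat \<Rightarrow> 'k mpoly) \<Rightarrow> bool" where
  "same_morphism S T P Q \<longleftrightarrow> (\<forall>i<adim T. P i - Q i \<in> aideal S)"

text \<open>\<open>morphism_comp Q P\<close> is \<open>Q\<close> after \<open>P\<close>.\<close>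

definition morphism_comp :: "(nat \<Rightarrow> 'k :: field mpoly) \<Rightarrow> (nat \<Rightarrow> 'k mpoly) \<Rightarrow> nat \<Rightarrow> 'k mpoly" where
  "morphism_comp Q P = (\<lambda>i. mpoly_subst P (Q i))"

definition morphism_at ::
    "'k :: field affine \<Rightarrow> (nat \<Rightarrow> 'k mpoly) \<Rightarrow> (nat \<Rightarrow> 'k) \<Rightarrow> nat \<Rightarrow> 'k" where
  "morphism_at T P a = (\<lambda>i. if i < adim T then mpoly_at a (P i) else 0)"

text \<open>Etale means locally of finite presentation (automatic here) and formally etale: for every
  closed subscheme \<open>Z\<^sub>0 \<subseteq> Z\<close> defined by an ideal of square zero, every commutative square formed by
  \<open>Z\<^sub>0 \<rightarrow> W\<close> and \<open>Z \<rightarrow> S\<close> has a unique diagonal \<open>Z \<rightarrow> W\<close>. As the coordinate rings of \<open>W\<close> and \<open>S\<close> are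
  finitely generated \<open>K\<close>-algebras, both existence and uniqueness of the diagonal can be checked in a
  finitely generated subalgebra, so it suffices to take \<open>Z\<close> affine of finite type over \<open>K\<close>.\<close>

definition etale :: "'k :: field affine \<Rightarrow> 'k affine \<Rightarrow> (nat \<Rightarrow> 'k mpoly) \<Rightarrow> bool" where
  "etale W S \<phi> \<longleftrightarrow> morphism W S \<phi> \<and>
     (\<forall>Z Z\<^sub>0 a b.
        affine_variety Z \<and> affine_variety Z\<^sub>0 \<and> adim Z\<^sub>0 = adim Z \<and> aideal Z \<subseteq> aideal Z\<^sub>0 \<and>
        (\<forall>p\<in>aideal Z\<^sub>0. \<forall>q\<in>aideal Z\<^sub>0. p * q \<in> aideal Z) \<and>
        morphism Z S a \<and> morphism Z\<^sub>0 W b \<and> same_morphism Z\<^sub>0 S (morphism_comp \<phi> b) a \<longrightarrow>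
        (\<exists>c. morphism Z W c \<and> same_morphism Z S (morphism_comp \<phi> c) a \<and> same_morphism Z\<^sub>0 W c b \<and>
           (\<forall>d. morphism Z W d \<and> same_morphism Z S (morphism_comp \<phi> d) a \<and> same_morphism Z\<^sub>0 W d b
              \<longrightarrow> same_morphism Z W c d)))"

text \<open>Etale neighbourhoods of a point of an affine variety; they are taken to be affine, which is no
  restriction for the notions below since a variety can be replaced by an affine open neighbourhood
  of the given point.\<close>

definition etale_neighbourhood ::
    "'k :: field affine \<Rightarrow> (nat \<Rightarrow> 'k) \<Rightarrow> 'k affine \<Rightarrow> (nat \<Rightarrow> 'k) \<Rightarrow> (nat \<Rightarrow> 'k mpoly) \<Rightarrow> bool" where
  "etale_neighbourhood W w\<^sub>0 S s\<^sub>0 \<phi> \<longleftrightarrow>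
     affine_variety W \<and> w\<^sub>0 \<in> points W \<and> etale W S \<phi> \<and> morphism_at S \<phi> w\<^sub>0 = s\<^sub>0"

section \<open>Unfoldings with trivial section\<close>

text \<open>An element of \<open>\<O>(T)[[x]]\<close> is given by a series whose coefficients are polynomials representing
  elements of the coordinate ring \<open>\<O>(T)\<close>; the definitions depend only on the residue classes.\<close>

definition fibre :: "('k :: field mpoly, 'v) mps \<Rightarrow> (nat \<Rightarrow> 'k) \<Rightarrow> ('k, 'v) mps" where
  "fibre F t = mps_map (mpoly_at t) F"

definition unfolding_of ::
    "('k :: field, 'v) mps \<Rightarrow> 'k affine \<Rightarrow> (nat \<Rightarrow> 'k) \<Rightarrow> ('k mpoly, 'v) mps \<Rightarrow> bool" where
  "unfolding_of f T t\<^sub>0 F \<longleftrightarrow>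
     affine_variety T \<and> t\<^sub>0 \<in> points T \<and> (\<forall>m. mps_coeff F m \<in> mpolys (adim T)) \<and>
     fibre F t\<^sub>0 = f \<and> (\<forall>t\<in>points T. fibre F t \<in> mps_max)"

definition etale_pullback ::
    "equiv_kind \<Rightarrow> 'k :: field affine \<Rightarrow> (nat \<Rightarrow> 'k) \<Rightarrow> ('k mpoly, 'v) mps \<Rightarrow>
     'k affine \<Rightarrow> (nat \<Rightarrow> 'k) \<Rightarrow> ('k mpoly, 'v) mps \<Rightarrow> bool" where
  "etale_pullback G S s\<^sub>0 H T t\<^sub>0 F \<longleftrightarrow>
     (\<exists>W w\<^sub>0 \<phi> \<psi>. etale_neighbourhood W w\<^sub>0 S s\<^sub>0 \<phi> \<and> morphism W T \<psi> \<and> morphism_at T \<psi> w\<^sub>0 = t\<^sub>0 \<and>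
        (\<forall>w\<in>points W. G_equivalent G (fibre H (morphism_at S \<phi> w)) (fibre F (morphism_at T \<psi> w))))"

definition complete_unfolding ::
    "equiv_kind \<Rightarrow> ('k :: field, 'v) mps \<Rightarrow> 'k affine \<Rightarrow> (nat \<Rightarrow> 'k) \<Rightarrow> ('k mpoly, 'v) mps \<Rightarrow> bool" where
  "complete_unfolding G f T t\<^sub>0 F \<longleftrightarrow> unfolding_of f T t\<^sub>0 F \<and>
     (\<forall>S s\<^sub>0 H. unfolding_of f S s\<^sub>0 H \<longrightarrow> etale_pullback G S s\<^sub>0 H T t\<^sub>0 F)"

section \<open>Formal deformations with trivial section\<close>

text \<open>The structure map of a \<open>K\<close>-algebra is written \<open>\<iota>\<close>. The rings \<open>B\<close> and \<open>C\<close> are types; the base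
  ring \<open>A\<close> of the deformation under consideration is a subring of a type.\<close>

definition nonunits :: "'a :: comm_ring_1 set \<Rightarrow> 'a set" where
  "nonunits A = {a\<in>A. \<forall>b\<in>A. a * b \<noteq> 1}"

abbreviation max_ideal :: "'a :: comm_ring_1 set" where
  "max_ideal \<equiv> nonunits UNIV"

definition complete_local_algebra :: "('k :: field \<Rightarrow> 'b :: comm_ring_1) \<Rightarrow> bool" where
  "complete_local_algebra \<iota> \<longleftrightarrow>
     \<iota> 1 = 1 \<and> (\<forall>c d. \<iota> (c + d) = \<iota> c + \<iota> d) \<and> (\<forall>c d. \<iota> (c * d) = \<iota> c * \<iota> d) \<and>
     is_ideal (max_ideal :: 'b set) \<and>
     (\<forall>I :: 'b set. is_ideal I \<longrightarrow> (\<exists>S. finite S \<and> ideal_gen S = I)) \<and>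
     (\<forall>b. \<exists>c. b - \<iota> c \<in> max_ideal) \<and>
     (\<forall>b :: nat \<Rightarrow> 'b. (\<forall>n. b (Suc n) - b n \<in> ideal_power max_ideal n) \<longrightarrow>
        (\<exists>!b'. \<forall>n. b' - b n \<in> ideal_power max_ideal n))"

definition local_alg_hom ::
    "('k :: field \<Rightarrow> 'a :: comm_ring_1) \<Rightarrow> 'a set \<Rightarrow> ('k \<Rightarrow> 'b :: comm_ring_1) \<Rightarrow> ('a \<Rightarrow> 'b) \<Rightarrow> bool" where
  "local_alg_hom \<iota>\<^sub>A A \<iota>\<^sub>B h \<longleftrightarrow>
     h 1 = 1 \<and> (\<forall>a\<in>A. \<forall>b\<in>A. h (a + b) = h a + h b) \<and> (\<forall>a\<in>A. \<forall>b\<in>A. h (a * b) = h a * h b) \<and>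
     (\<forall>c. h (\<iota>\<^sub>A c) = \<iota>\<^sub>B c) \<and> (\<forall>a\<in>nonunits A. h a \<in> max_ideal)"

definition deformation ::
    "('k :: field, 'v) mps \<Rightarrow> ('k \<Rightarrow> 'a :: comm_ring_1) \<Rightarrow> 'a set \<Rightarrow> ('a, 'v) mps \<Rightarrow> bool" where
  "deformation f \<iota> A F \<longleftrightarrow> (\<forall>m. mps_coeff F m \<in> A) \<and> F \<in> mps_max \<and>
     (\<forall>m. mps_coeff F m - \<iota> (mps_coeff f m) \<in> nonunits A)"

text \<open>\<open>(\<Phi>, u)\<close> is an equivalence from \<open>F\<close> to \<open>H\<close>. As \<open>\<mm>\<^sub>B\<close> is finitely generated, reduction modulo
  \<open>\<mm>\<^sub>B B[[x]]\<close> is reduction of all coefficients modulo \<open>\<mm>\<^sub>B\<close>.\<close>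

definition formal_equivalence ::
    "equiv_kind \<Rightarrow> (('b :: comm_ring_1, 'v) mps \<Rightarrow> ('b, 'v) mps) \<Rightarrow> ('b, 'v) mps \<Rightarrow>
     ('b, 'v) mps \<Rightarrow> ('b, 'v) mps \<Rightarrow> bool" where
  "formal_equivalence G \<Phi> u F H \<longleftrightarrow>
     \<Phi> \<in> mps_auts \<and> \<Phi> ` mps_max = mps_max \<and>
     (\<forall>X m. mps_coeff (\<Phi> X - X) m \<in> max_ideal) \<and>
     u dvd 1 \<and> (\<forall>m. mps_coeff (u - 1) m \<in> max_ideal) \<and> (G = Right_Equiv \<longrightarrow> u = 1) \<and>
     H = u * \<Phi> F"

text \<open>The test rings \<open>B\<close>, \<open>C\<close> range over all algebra structures on the types \<open>'b\<close>, \<open>'c\<close>; universality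
  over all rings is obtained by leaving these types arbitrary.\<close>

definition formally_versal ::
    "'b :: comm_ring_1 itself \<Rightarrow> 'c :: comm_ring_1 itself \<Rightarrow> equiv_kind \<Rightarrow> ('k :: field, 'v) mps \<Rightarrow>
     ('k \<Rightarrow> 'a :: comm_ring_1) \<Rightarrow> 'a set \<Rightarrow> ('a, 'v) mps \<Rightarrow> bool" where
  "formally_versal tb tc G f \<iota>\<^sub>A A F \<longleftrightarrow> deformation f \<iota>\<^sub>A A F \<and>
     (\<forall>(\<iota>\<^sub>B :: 'k \<Rightarrow> 'b) (\<iota>\<^sub>C :: 'k \<Rightarrow> 'c) \<pi> H h\<^sub>C \<Phi>\<^sub>C u\<^sub>C.
        complete_local_algebra \<iota>\<^sub>B \<and> complete_local_algebra \<iota>\<^sub>C \<and>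
        local_alg_hom \<iota>\<^sub>B UNIV \<iota>\<^sub>C \<pi> \<and> surj \<pi> \<and>
        deformation f \<iota>\<^sub>B UNIV H \<and> local_alg_hom \<iota>\<^sub>A A \<iota>\<^sub>C h\<^sub>C \<and>
        formal_equivalence G \<Phi>\<^sub>C u\<^sub>C (mps_map h\<^sub>C F) (mps_map \<pi> H) \<longrightarrow>
        (\<exists>h\<^sub>B \<Phi>\<^sub>B u\<^sub>B.
           local_alg_hom \<iota>\<^sub>A A \<iota>\<^sub>B h\<^sub>B \<and> (\<forall>a\<in>A. \<pi> (h\<^sub>B a) = h\<^sub>C a) \<and>
           formal_equivalence G \<Phi>\<^sub>B u\<^sub>B (mps_map h\<^sub>B F) H \<and>
           (\<forall>X. mps_map \<pi> (\<Phi>\<^sub>B X) = \<Phi>\<^sub>C (mps_map \<pi> X)) \<and> mps_map \<pi> u\<^sub>B = u\<^sub>C))"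

text \<open>The ring \<open>K[\<epsilon>]/\<langle>\<epsilon>\<^sup>2\<rangle>\<close>; \<open>Dual_Number a b\<close> is \<open>a + b \<epsilon>\<close>.\<close>

datatype 'k dual_number = Dual_Number (dual_re: 'k) (dual_eps: 'k)

instantiation dual_number :: (comm_ring_1) comm_ring_1
begin

definition zero_dual_number :: "'a dual_number" where "0 = Dual_Number 0 0"
definition one_dual_number :: "'a dual_number" where "1 = Dual_Number 1 0"
definition plus_dual_number :: "'a dual_number \<Rightarrow> 'a dual_number \<Rightarrow> 'a dual_number" where
  "x + y = Dual_Number (dual_re x + dual_re y) (dual_eps x + dual_eps y)"
definition minus_dual_number :: "'a dual_number \<Rightarrow> 'a dual_number \<Rightarrow> 'a dual_number" where
  "x - y = Dual_Number (dual_re x - dual_re y) (dual_eps x - dual_eps y)"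
definition uminus_dual_number :: "'a dual_number \<Rightarrow> 'a dual_number" where
  "- x = Dual_Number (- dual_re x) (- dual_eps x)"
definition times_dual_number :: "'a dual_number \<Rightarrow> 'a dual_number \<Rightarrow> 'a dual_number" where
  "x * y = Dual_Number (dual_re x * dual_re y) (dual_re x * dual_eps y + dual_eps x * dual_re y)"

instance
  by intro_classes
    (simp_all add: zero_dual_number_def one_dual_number_def plus_dual_number_def
      minus_dual_number_def uminus_dual_number_def times_dual_number_def algebra_simps)

end

definition semi_universal ::
    "'b :: comm_ring_1 itself \<Rightarrow> 'c :: comm_ring_1 itself \<Rightarrow> equiv_kind \<Rightarrow> ('k :: field, 'v) mps \<Rightarrow>
     ('k \<Rightarrow> 'a :: comm_ring_1) \<Rightarrow> 'a set \<Rightarrow> ('a, 'v) mps \<Rightarrow> bool" where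
  "semi_universal tb tc G f \<iota>\<^sub>A A F \<longleftrightarrow> formally_versal tb tc G f \<iota>\<^sub>A A F \<and>
     (\<forall>h h' :: 'a \<Rightarrow> 'k dual_number.
        local_alg_hom \<iota>\<^sub>A A (\<lambda>c. Dual_Number c 0) h \<and> local_alg_hom \<iota>\<^sub>A A (\<lambda>c. Dual_Number c 0) h' \<and>
        (\<exists>\<Phi> u. formal_equivalence G \<Phi> u (mps_map h F) (mps_map h' F)) \<longrightarrow>
        (\<forall>a\<in>A. h a = h' a))"

text \<open>\<open>K[[t\<^sub>0, \<dots>, t\<^sub>l\<^sub>-\<^sub>1]]\<close> as a subring of the series in countably many variables.\<close>

definition power_series_ring :: "nat \<Rightarrow> ('k :: field, nat) mps set" where
  "power_series_ring l = {a. \<forall>m. mps_coeff a m \<noteq> 0 \<longrightarrow> Poly_Mapping.keys m \<subseteq> {..<l}}"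

section \<open>The unfolding\<close>

definition linear_unfolding ::
    "('k :: field, 'v) mps \<Rightarrow> nat \<Rightarrow> (nat \<Rightarrow> ('v \<Rightarrow>\<^sub>0 nat) \<Rightarrow>\<^sub>0 'k) \<Rightarrow> ('k mpoly, 'v) mps" where
  "linear_unfolding f l g = mps_map mpoly_const f +
     (\<Sum>i<l. mps_const (mpoly_var i) * mps_map mpoly_const (mps_of_mpoly (g i)))"

text \<open>A family over \<open>K[t]\<close>, viewed as a family over \<open>K[[t]]\<close>.\<close>

definition formal_family :: "('k :: field mpoly, 'v) mps \<Rightarrow> (('k, nat) mps, 'v) mps" where
  "formal_family F = mps_map mps_of_mpoly F"

end

theory Submission
  imports Defs
begin

text \<open>Write the tangent image of \<^term>\<open>f\<close> as the set of all \<open>\<Sum> \<xi>\<^sub>i \<partial>\<^sub>i f + v f\<close> with \<open>\<xi>\<^sub>i \<in> \<mm>\<close>, where \<open>v = 0\<close> for right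
  equivalence. Finite codimension and the generators \<open>g\<^sub>j\<close> solve the infinitesimal equation
  \<open>x\<^sup>\<beta> = \<Sum> \<xi>\<^sub>i \<partial>\<^sub>i f + \<Sum> c\<^sub>j g\<^sub>j + v f\<close> for every monomial.

  Formal versality: the equation \<open>H = u \<cdot> F(\<phi>, b)\<close> over \<open>B\<close> is solved by a Newton iteration with the fixed
  derivative at \<open>f\<close>. It starts at an arbitrary lift of the solution over \<open>C\<close>, and all
  errors and corrections lie in \<open>\<mm>\<^sub>B\<^sup>n I\<close>, where \<open>I\<close> is the kernel of \<open>B \<rightarrow> C\<close>. The same iteration with respect to
  the order in \<open>x\<close> proves finite determinacy in all characteristics, and over the dual numbers a single
  step gives semi-universality.

  Completeness needs no approximation theorem: choosing one direction \<open>(\<xi>, c, v)\<close> for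
  each monomial of degree at most \<open>k\<close> gives a map from an affine space to the \<open>k\<close>-jets with identity derivative
  at the origin. Its fibre product with \<open>S\<close> is etale over \<open>S\<close> near \<open>s\<^sub>0\<close>. There the \<open>k\<close>-jets of the two families
  are equivalent, and finite determinacy, which holds with a uniform bound near \<open>s\<^sub>0\<close>, does the rest.\<close>

section \<open>Monomials and coefficients\<close>

text \<open>One derivative serves the whole iteration because two sizes are kept apart: an ideal
  \<open>E\<close> containing the corrections and an ideal \<open>M\<close> containing the deviation
  from (identity, 1, \<open>f\<close>). Replacing the derivative at the current point by the one at
  \<open>f\<close> costs only terms in \<open>E * M\<close> and \<open>E * E\<close>, which lie
  deeper than the old error. Three choices of (\<open>E\<close>, \<open>M\<close>) give versality,
  determinacy and the computation over the dual numbers. The linear equation is solved over K and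
  transported coefficientwise to every K-algebra; no vector field is integrated, so no division by
  integers occurs.

  The trivial section admits only vector fields vanishing at the origin, which is why the
  infinitesimal equation is posed for the monomials other than 1.

  For completeness the obstacle is that the degree up to which a jet decides the class may depend on
  the fibre. A bound valid near the base point has to be found before the order of the jets can be
  fixed; it comes from bounding the codimension of the tangent images of the nearby fibres.\<close>

definition mdeg :: "('v \<Rightarrow>\<^sub>0 nat) \<Rightarrow> nat" where
  "mdeg m = (\<Sum>i\<in>Poly_Mapping.keys m. Poly_Mapping.lookup m i)"

lemma mdeg_superset:
  "finite A \<Longrightarrow> Poly_Mapping.keys m \<subseteq> A \<Longrightarrow> mdeg m = (\<Sum>i\<in>A. Poly_Mapping.lookup m i)"
  unfolding mdeg_def by (rule sum.mono_neutral_left) (auto simp: in_keys_iff)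

lemma keys_add_nat:
  "Poly_Mapping.keys (a + b :: 'v \<Rightarrow>\<^sub>0 nat) = Poly_Mapping.keys a \<union> Poly_Mapping.keys b"
  by (auto simp: in_keys_iff lookup_add)

lemma mdeg_add: "mdeg (a + b) = mdeg a + mdeg b"
proof -
  let ?A = "Poly_Mapping.keys a \<union> Poly_Mapping.keys b"
  have "mdeg a = (\<Sum>i\<in>?A. Poly_Mapping.lookup a i)" "mdeg b = (\<Sum>i\<in>?A. Poly_Mapping.lookup b i)"
    "mdeg (a + b) = (\<Sum>i\<in>?A. Poly_Mapping.lookup (a + b) i)"
    by (rule mdeg_superset; simp add: keys_add_nat)+
  then show ?thesis by (simp add: lookup_add sum.distrib)
qed

lemma mdeg_0 [simp]: "mdeg 0 = 0"
  by (simp add: mdeg_def)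

lemma mdeg_eq_0_iff [simp]: "mdeg m = 0 \<longleftrightarrow> m = 0"
  by (auto simp: mdeg_def in_keys_iff intro!: poly_mapping_eqI)

lemma mdeg_single [simp]: "mdeg (Poly_Mapping.single i n) = n"
  by (cases "n = 0") (auto simp: mdeg_def)

lemma finite_monoms:
  assumes "finite V"
  shows "finite {m :: 'v \<Rightarrow>\<^sub>0 nat. Poly_Mapping.keys m \<subseteq> V \<and> mdeg m \<le> n}"
proof -
  have "Poly_Mapping.lookup ` {m. Poly_Mapping.keys m \<subseteq> V \<and> mdeg m \<le> n} \<subseteq>
      {h. \<forall>x. (x \<in> V \<longrightarrow> h x \<in> {..n}) \<and> (x \<notin> V \<longrightarrow> h x = 0)}"
  proof (clarsimp, safe)
    fix m :: "'v \<Rightarrow>\<^sub>0 nat" and x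
    assume *: "Poly_Mapping.keys m \<subseteq> V" "mdeg m \<le> n"
    show "Poly_Mapping.lookup m x \<le> n"
    proof (cases "x \<in> Poly_Mapping.keys m")
      case True
      then have "Poly_Mapping.lookup m x \<le> mdeg m"
        unfolding mdeg_def by (intro member_le_sum) auto
      with * show ?thesis by simp
    qed (simp add: in_keys_iff)
    show "Poly_Mapping.lookup m x = 0" if "x \<notin> V"
      using that *(1) by (auto simp: in_keys_iff)
  qed
  moreover have "finite {h. \<forall>x. (x \<in> V \<longrightarrow> h x \<in> {..n}) \<and> (x \<notin> V \<longrightarrow> h x = 0)}"
    by (rule finite_set_of_finite_funs) (use assms in auto)
  ultimately have "finite (Poly_Mapping.lookup ` {m. Poly_Mapping.keys m \<subseteq> V \<and> mdeg m \<le> n})"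
    by (rule finite_subset)
  then show ?thesis by (rule finite_imageD) (simp add: inj_on_def lookup_inject)
qed

lemma finite_monoms_UNIV:
  "finite {m :: 'v :: finite \<Rightarrow>\<^sub>0 nat. mdeg m \<le> n}"
  "finite {m :: 'v :: finite \<Rightarrow>\<^sub>0 nat. mdeg m < n}"
  "finite {m :: 'v :: finite \<Rightarrow>\<^sub>0 nat. mdeg m = n}"
proof -
  show *: "finite {m :: 'v \<Rightarrow>\<^sub>0 nat. mdeg m \<le> n}"
    using finite_monoms[of "UNIV :: 'v set" n] by simp
  show "finite {m :: 'v \<Rightarrow>\<^sub>0 nat. mdeg m < n}" "finite {m :: 'v \<Rightarrow>\<^sub>0 nat. mdeg m = n}"
    by (rule finite_subset[OF _ *]; auto)+
qed

lemma monom_nonzeroE: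
  assumes "m \<noteq> (0 :: 'v \<Rightarrow>\<^sub>0 nat)"
  obtains i k where "m = Poly_Mapping.single i (Suc 0) + k" "i \<in> Poly_Mapping.keys m"
proof -
  obtain i where i: "i \<in> Poly_Mapping.keys m"
    using assms by (metis keys_eq_empty ex_in_conv)
  then have "m = Poly_Mapping.single i (Suc 0) + (m - Poly_Mapping.single i (Suc 0))"
    by (intro poly_mapping_eqI) (auto simp: lookup_add lookup_minus lookup_single when_def in_keys_iff)
  with that i show ?thesis by blast
qed

lemma monom_single_diff:
  "i \<in> Poly_Mapping.keys m \<Longrightarrow> m - Poly_Mapping.single i (Suc 0) + Poly_Mapping.single i (Suc 0) = m"
  by (intro poly_mapping_eqI) (auto simp: lookup_add lookup_minus lookup_single when_def in_keys_iff)

lemma single_Suc_0_eq_iff [simp]: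
  "Poly_Mapping.single i (Suc 0) = Poly_Mapping.single j (Suc 0) \<longleftrightarrow> i = j"
  by (metis lookup_single_eq lookup_single_not_eq nat.distinct(1))

lemma single_Suc_0_neq_0 [simp]: "Poly_Mapping.single i (Suc 0) \<noteq> 0" "0 \<noteq> Poly_Mapping.single i (Suc 0)"
  by (metis lookup_single_eq lookup_zero nat.distinct(1))+

lemma monom_induct [case_names zero step]:
  assumes "P (0 :: 'v \<Rightarrow>\<^sub>0 nat)" "\<And>i m. P m \<Longrightarrow> P (Poly_Mapping.single i (Suc 0) + m)"
  shows "P m"
proof (induction "mdeg m" arbitrary: m)
  case 0
  then show ?case using assms(1) by (metis mdeg_eq_0_iff)
next
  case (Suc n)
  from Suc.hyps(2) have "m \<noteq> 0" by (metis mdeg_0 nat.distinct(1))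
  then obtain i k where ik: "m = Poly_Mapping.single i (Suc 0) + k" using monom_nonzeroE by blast
  with Suc.hyps(2) have "n = mdeg k" by (simp add: mdeg_add)
  from Suc.hyps(1)[OF this] show ?case unfolding ik by (rule assms(2))
qed

lemma monom_split_deg:
  assumes "d \<le> mdeg m"
  shows "\<exists>a b. m = a + b \<and> mdeg b = d"
  using assms
proof (induction d)
  case 0
  then show ?case by (intro exI[of _ m] exI[of _ 0]) auto
next
  case (Suc d)
  then obtain a b where ab: "m = a + b" "mdeg b = d" by auto
  with Suc have "a \<noteq> 0" by (auto simp: mdeg_add)
  then obtain i k where "a = Poly_Mapping.single i (Suc 0) + k" using monom_nonzeroE by blast
  with ab show ?case
    by (intro exI[of _ k] exI[of _ "Poly_Mapping.single i (Suc 0) + b"]) (auto simp: mdeg_add ac_simps)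
qed

text \<open>A saturated chain of divisors of \<open>m\<close>, one in each degree. In a quotient of
  small dimension the classes of these divisors must become linearly dependent.\<close>

lemma monom_chain:
  "\<exists>a. a 0 = 0 \<and> a (mdeg m) = m \<and> (\<forall>j<mdeg m. \<exists>i. a (Suc j) = a j + Poly_Mapping.single i (Suc 0))"
proof (induction m rule: monom_induct)
  case zero
  then show ?case by auto
next
  case (step i m)
  then obtain a where a: "a 0 = 0" "a (mdeg m) = m"
    "\<forall>j<mdeg m. \<exists>i. a (Suc j) = a j + Poly_Mapping.single i (Suc 0)" by blast
  let ?a = "a(Suc (mdeg m) := Poly_Mapping.single i (Suc 0) + m)"
  have "\<exists>i'. ?a (Suc j) = ?a j + Poly_Mapping.single i' (Suc 0)" if "j < Suc (mdeg m)" for j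
    using that a by (cases "j = mdeg m") (auto simp: ac_simps)
  then show ?case using a
    by (intro exI[of _ ?a]) (auto simp: mdeg_add)
qed

definition mpow :: "('v \<Rightarrow> 'a :: comm_monoid_mult) \<Rightarrow> ('v \<Rightarrow>\<^sub>0 nat) \<Rightarrow> 'a" where
  "mpow y m = (\<Prod>i\<in>Poly_Mapping.keys m. y i ^ Poly_Mapping.lookup m i)"

lemma mpow_superset:
  "finite A \<Longrightarrow> Poly_Mapping.keys m \<subseteq> A \<Longrightarrow> mpow y m = (\<Prod>i\<in>A. y i ^ Poly_Mapping.lookup m i)"
  unfolding mpow_def by (rule prod.mono_neutral_left) (auto simp: in_keys_iff)

lemma mpow_0 [simp]: "mpow y 0 = 1"
  by (simp add: mpow_def)

lemma mpow_add: "mpow y (a + b) = mpow y a * mpow y b"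
proof -
  let ?A = "Poly_Mapping.keys a \<union> Poly_Mapping.keys b"
  have "mpow y a = (\<Prod>i\<in>?A. y i ^ Poly_Mapping.lookup a i)"
    "mpow y b = (\<Prod>i\<in>?A. y i ^ Poly_Mapping.lookup b i)"
    "mpow y (a + b) = (\<Prod>i\<in>?A. y i ^ Poly_Mapping.lookup (a + b) i)"
    by (rule mpow_superset; simp add: keys_add_nat)+
  then show ?thesis by (simp add: lookup_add prod.distrib power_add)
qed

lemma mpow_single [simp]: "mpow y (Poly_Mapping.single i n) = y i ^ n"
  by (cases "n = 0") (auto simp: mpow_def)

section \<open>Coefficients, constants and monomial series\<close>

lemmas mps_coeff_simps [simp] =
  zero_mps.rep_eq plus_mps.rep_eq minus_mps.rep_eq uminus_mps.rep_eq mps_map.rep_eq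
lemmas mps_coeff_one = one_mps.rep_eq
lemmas mps_coeff_mult = times_mps.rep_eq
lemmas mps_coeff_const = mps_const.rep_eq

lemma mps_coeff_pderiv: "mps_coeff (mps_pderiv i F) m =
    of_nat (Suc (Poly_Mapping.lookup m i)) * mps_coeff F (m + Poly_Mapping.single i (Suc 0))"
  by (simp add: mps_pderiv.rep_eq)

lemma mps_coeff_sum [simp]: "mps_coeff (\<Sum>i\<in>A. F i) m = (\<Sum>i\<in>A. mps_coeff (F i) m)"
  by (induction A rule: infinite_finite_induct) auto

lemma mps_const_coeff_0 [simp]: "mps_coeff (mps_const c) 0 = c"
  by (simp add: mps_coeff_const)

lemma mps_const_0 [simp]: "mps_const 0 = (0 :: ('a :: comm_ring_1, 'v) mps)"
  by (rule mps_eqI) (simp add: mps_coeff_const)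

lemma mps_const_1 [simp]: "mps_const 1 = (1 :: ('a :: comm_ring_1, 'v) mps)"
  by (rule mps_eqI) (simp add: mps_coeff_const mps_coeff_one)

lemma mps_const_add: "mps_const (c + d) = mps_const c + (mps_const d :: ('a :: comm_ring_1, 'v) mps)"
  by (rule mps_eqI) (simp add: mps_coeff_const)

lemma mps_coeff_const_mult [simp]: "mps_coeff (mps_const c * F) m = c * mps_coeff F m"
proof -
  have "mps_coeff (mps_const c * F) m =
      (\<Sum>(a, b)\<in>{(0 :: 'b \<Rightarrow>\<^sub>0 nat, m)}. mps_coeff (mps_const c) a * mps_coeff F b)"
    unfolding mps_coeff_mult
    by (rule sum.mono_neutral_right[OF finite_monom_splits]) (auto simp: mps_coeff_const split: if_splits)
  then show ?thesis by simp
qed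

lemma mps_const_mult: "mps_const (c * d) = mps_const c * (mps_const d :: ('a :: comm_ring_1, 'v) mps)"
  by (rule mps_eqI) (simp add: mps_coeff_const)

lemma mps_coeff_mult_0: "mps_coeff (F * G) 0 = mps_coeff F 0 * mps_coeff G 0"
proof -
  have "{(a, b). a + b = (0 :: 'b \<Rightarrow>\<^sub>0 nat)} = {(0, 0)}"
    by (auto, (metis add_is_0 mdeg_0 mdeg_add mdeg_eq_0_iff)+)
  then show ?thesis by (simp add: mps_coeff_mult)
qed

definition mps_monom :: "('v \<Rightarrow>\<^sub>0 nat) \<Rightarrow> ('a :: comm_ring_1, 'v) mps" where
  "mps_monom a = Abs_mps (\<lambda>m. if m = a then 1 else 0)"

lemma mps_coeff_monom: "mps_coeff (mps_monom a) m = (if m = a then 1 else 0)"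
  by (simp add: mps_monom_def Abs_mps_inverse)

abbreviation mps_var :: "'v \<Rightarrow> ('a :: comm_ring_1, 'v) mps" where
  "mps_var i \<equiv> mps_monom (Poly_Mapping.single i (Suc 0))"

lemma mps_monom_mult_coeff_add [simp]: "mps_coeff (mps_monom a * F) (a + k) = mps_coeff F k"
proof -
  have "mps_coeff (mps_monom a * F) (a + k) =
      (\<Sum>(p, q)\<in>{(a, k)}. mps_coeff (mps_monom a) p * mps_coeff F q)"
    unfolding mps_coeff_mult
    by (rule sum.mono_neutral_right[OF finite_monom_splits]) (auto simp: mps_coeff_monom split: if_splits)
  then show ?thesis by (simp add: mps_coeff_monom)
qed

lemma mps_monom_mult_coeff_eq_0:
  assumes "\<nexists>k. m = a + k"
  shows "mps_coeff (mps_monom a * F) m = 0"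
  unfolding mps_coeff_mult
  by (rule sum.neutral) (use assms in \<open>auto simp: mps_coeff_monom\<close>)

lemma mps_monom_0 [simp]: "mps_monom 0 = 1"
  by (rule mps_eqI) (simp add: mps_coeff_monom mps_coeff_one)

lemma mps_monom_add: "mps_monom (a + b) = mps_monom a * mps_monom b"
proof (rule mps_eqI)
  fix m
  show "mps_coeff (mps_monom (a + b)) m = mps_coeff (mps_monom a * mps_monom b :: ('a, 'b) mps) m"
  proof (cases "\<exists>k. m = a + k")
    case True
    then show ?thesis by (auto simp: mps_coeff_monom)
  next
    case False
    then show ?thesis by (auto simp: mps_monom_mult_coeff_eq_0 mps_coeff_monom)
  qed
qed

lemma mpow_mps_var [simp]: "mpow mps_var m = mps_monom m"
  by (induction m rule: monom_induct) (simp_all add: mpow_add mps_monom_add)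

section \<open>Ring homomorphisms and their coefficientwise extension\<close>

locale ring_morphism =
  fixes h :: "'a :: comm_ring_1 \<Rightarrow> 'b :: comm_ring_1"
  assumes one: "h 1 = 1"
    and add: "h (x + y) = h x + h y"
    and mult: "h (x * y) = h x * h y"
begin

lemma zero: "h 0 = 0"
  using add[of 0 0] by simp

lemma uminus: "h (- x) = - h x"
  using add[of x "- x"] zero by (simp add: eq_neg_iff_add_eq_0 add.commute)

lemma minus: "h (x - y) = h x - h y"
  using add[of x "- y"] uminus by simp

lemma sum: "h (sum F A) = (\<Sum>x\<in>A. h (F x))"
  by (induction A rule: infinite_finite_induct) (auto simp: zero add)

lemma prod: "h (prod F A) = (\<Prod>x\<in>A. h (F x))"
  by (induction A rule: infinite_finite_induct) (auto simp: one mult)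

lemma power: "h (x ^ n) = h x ^ n"
  by (induction n) (auto simp: one mult)

lemma of_nat: "h (of_nat n) = of_nat n"
  by (induction n) (auto simp: zero one add)

lemma mpow: "h (mpow y m) = mpow (\<lambda>i. h (y i)) m"
  by (simp add: mpow_def prod power)

lemmas hom_simps = zero one add mult uminus minus

end

lemma ring_morphism_id: "ring_morphism (\<lambda>x. x)"
  by (simp add: ring_morphism_def)

lemma ring_morphism_const: "ring_morphism mps_const"
  by (simp add: ring_morphism_def mps_const_add mps_const_mult)

lemma ring_morphism_mps_map:
  assumes "ring_morphism h"
  shows "ring_morphism (mps_map h :: ('a :: comm_ring_1, 'v) mps \<Rightarrow> ('b :: comm_ring_1, 'v) mps)"
proof -
  interpret ring_morphism h by fact
  show ?thesis
    by standard (auto intro!: mps_eqI simp: mps_coeff_one mps_coeff_mult hom_simps sum case_prod_unfold)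
qed

lemma mps_map_const: "ring_morphism h \<Longrightarrow> mps_map h (mps_const c) = mps_const (h c)"
  by (rule mps_eqI) (simp add: mps_coeff_const ring_morphism.zero)

lemma mps_map_monom: "ring_morphism h \<Longrightarrow> mps_map h (mps_monom m) = mps_monom m"
  by (rule mps_eqI) (simp add: mps_coeff_monom ring_morphism.zero ring_morphism.one)

lemma mps_map_pderiv: "ring_morphism h \<Longrightarrow> mps_map h (mps_pderiv i F) = mps_pderiv i (mps_map h F)"
  by (rule mps_eqI)
    (simp add: mps_coeff_pderiv ring_morphism.mult ring_morphism.of_nat ring_morphism.add ring_morphism.one)

lemma mps_pderiv_add: "mps_pderiv i (F + G) = mps_pderiv i F + mps_pderiv i G"
  by (rule mps_eqI) (simp add: mps_coeff_pderiv algebra_simps)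

lemma mps_pderiv_diff: "mps_pderiv i (F - G) = mps_pderiv i F - mps_pderiv i G"
  by (rule mps_eqI) (simp add: mps_coeff_pderiv algebra_simps)

section \<open>Ideals and complete filtrations\<close>

lemma module_times: "module ((*) :: 'a :: comm_ring_1 \<Rightarrow> 'a \<Rightarrow> 'a)"
  by unfold_locales (simp_all add: algebra_simps)

lemma is_idealD:
  assumes "is_ideal J"
  shows "0 \<in> J" "a \<in> J \<Longrightarrow> b \<in> J \<Longrightarrow> a + b \<in> J" "a \<in> J \<Longrightarrow> r * a \<in> J" "a \<in> J \<Longrightarrow> a * r \<in> J"
    "a \<in> J \<Longrightarrow> - a \<in> J" "a \<in> J \<Longrightarrow> b \<in> J \<Longrightarrow> a - b \<in> J" "(\<And>x. x \<in> A \<Longrightarrow> F x \<in> J) \<Longrightarrow> sum F A \<in> J"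
proof -
  show scale: "a \<in> J \<Longrightarrow> r * a \<in> J" by (rule module.subspace_scale[OF module_times assms])
  then show "a \<in> J \<Longrightarrow> a * r \<in> J" by (simp add: mult.commute)
  show "(\<And>x. x \<in> A \<Longrightarrow> F x \<in> J) \<Longrightarrow> sum F A \<in> J"
    by (rule module.subspace_sum[OF module_times assms])
qed (fact module.subspace_0[OF module_times assms] module.subspace_add[OF module_times assms]
    module.subspace_neg[OF module_times assms] module.subspace_diff[OF module_times assms])+

lemma is_idealI:
  "0 \<in> J \<Longrightarrow> (\<And>a b. a \<in> J \<Longrightarrow> b \<in> J \<Longrightarrow> a + b \<in> J) \<Longrightarrow> (\<And>r a. a \<in> J \<Longrightarrow> r * a \<in> J) \<Longrightarrow> is_ideal J"
  by (rule module.subspaceI[OF module_times]) auto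

text \<open>Congruence modulo an ideal is written throughout as membership of a difference. The
  \<open>ideal_cong\<close> rules follow the shape of the terms, so that a congruence of composite
  expressions reduces to its parts.\<close>

lemma ideal_cong_trans: "is_ideal J \<Longrightarrow> a - b \<in> J \<Longrightarrow> b - c \<in> J \<Longrightarrow> a - c \<in> J"
  using is_idealD(2)[of J "a - b" "b - c"] by simp

lemma ideal_cong_sym: "is_ideal J \<Longrightarrow> a - b \<in> J \<Longrightarrow> b - a \<in> J"
  using is_idealD(5)[of J "a - b"] by simp

lemma ideal_cong_mult: "is_ideal J \<Longrightarrow> a - b \<in> J \<Longrightarrow> c - d \<in> J \<Longrightarrow> a * c - b * d \<in> J"
  using is_idealD(2)[of J "(a - b) * c" "b * (c - d)"] is_idealD(4)[of J "a - b" c]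
    is_idealD(3)[of J "c - d" b]
  by (simp add: algebra_simps)

lemma ideal_cong_add: "is_ideal J \<Longrightarrow> a - b \<in> J \<Longrightarrow> c - d \<in> J \<Longrightarrow> (a + c) - (b + d) \<in> J"
  using is_idealD(2)[of J "a - b" "c - d"] by (simp add: algebra_simps)

lemma ideal_cong_diff: "is_ideal J \<Longrightarrow> a - b \<in> J \<Longrightarrow> c - d \<in> J \<Longrightarrow> (a - c) - (b - d) \<in> J"
  using is_idealD(6)[of J "a - b" "c - d"] by (simp add: algebra_simps)

lemma ideal_cong_sum:
  "is_ideal J \<Longrightarrow> (\<And>x. x \<in> A \<Longrightarrow> F x - G x \<in> J) \<Longrightarrow> sum F A - sum G A \<in> J"
  by (simp add: is_idealD(7) flip: sum_subtractf)

lemma ideal_cong_mem: "is_ideal J \<Longrightarrow> a - b \<in> J \<Longrightarrow> b \<in> J \<Longrightarrow> a \<in> J"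
  using is_idealD(2)[of J "a - b" b] by simp

lemma ideal_cong_power: "is_ideal J \<Longrightarrow> a - b \<in> J \<Longrightarrow> a ^ n - b ^ n \<in> J"
  by (induction n) (auto intro: ideal_cong_mult simp: is_idealD)

lemma ideal_cong_prod:
  assumes "is_ideal J" "\<And>x. x \<in> A \<Longrightarrow> F x - G x \<in> J"
  shows "prod F A - prod G A \<in> J"
  using assms(2)
  by (induction A rule: infinite_finite_induct) (auto intro!: ideal_cong_mult assms(1) simp: is_idealD assms(1))

lemma ideal_cong_mpow:
  "is_ideal J \<Longrightarrow> (\<And>i. i \<in> Poly_Mapping.keys m \<Longrightarrow> y i - y' i \<in> J) \<Longrightarrow> mpow y m - mpow y' m \<in> J"
  unfolding mpow_def by (intro ideal_cong_prod ideal_cong_power)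

lemma is_ideal_UNIV: "is_ideal UNIV"
  by (rule is_idealI) auto

lemma is_ideal_zero: "is_ideal {0}"
  by (rule is_idealI) auto

lemma is_ideal_ideal_gen: "is_ideal (ideal_gen S)"
  by (rule module.subspace_span[OF module_times])

lemma ideal_gen_minimal: "S \<subseteq> J \<Longrightarrow> is_ideal J \<Longrightarrow> ideal_gen S \<subseteq> J"
  by (rule module.span_minimal[OF module_times])

lemma is_ideal_ideal_prod: "is_ideal (ideal_prod I J)"
  unfolding ideal_prod_def by (rule is_ideal_ideal_gen)

lemma ideal_prodI: "a \<in> I \<Longrightarrow> b \<in> J \<Longrightarrow> a * b \<in> ideal_prod I J"
  unfolding ideal_prod_def by (rule module.span_base[OF module_times]) auto

lemma ideal_prod_least:
  "is_ideal Q \<Longrightarrow> (\<And>a b. a \<in> I \<Longrightarrow> b \<in> J \<Longrightarrow> a * b \<in> Q) \<Longrightarrow> ideal_prod I J \<subseteq> Q"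
  unfolding ideal_prod_def by (rule ideal_gen_minimal) auto

lemma ideal_prod_subset: "is_ideal J \<Longrightarrow> ideal_prod I J \<subseteq> J"
  by (rule ideal_prod_least) (auto simp: is_idealD)

lemma ideal_prod_mono: "I \<subseteq> I' \<Longrightarrow> J \<subseteq> J' \<Longrightarrow> ideal_prod I J \<subseteq> ideal_prod I' J'"
  by (rule ideal_prod_least) (auto intro: ideal_prodI is_ideal_ideal_prod)

lemma is_ideal_ideal_power: "is_ideal (ideal_power I n)"
  by (cases n) (auto simp: is_ideal_UNIV is_ideal_ideal_prod)

lemma ideal_power_mult:
  assumes "a \<in> ideal_power I m" "b \<in> ideal_power I n"
  shows "a * b \<in> ideal_power I (m + n)"
  using assms
proof (induction m arbitrary: a)
  case 0
  then show ?case by (simp add: is_idealD[OF is_ideal_ideal_power])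
next
  case (Suc m)
  \<comment> \<open>With \<open>b\<close> fixed, the elements \<open>a\<close> satisfying the claim
    form an ideal, so it is enough to treat the products that generate the power.\<close>
  let ?J = "{a. a * b \<in> ideal_power I (Suc m + n)}"
  note id = is_idealD[OF is_ideal_ideal_power[of I "Suc m + n"]]
  have "is_ideal ?J"
    by (rule is_idealI) (simp_all only: mem_Collect_eq mult_zero_left distrib_right mult.assoc id)
  moreover have "x * y \<in> ?J" if "x \<in> I" "y \<in> ideal_power I m" for x y
    using ideal_prodI[OF that(1) Suc.IH[OF that(2) Suc.prems(2)]] by (simp add: mult.assoc)
  ultimately have "ideal_prod I (ideal_power I m) \<subseteq> ?J" by (rule ideal_prod_least)
  with Suc.prems(1) show ?case by auto
qed

lemma ideal_power_Suc_subset: "ideal_power I (Suc n) \<subseteq> ideal_power I n"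
  using ideal_prod_subset[OF is_ideal_ideal_power] by simp

section \<open>Order in the variables and conditions on all coefficients\<close>

definition ord_ge :: "nat \<Rightarrow> ('a :: comm_ring_1, 'v) mps set" where
  "ord_ge n = {F. \<forall>m. mdeg m < n \<longrightarrow> mps_coeff F m = 0}"

text \<open>For a finitely generated ideal \<open>J\<close> this is the extension of
  \<open>J\<close> to the series ring. The same notation is used later with a subring, to record
  that only certain parameters occur in the coefficients.\<close>

definition coeffs_in :: "'a set \<Rightarrow> ('a :: comm_ring_1, 'v) mps set" where
  "coeffs_in J = {F. \<forall>m. mps_coeff F m \<in> J}"

lemma ord_ge_0 [simp]: "ord_ge 0 = UNIV"
  by (auto simp: ord_ge_def)

lemma ord_ge_1: "ord_ge 1 = mps_max" "ord_ge (Suc 0) = mps_max"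
  by (auto simp: ord_ge_def mps_max_def)

lemma ord_ge_antimono: "m \<le> n \<Longrightarrow> ord_ge n \<subseteq> ord_ge m"
  by (auto simp: ord_ge_def)

lemma ord_ge_mult:
  assumes "F \<in> ord_ge m" "G \<in> ord_ge n"
  shows "F * G \<in> ord_ge (m + n)"
proof -
  have "mps_coeff (F * G) k = 0" if "mdeg k < m + n" for k
    unfolding mps_coeff_mult
  proof (rule sum.neutral, safe)
    fix a b
    assume "k = a + b"
    with that have "mdeg a < m \<or> mdeg b < n" by (auto simp: mdeg_add)
    with assms show "mps_coeff F a * mps_coeff G b = 0" by (auto simp: ord_ge_def)
  qed
  then show ?thesis by (simp add: ord_ge_def)
qed

lemma is_ideal_ord_ge: "is_ideal (ord_ge n)"
proof (rule is_idealI)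
  show "r * a \<in> ord_ge n" if "a \<in> ord_ge n" for r a :: "('a, 'b) mps"
    using ord_ge_mult[of r 0 a n] that by simp
qed (auto simp: ord_ge_def)

lemma is_ideal_mps_max: "is_ideal mps_max"
  using is_ideal_ord_ge[of 1] by (simp add: ord_ge_1)

lemma mps_monom_ord_ge: "mdeg m \<ge> n \<Longrightarrow> mps_monom m \<in> ord_ge n"
  by (auto simp: ord_ge_def mps_coeff_monom)

lemma mps_var_max [simp]: "mps_var i \<in> mps_max"
  using mps_monom_ord_ge[of 1 "Poly_Mapping.single i (Suc 0)"] by (simp add: ord_ge_1)

lemma is_ideal_coeffs_in:
  assumes "is_ideal J"
  shows "is_ideal (coeffs_in J)"
  by (intro is_idealI)
    (auto simp: coeffs_in_def mps_coeff_mult is_idealD(1,2)[OF assms] intro!: is_idealD(3,7)[OF assms])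

lemma coeffs_in_mult:
  "F \<in> coeffs_in I \<Longrightarrow> G \<in> coeffs_in J \<Longrightarrow> F * G \<in> coeffs_in (ideal_prod I J)"
  by (auto simp: coeffs_in_def mps_coeff_mult intro!: is_idealD(7) is_ideal_ideal_prod ideal_prodI)

lemma coeffs_in_const: "is_ideal J \<Longrightarrow> c \<in> J \<Longrightarrow> mps_const c \<in> coeffs_in J"
  by (auto simp: coeffs_in_def mps_coeff_const is_idealD)

text \<open>Three filtrations are instances: the order of a series, the powers of the maximal ideal
  of a complete local algebra, and the finite filtration of the dual numbers. Completeness is stated
  for increments in \<open>I n\<close>, which is the form the Newton iterations produce.\<close>

locale complete_filtration =
  fixes I :: "nat \<Rightarrow> 'r :: comm_ring_1 set"
  assumes I0: "I 0 = UNIV"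
    and ideal: "is_ideal (I n)"
    and Suc_subset: "I (Suc n) \<subseteq> I n"
    and mult: "a \<in> I m \<Longrightarrow> b \<in> I n \<Longrightarrow> a * b \<in> I (m + n)"
    and complete: "(\<And>n. x (Suc n) - x n \<in> I n) \<Longrightarrow> \<exists>x'. \<forall>n. x' - x n \<in> I n"
    and hausdorff: "(\<And>n. r \<in> I n) \<Longrightarrow> r = 0"
begin

lemmas idealD = is_idealD[OF ideal]

lemma antimono: "m \<le> n \<Longrightarrow> I n \<subseteq> I m"
  by (induction rule: dec_induct) (use Suc_subset in auto)

lemma mpow_mem:
  assumes "\<And>i. i \<in> Poly_Mapping.keys m \<Longrightarrow> y i \<in> I 1"
  shows "mpow y m \<in> I (mdeg m)"
  using assms
proof (induction m rule: monom_induct)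
  case zero
  then show ?case by (simp add: I0)
next
  case (step i m)
  then have "y i \<in> I 1" "mpow y m \<in> I (mdeg m)" by (auto simp: keys_add_nat)
  from mult[OF this] show ?case by (simp add: mpow_add mdeg_add)
qed

lemma eq_if_cong: "(\<And>n. x - y \<in> I n) \<Longrightarrow> x = y"
  using hausdorff[of "x - y"] by simp

end

lemma ord_ge_limit:
  fixes X :: "nat \<Rightarrow> ('a :: comm_ring_1, 'v) mps"
  assumes "\<And>n. X (Suc n) - X n \<in> ord_ge n"
  shows "\<exists>X'. \<forall>n. X' - X n \<in> ord_ge n"
proof -
  have stab: "mps_coeff (X (n + k)) m = mps_coeff (X n) m" if "mdeg m < n" for n k m
  proof (induction k)
    case (Suc k)
    then show ?case using assms[of "n + k"] that by (auto simp: ord_ge_def)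
  qed simp
  \<comment> \<open>The coefficient of \<open>m\<close> no longer changes from index
    \<open>Suc (mdeg m)\<close> on.\<close>
  define X' where "X' = Abs_mps (\<lambda>m. mps_coeff (X (Suc (mdeg m))) m)"
  have X': "mps_coeff X' m = mps_coeff (X (Suc (mdeg m))) m" for m
    by (simp add: X'_def Abs_mps_inverse)
  have "mps_coeff (X n) m = mps_coeff X' m" if "mdeg m < n" for n m
    using stab[of m "Suc (mdeg m)" "n - Suc (mdeg m)"] that by (simp add: X')
  then have "X' - X n \<in> ord_ge n" for n
    by (simp add: ord_ge_def)
  then show ?thesis by blast
qed

lemma complete_filtration_ord_ge: "complete_filtration (ord_ge :: nat \<Rightarrow> ('a :: comm_ring_1, 'v) mps set)"
proof
  show "r = 0" if "\<And>n. r \<in> ord_ge n" for r :: "('a, 'v) mps"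
  proof (rule mps_eqI)
    fix m
    show "mps_coeff r m = mps_coeff 0 m"
      using that[of "Suc (mdeg m)"] by (simp add: ord_ge_def)
  qed
  show "ord_ge (Suc n) \<subseteq> (ord_ge n :: ('a, 'v) mps set)" for n
    by (rule ord_ge_antimono) simp
qed (simp_all add: ord_ge_mult is_ideal_ord_ge ord_ge_limit)

section \<open>Evaluation of power series\<close>

text \<open>The series in the variables \<open>V\<close> only. With \<open>V = {..<l}\<close> this
  is the base ring of the formal deformation inside the series in countably many variables; with
  \<open>V = UNIV\<close> it is the whole ring. One theory of evaluation thus covers both the
  parameters and the variables of \<open>f\<close>.\<close>

definition supp_on :: "'v set \<Rightarrow> ('a :: comm_ring_1, 'v) mps set" where
  "supp_on V = {F. \<forall>m. mps_coeff F m \<noteq> 0 \<longrightarrow> Poly_Mapping.keys m \<subseteq> V}"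

lemma supp_on_add: "F \<in> supp_on V \<Longrightarrow> G \<in> supp_on V \<Longrightarrow> F + G \<in> supp_on V"
  unfolding supp_on_def by simp (metis add.right_neutral)

lemma supp_on_0: "0 \<in> supp_on V"
  by (simp add: supp_on_def)

lemma supp_on_uminus: "F \<in> supp_on V \<Longrightarrow> - F \<in> supp_on V"
  unfolding supp_on_def by simp

lemma supp_on_diff: "F \<in> supp_on V \<Longrightarrow> G \<in> supp_on V \<Longrightarrow> F - G \<in> supp_on V"
  using supp_on_add[of F V "- G"] supp_on_uminus[of G V] by simp

lemma supp_on_mult:
  assumes "F \<in> supp_on V" "G \<in> supp_on V"
  shows "F * G \<in> supp_on V"
proof -
  have "mps_coeff (F * G) m = 0" if "\<not> Poly_Mapping.keys m \<subseteq> V" for m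
    unfolding mps_coeff_mult
  proof (rule sum.neutral, safe)
    fix a b
    assume "m = a + b"
    with that have "\<not> Poly_Mapping.keys a \<subseteq> V \<or> \<not> Poly_Mapping.keys b \<subseteq> V"
      by (auto simp: keys_add_nat)
    then have "mps_coeff F a = 0 \<or> mps_coeff G b = 0"
      using assms unfolding supp_on_def by blast
    then show "mps_coeff F a * mps_coeff G b = 0" by auto
  qed
  then show ?thesis unfolding supp_on_def by blast
qed

lemma supp_on_sum: "(\<And>i. i \<in> A \<Longrightarrow> F i \<in> supp_on V) \<Longrightarrow> sum F A \<in> supp_on V"
  by (induction A rule: infinite_finite_induct) (auto intro: supp_on_add simp: supp_on_0)

lemma supp_on_const: "mps_const c \<in> supp_on V"
  by (auto simp: supp_on_def mps_coeff_const)

lemma supp_on_monom: "Poly_Mapping.keys m \<subseteq> V \<Longrightarrow> mps_monom m \<in> supp_on V"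
  by (auto simp: supp_on_def mps_coeff_monom)

lemma supp_on_UNIV: "supp_on UNIV = UNIV"
  by (auto simp: supp_on_def)

text \<open>Every monomial other than 1 is charged to one chosen variable \<open>p m\<close>
  dividing it. The quotients collect disjoint parts of \<open>F\<close>, so the order drops by
  exactly one and no new variables appear.\<close>

lemma mps_division:
  fixes F :: "('a :: comm_ring_1, 'v) mps"
  assumes "finite V" "F \<in> supp_on V" "F \<in> ord_ge (Suc n)"
  shows "\<exists>G. (\<forall>i. G i \<in> supp_on V \<and> G i \<in> ord_ge n) \<and> F = (\<Sum>i\<in>V. mps_var i * G i)"
proof -
  define p :: "('v \<Rightarrow>\<^sub>0 nat) \<Rightarrow> 'v" where "p m = (SOME i. i \<in> Poly_Mapping.keys m)" for m
  have p: "p m \<in> Poly_Mapping.keys m" if "m \<noteq> 0" for m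
    unfolding p_def using that by (metis keys_eq_empty someI_ex ex_in_conv)
  define G where "G i = Abs_mps (\<lambda>k. if p (Poly_Mapping.single i (Suc 0) + k) = i
    then mps_coeff F (Poly_Mapping.single i (Suc 0) + k) else 0)" for i
  have G: "mps_coeff (G i) k = (if p (Poly_Mapping.single i (Suc 0) + k) = i
    then mps_coeff F (Poly_Mapping.single i (Suc 0) + k) else 0)" for i k
    by (simp add: G_def Abs_mps_inverse)
  have xG: "mps_coeff (mps_var i * G i) m = (if m \<noteq> 0 \<and> p m = i then mps_coeff F m else 0)" for i m
  proof (cases "\<exists>k. m = Poly_Mapping.single i (Suc 0) + k")
    case True
    then obtain k where k: "m = Poly_Mapping.single i (Suc 0) + k" by blast
    have "m \<noteq> 0" using arg_cong[OF k, of mdeg] by (auto simp: mdeg_add)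
    moreover have "mps_coeff (mps_var i * G i) m = mps_coeff (G i) k"
      unfolding k by (rule mps_monom_mult_coeff_add)
    ultimately show ?thesis by (simp add: G k[symmetric])
  next
    case False
    have "\<not> (m \<noteq> 0 \<and> p m = i)"
      using False p[of m] monom_single_diff[of i m] by (metis add.commute)
    with False show ?thesis by (auto simp: mps_monom_mult_coeff_eq_0)
  qed
  have "Poly_Mapping.keys k \<subseteq> V" if "mps_coeff (G i) k \<noteq> 0" for i k
  proof -
    from that have "mps_coeff F (Poly_Mapping.single i (Suc 0) + k) \<noteq> 0"
      by (auto simp: G split: if_splits)
    then have "Poly_Mapping.keys (Poly_Mapping.single i (Suc 0) + k) \<subseteq> V"
      using assms(2) unfolding supp_on_def by blast
    then show ?thesis by (simp add: keys_add_nat)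
  qed
  then have "G i \<in> supp_on V" for i
    unfolding supp_on_def by blast
  moreover have "F = (\<Sum>i\<in>V. mps_var i * G i)"
  proof (rule mps_eqI)
    fix m
    show "mps_coeff F m = mps_coeff (\<Sum>i\<in>V. mps_var i * G i) m"
    proof (cases "mps_coeff F m = 0")
      case False
      have "mdeg m \<ge> Suc n" using False assms(3) by (auto simp: ord_ge_def not_less[symmetric])
      then have "m \<noteq> 0" by auto
      moreover have "Poly_Mapping.keys m \<subseteq> V" using False assms(2) by (auto simp: supp_on_def)
      ultimately have "p m \<in> V" using p by blast
      then show ?thesis using \<open>m \<noteq> 0\<close> assms(1) by (simp add: xG)
    qed (simp add: xG sum.neutral)
  qed
  moreover have "G i \<in> ord_ge n" for i
    using assms(3) by (auto simp: ord_ge_def G mdeg_add)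
  ultimately show ?thesis by (intro exI[of _ G] conjI allI)
qed

lemma additive_on_supp_sum:
  assumes "\<psi> 0 = 0" "\<And>F G. F \<in> supp_on V \<Longrightarrow> G \<in> supp_on V \<Longrightarrow> \<psi> (F + G) = \<psi> F + \<psi> G"
    "\<And>x. x \<in> A \<Longrightarrow> G x \<in> supp_on V"
  shows "\<psi> (sum G A) = (\<Sum>x\<in>A. \<psi> (G x))"
  using assms(3)
proof (induction A rule: infinite_finite_induct)
  case (insert x A)
  then have "\<psi> (G x + sum G A) = \<psi> (G x) + \<psi> (sum G A)"
    by (intro assms(2) supp_on_sum) auto
  with insert show ?case by simp
qed (simp_all add: assms(1))

text \<open>The limit of the partial sums by degree, pinned down by one congruence at each level of
  the filtration. Restricting the monomials to a finite set \<open>V\<close> keeps the partial sums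
  finite even if the index type is infinite.\<close>

definition mps_eval ::
    "(nat \<Rightarrow> 'r :: comm_ring_1 set) \<Rightarrow> ('a \<Rightarrow> 'r) \<Rightarrow> 'v set \<Rightarrow> ('v \<Rightarrow> 'r) \<Rightarrow> ('a :: comm_ring_1, 'v) mps \<Rightarrow> 'r" where
  "mps_eval I \<iota> V y F = (THE r. \<forall>n. r - (\<Sum>m | Poly_Mapping.keys m \<subseteq> V \<and> mdeg m < n.
     \<iota> (mps_coeff F m) * mpow y m) \<in> I n)"

locale mps_evaluation = complete_filtration I + base: ring_morphism \<iota>
  for I :: "nat \<Rightarrow> 'r :: comm_ring_1 set" and \<iota> :: "'a :: comm_ring_1 \<Rightarrow> 'r" +
  fixes V :: "'v set" and y :: "'v \<Rightarrow> 'r"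
  assumes finite_V: "finite V" and y_mem: "i \<in> V \<Longrightarrow> y i \<in> I 1"
begin

definition partial_sum :: "('a, 'v) mps \<Rightarrow> nat \<Rightarrow> 'r" where
  "partial_sum F n = (\<Sum>m | Poly_Mapping.keys m \<subseteq> V \<and> mdeg m < n. \<iota> (mps_coeff F m) * mpow y m)"

lemma finite_index: "finite {m. Poly_Mapping.keys m \<subseteq> V \<and> mdeg m < n}"
  by (rule finite_subset[OF _ finite_monoms[OF finite_V, of n]]) auto

lemma term_mem: "Poly_Mapping.keys m \<subseteq> V \<Longrightarrow> n \<le> mdeg m \<Longrightarrow> c * mpow y m \<in> I n"
  using mpow_mem[of m y] y_mem antimono[of n "mdeg m"] idealD(3) by blast

lemma partial_sum_Suc: "partial_sum F (Suc n) - partial_sum F n \<in> I n"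
proof -
  have "partial_sum F (Suc n) - partial_sum F n =
      (\<Sum>m\<in>{m. Poly_Mapping.keys m \<subseteq> V \<and> mdeg m < Suc n} - {m. Poly_Mapping.keys m \<subseteq> V \<and> mdeg m < n}.
        \<iota> (mps_coeff F m) * mpow y m)"
    unfolding partial_sum_def using finite_index by (subst sum_diff) auto
  also have "\<dots> \<in> I n"
    by (rule idealD(7)) (auto intro: term_mem)
  finally show ?thesis .
qed

lemma eval_ex1: "\<exists>!r. \<forall>n. r - partial_sum F n \<in> I n"
proof -
  obtain r where r: "\<forall>n. r - partial_sum F n \<in> I n"
    using complete[of "partial_sum F"] partial_sum_Suc by blast
  moreover have "r' = r" if "\<forall>n. r' - partial_sum F n \<in> I n" for r'
    using that r by (intro eq_if_cong) (meson ideal ideal_cong_sym ideal_cong_trans)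
  ultimately show ?thesis by blast
qed

abbreviation ev :: "('a, 'v) mps \<Rightarrow> 'r" where
  "ev \<equiv> mps_eval I \<iota> V y"

lemma eval_cong: "ev F - partial_sum F n \<in> I n"
  using theI'[OF eval_ex1[of F]] unfolding mps_eval_def partial_sum_def by blast

lemma eval_unique: "(\<And>n. r - partial_sum F n \<in> I n) \<Longrightarrow> ev F = r"
  using eval_cong[of F] by (intro eq_if_cong) (meson ideal ideal_cong_sym ideal_cong_trans)

text \<open>The product of the partial sums differs from the partial sum of the product exactly by
  the pairs of monomials with total degree at least \<open>n\<close>, and their terms lie in
  \<open>I n\<close>.\<close>

lemma partial_sum_mult: "partial_sum F n * partial_sum G n - partial_sum (F * G) n \<in> I n"
proof -
  let ?M = "{m. Poly_Mapping.keys m \<subseteq> V \<and> mdeg m < n}"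
  let ?t = "\<lambda>(a, b). \<iota> (mps_coeff F a) * \<iota> (mps_coeff G b) * mpow y (a + b)"
  have "partial_sum F n * partial_sum G n = (\<Sum>p\<in>?M \<times> ?M. ?t p)"
    unfolding partial_sum_def sum_product sum.cartesian_product
    by (rule sum.cong) (auto simp: mpow_add)
  also have "\<dots> = (\<Sum>p\<in>{p\<in>?M \<times> ?M. mdeg (fst p + snd p) < n}. ?t p) +
      (\<Sum>p\<in>{p\<in>?M \<times> ?M. \<not> mdeg (fst p + snd p) < n}. ?t p)"
    using finite_index
    by (subst sum.union_disjoint[symmetric]) (auto intro!: sum.cong intro: finite_subset[OF _ finite_cartesian_product])
  finally have eq: "partial_sum F n * partial_sum G n =
      (\<Sum>p\<in>{p\<in>?M \<times> ?M. mdeg (fst p + snd p) < n}. ?t p) +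
      (\<Sum>p\<in>{p\<in>?M \<times> ?M. \<not> mdeg (fst p + snd p) < n}. ?t p)" .
  have "partial_sum (F * G) n =
      (\<Sum>m\<in>?M. \<Sum>p | fst p + snd p = m. \<iota> (mps_coeff F (fst p)) * \<iota> (mps_coeff G (snd p)) * mpow y m)"
    unfolding partial_sum_def mps_coeff_mult
    by (rule sum.cong) (simp_all add: base.sum base.mult sum_distrib_right case_prod_unfold)
  also have "\<dots> = (\<Sum>(m, p)\<in>(SIGMA m:?M. {p. fst p + snd p = m}).
      \<iota> (mps_coeff F (fst p)) * \<iota> (mps_coeff G (snd p)) * mpow y m)"
    using finite_monom_splits finite_index
    by (intro sum.Sigma) (auto simp: case_prod_unfold)
  also have "\<dots> = (\<Sum>p\<in>{p\<in>?M \<times> ?M. mdeg (fst p + snd p) < n}. ?t p)"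
    by (rule sum.reindex_bij_witness[of _ "\<lambda>p. (fst p + snd p, p)" snd])
      (auto simp: keys_add_nat mdeg_add)
  finally have "partial_sum F n * partial_sum G n - partial_sum (F * G) n =
      (\<Sum>p\<in>{p\<in>?M \<times> ?M. \<not> mdeg (fst p + snd p) < n}. ?t p)"
    using eq by simp
  also have "\<dots> \<in> I n"
    by (rule idealD(7)) (auto intro!: term_mem simp: keys_add_nat)
  finally show ?thesis .
qed

lemma eval_const [simp]: "ev (mps_const c) = \<iota> c"
proof (rule eval_unique)
  fix n
  show "\<iota> c - partial_sum (mps_const c) n \<in> I n"
  proof (cases n)
    case (Suc k)
    have "partial_sum (mps_const c) n = (\<Sum>m\<in>{0}. \<iota> (mps_coeff (mps_const c) m) * mpow y m)"
      unfolding partial_sum_def using finite_index Suc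
      by (intro sum.mono_neutral_right) (auto simp: mps_coeff_const base.zero)
    then show ?thesis by (simp add: idealD)
  qed (simp add: I0)
qed

lemma eval_monom: 
  assumes "Poly_Mapping.keys a \<subseteq> V"
  shows "ev (mps_monom a) = mpow y a"
proof (rule eval_unique)
  fix n
  show "mpow y a - partial_sum (mps_monom a) n \<in> I n"
  proof (cases "mdeg a < n")
    case True
    have "partial_sum (mps_monom a) n = (\<Sum>m\<in>{a}. \<iota> (mps_coeff (mps_monom a) m) * mpow y m)"
      unfolding partial_sum_def using finite_index True assms
      by (intro sum.mono_neutral_right) (auto simp: mps_coeff_monom base.zero)
    then show ?thesis by (simp add: idealD base.one mps_coeff_monom)
  next
    case False
    then have "partial_sum (mps_monom a) n = 0"
      unfolding partial_sum_def
      by (intro sum.neutral) (auto simp: mps_coeff_monom base.zero)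
    then show ?thesis using term_mem[OF assms, of n 1] False by simp
  qed
qed

lemma eval_var [simp]: "i \<in> V \<Longrightarrow> ev (mps_var i) = y i"
  using eval_monom[of "Poly_Mapping.single i (Suc 0)"] by simp

lemma eval_ring_morphism: "ring_morphism ev"
proof
  show "ev 1 = 1" using eval_const[of 1] by (simp add: base.one)
  fix F G
  have "ev F + ev G - partial_sum (F + G) n \<in> I n" for n
  proof -
    have "partial_sum (F + G) n = partial_sum F n + partial_sum G n"
      by (simp add: partial_sum_def base.add ring_distribs sum.distrib)
    then show ?thesis using ideal_cong_add[OF ideal eval_cong eval_cong] by metis
  qed
  then show "ev (F + G) = ev F + ev G" by (rule eval_unique)
  have "ev F * ev G - partial_sum (F * G) n \<in> I n" for n
    by (rule ideal_cong_trans[OF ideal ideal_cong_mult[OF ideal eval_cong eval_cong] partial_sum_mult])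
  then show "ev (F * G) = ev F * ev G" by (rule eval_unique)
qed

lemma eval_0_cong: "ev F - \<iota> (mps_coeff F 0) \<in> I 1"
proof -
  have "{m :: 'v \<Rightarrow>\<^sub>0 nat. Poly_Mapping.keys m \<subseteq> V \<and> mdeg m < 1} = {0}" by auto
  then show ?thesis using eval_cong[of F 1] by (simp add: partial_sum_def)
qed

text \<open>Continuity is automatic: by repeated \<open>mps_division\<close> a series of order
  \<open>n\<close> is a combination of products of \<open>n\<close> variables, so
  \<open>\<psi>\<close> sends it into \<open>I n\<close>. Hence \<open>\<psi>\<close> is determined
  by its values on the variables. The laws are required on \<open>supp_on V\<close> only, because
  homomorphisms out of the formal base ring are specified only there.\<close>

lemma hom_eq_eval:
  assumes add: "\<And>F G. F \<in> supp_on V \<Longrightarrow> G \<in> supp_on V \<Longrightarrow> \<psi> (F + G) = \<psi> F + \<psi> G"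
    and mult: "\<And>F G. F \<in> supp_on V \<Longrightarrow> G \<in> supp_on V \<Longrightarrow> \<psi> (F * G) = \<psi> F * \<psi> G"
    and const: "\<And>c. \<psi> (mps_const c) = \<iota> c"
    and var: "\<And>i. i \<in> V \<Longrightarrow> \<psi> (mps_var i) = y i"
    and F: "F \<in> supp_on V"
  shows "\<psi> F = ev F"
proof -
  have zero: "\<psi> 0 = 0" using const[of 0] base.zero by simp
  note sum = additive_on_supp_sum[where \<psi> = \<psi>, OF zero add]
  have ord: "\<psi> G \<in> I n" if "G \<in> supp_on V" "G \<in> ord_ge n" for G n
    using that
  proof (induction n arbitrary: G)
    case (Suc n)
    obtain H where H: "\<And>i. H i \<in> supp_on V" "\<And>i. H i \<in> ord_ge n" "G = (\<Sum>i\<in>V. mps_var i * H i)"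
      using mps_division[OF finite_V Suc.prems] by metis
    have vs: "mps_var i \<in> supp_on V" if "i \<in> V" for i
      using that by (intro supp_on_monom) auto
    have "\<psi> G = (\<Sum>i\<in>V. y i * \<psi> (H i))"
      unfolding H(3) using H(1) vs var by (subst sum) (auto intro!: supp_on_mult sum.cong simp: mult)
    also have "\<dots> \<in> I (Suc n)"
    proof (rule idealD(7))
      fix i assume "i \<in> V"
      then have "y i * \<psi> (H i) \<in> I (1 + n)"
        using complete_filtration.mult[OF complete_filtration_axioms y_mem Suc.IH[OF H(1,2)]] by blast
      then show "y i * \<psi> (H i) \<in> I (Suc n)" by simp
    qed
    finally show ?case .
  qed (simp add: I0)
  have mon: "Poly_Mapping.keys m \<subseteq> V \<Longrightarrow> \<psi> (mps_monom m) = mpow y m" for m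
  proof (induction m rule: monom_induct)
    case zero
    then show ?case using const[of 1] by (simp add: base.one)
  next
    case (step i m)
    then have iV: "i \<in> V" and kV: "Poly_Mapping.keys m \<subseteq> V" by (auto simp: keys_add_nat)
    have "\<psi> (mps_var i * mps_monom m) = \<psi> (mps_var i) * \<psi> (mps_monom m)"
      using iV kV by (intro mult supp_on_monom) auto
    then show ?case using step.IH[OF kV] var[OF iV] by (simp add: mps_monom_add mpow_add)
  qed
  have "\<psi> F - partial_sum F n \<in> I n" for n
  proof -
    let ?M = "{m. Poly_Mapping.keys m \<subseteq> V \<and> mdeg m < n}"
    let ?P = "\<Sum>m\<in>?M. mps_const (mps_coeff F m) * mps_monom m"
    have Ps: "?P \<in> supp_on V"
      by (intro supp_on_sum supp_on_mult supp_on_const supp_on_monom) auto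
    have "\<psi> ?P = (\<Sum>m\<in>?M. \<psi> (mps_const (mps_coeff F m) * mps_monom m))"
      by (intro sum supp_on_mult supp_on_const supp_on_monom) auto
    also have "\<dots> = partial_sum F n"
      unfolding partial_sum_def
      by (intro sum.cong) (auto simp: mult supp_on_const supp_on_monom const mon)
    finally have P: "\<psi> ?P = partial_sum F n" .
    have D: "F - ?P \<in> supp_on V" by (intro supp_on_diff F Ps)
    have "\<psi> F = \<psi> (?P + (F - ?P))" by simp
    also have "\<dots> = partial_sum F n + \<psi> (F - ?P)"
      by (subst add[OF Ps D]) (simp only: P)
    finally have *: "\<psi> F - partial_sum F n = \<psi> (F - ?P)" by simp
    have "F - ?P \<in> ord_ge n"
      unfolding ord_ge_def
    proof (clarsimp)
      fix m :: "'v \<Rightarrow>\<^sub>0 nat"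
      assume "mdeg m < n"
      have "(\<Sum>k\<in>?M. mps_coeff F k * mps_coeff (mps_monom k) m) =
        (\<Sum>k\<in>?M. if k = m then mps_coeff F k else 0)"
        by (intro sum.cong) (auto simp: mps_coeff_monom)
      also have "\<dots> = mps_coeff F m"
        using F \<open>mdeg m < n\<close> finite_index[of n] by (auto simp: supp_on_def)
      finally show "mps_coeff F m = (\<Sum>k\<in>?M. mps_coeff F k * mps_coeff (mps_monom k) m)" by simp
    qed
    with D * show ?thesis using ord by simp
  qed
  then show ?thesis by (rule eval_unique[symmetric])
qed

end

section \<open>Substitution and Taylor expansion\<close>

definition mps_subst ::
    "('v :: finite \<Rightarrow> ('a :: comm_ring_1, 'w) mps) \<Rightarrow> ('a, 'v) mps \<Rightarrow> ('a, 'w) mps" where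
  "mps_subst \<phi> = mps_eval ord_ge mps_const UNIV \<phi>"

lemma mps_evaluation_subst:
  "\<forall>i. \<phi> i \<in> mps_max \<Longrightarrow> mps_evaluation ord_ge mps_const (UNIV :: 'v :: finite set) \<phi>"
  by (simp add: mps_evaluation_def mps_evaluation_axioms_def complete_filtration_ord_ge
      ring_morphism_const ord_ge_1)

lemma ring_morphism_subst: "\<forall>i. \<phi> i \<in> mps_max \<Longrightarrow> ring_morphism (mps_subst \<phi>)"
  unfolding mps_subst_def by (rule mps_evaluation.eval_ring_morphism[OF mps_evaluation_subst])

lemma subst_const: "\<forall>i. \<phi> i \<in> mps_max \<Longrightarrow> mps_subst \<phi> (mps_const c) = mps_const c"
  unfolding mps_subst_def by (rule mps_evaluation.eval_const[OF mps_evaluation_subst])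

lemma subst_monom: "\<forall>i. \<phi> i \<in> mps_max \<Longrightarrow> mps_subst \<phi> (mps_monom m) = mpow \<phi> m"
  unfolding mps_subst_def by (rule mps_evaluation.eval_monom[OF mps_evaluation_subst]) auto

lemma subst_var: "\<forall>i. \<phi> i \<in> mps_max \<Longrightarrow> mps_subst \<phi> (mps_var i) = \<phi> i"
  by (simp add: subst_monom)

lemma subst_partial_sum:
  assumes "\<forall>i. \<phi> i \<in> mps_max"
  shows "mps_subst \<phi> F - (\<Sum>k | mdeg k < n. mps_const (mps_coeff F k) * mpow \<phi> k) \<in> ord_ge n"
  using mps_evaluation.eval_cong[OF mps_evaluation_subst[OF assms], of F n]
  by (simp add: mps_subst_def mps_evaluation.partial_sum_def[OF mps_evaluation_subst[OF assms]])

lemma mps_coeff_subst: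
  assumes "\<forall>i. \<phi> i \<in> mps_max" "mdeg m < n"
  shows "mps_coeff (mps_subst \<phi> F) m = (\<Sum>k | mdeg k < n. mps_coeff F k * mps_coeff (mpow \<phi> k) m)"
  using subst_partial_sum[OF assms(1), of F n] assms(2) by (auto simp: ord_ge_def)

lemma subst_coeff_0: "\<forall>i. \<phi> i \<in> mps_max \<Longrightarrow> mps_coeff (mps_subst \<phi> F) 0 = mps_coeff F 0"
proof -
  assume *: "\<forall>i. \<phi> i \<in> mps_max"
  have "{k :: 'a \<Rightarrow>\<^sub>0 nat. mdeg k < 1} = {0}" by auto
  then show ?thesis using mps_coeff_subst[OF *, of 0 1 F] by (simp add: mps_coeff_one)
qed

lemma subst_mem_max: "\<forall>i. \<phi> i \<in> mps_max \<Longrightarrow> F \<in> mps_max \<Longrightarrow> mps_subst \<phi> F \<in> mps_max"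
  using subst_coeff_0[of \<phi> F] by (simp add: mps_max_def)

lemma subst_ord_ge:
  assumes "\<forall>i. \<phi> i \<in> mps_max" "F \<in> ord_ge n"
  shows "mps_subst \<phi> F \<in> ord_ge n"
  using mps_coeff_subst[OF assms(1), of _ n F] assms(2) by (auto simp: ord_ge_def intro!: sum.neutral)

text \<open>The source of all identities between substitutions: applied to the identity, to a
  composite and to an automorphism it gives \<open>subst_ident\<close>, \<open>subst_comp\<close>
  and \<open>auts_eq_subst\<close>.\<close>

lemma subst_unique:
  assumes "\<And>F G. \<psi> (F + G) = \<psi> F + \<psi> G" "\<And>F G. \<psi> (F * G) = \<psi> F * \<psi> G"
    "\<And>c. \<psi> (mps_const c) = mps_const c" "\<forall>i. \<psi> (mps_var i) \<in> mps_max"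
  shows "\<psi> = mps_subst (\<lambda>i. \<psi> (mps_var i))"
  unfolding mps_subst_def
  by (rule ext, rule mps_evaluation.hom_eq_eval[OF mps_evaluation_subst])
    (use assms in \<open>auto simp: supp_on_UNIV\<close>)

lemma subst_ident: "mps_subst mps_var F = F"
  using fun_cong[OF subst_unique[of "\<lambda>F. F"], of F] by simp

lemma subst_comp:
  assumes "\<forall>i. \<phi> i \<in> mps_max" "\<forall>i. \<psi> i \<in> mps_max"
  shows "mps_subst \<phi> (mps_subst \<psi> F) = mps_subst (\<lambda>i. mps_subst \<phi> (\<psi> i)) F"
proof -
  interpret \<phi>: ring_morphism "mps_subst \<phi>" using assms(1) by (rule ring_morphism_subst)
  interpret \<psi>: ring_morphism "mps_subst \<psi>" using assms(2) by (rule ring_morphism_subst)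
  have "(\<lambda>F. mps_subst \<phi> (mps_subst \<psi> F)) = mps_subst (\<lambda>i. mps_subst \<phi> (mps_subst \<psi> (mps_var i)))"
    by (rule subst_unique)
      (simp_all add: \<phi>.hom_simps \<psi>.hom_simps subst_const subst_var subst_mem_max assms)
  then show ?thesis by (simp add: fun_eq_iff subst_var assms)
qed

lemma mps_map_subst:
  assumes "ring_morphism h" "\<forall>i. \<phi> i \<in> mps_max"
  shows "mps_map h (mps_subst \<phi> F) = mps_subst (\<lambda>i. mps_map h (\<phi> i)) (mps_map h F)"
proof (rule mps_eqI)
  fix m
  interpret h: ring_morphism h by fact
  interpret mh: ring_morphism "mps_map h" by (rule ring_morphism_mps_map) fact
  have *: "\<forall>i. mps_map h (\<phi> i) \<in> mps_max"
    using assms(2) by (simp add: mps_max_def h.zero)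
  have "mps_coeff (mpow (\<lambda>i. mps_map h (\<phi> i)) k) m = h (mps_coeff (mpow \<phi> k) m)" for k
    using arg_cong[OF mh.mpow[of \<phi> k], of "\<lambda>F. mps_coeff F m"] by simp
  then show "mps_coeff (mps_map h (mps_subst \<phi> F)) m =
      mps_coeff (mps_subst (\<lambda>i. mps_map h (\<phi> i)) (mps_map h F)) m"
    by (simp add: mps_coeff_subst[OF assms(2) lessI] mps_coeff_subst[OF * lessI] h.sum h.mult)
qed

text \<open>Closed in the topology given by the order. For such ideals a congruence between series
  follows from congruences between their truncations, which are finite sums of powers.\<close>

definition ord_closed :: "('a :: comm_ring_1, 'v) mps set \<Rightarrow> bool" where
  "ord_closed Q \<longleftrightarrow> (\<forall>r. (\<forall>n. \<exists>q\<in>Q. r - q \<in> ord_ge n) \<longrightarrow> r \<in> Q)"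

lemma ord_closed_coeffs_in: "ord_closed (coeffs_in J)"
  unfolding ord_closed_def
proof (intro allI impI)
  fix r :: "('a, 'b) mps"
  assume *: "\<forall>n. \<exists>q\<in>coeffs_in J. r - q \<in> ord_ge n"
  have "mps_coeff r m \<in> J" for m
  proof -
    obtain q where "q \<in> coeffs_in J" "r - q \<in> ord_ge (Suc (mdeg m))" using * by blast
    then show ?thesis by (auto simp: coeffs_in_def ord_ge_def)
  qed
  then show "r \<in> coeffs_in J" by (simp add: coeffs_in_def)
qed

lemma ord_closed_ord_ge: "ord_closed (ord_ge k)"
  unfolding ord_closed_def
proof (intro allI impI)
  fix r :: "('a, 'b) mps"
  assume "\<forall>n. \<exists>q\<in>ord_ge k. r - q \<in> ord_ge n"
  then obtain q where "q \<in> ord_ge k" "r - q \<in> ord_ge k" by blast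
  then show "r \<in> ord_ge k" using ideal_cong_mem[OF is_ideal_ord_ge] by blast
qed

lemma ord_closedI:
  assumes "ord_closed Q" "\<And>n. \<exists>q. r - q \<in> ord_ge n \<and> q \<in> Q"
  shows "r \<in> Q"
  using assms unfolding ord_closed_def by blast

lemma subst_cong:
  assumes "is_ideal Q" "ord_closed Q" "\<forall>i. \<phi> i \<in> mps_max" "\<forall>i. \<phi>' i \<in> mps_max" "\<And>i. \<phi> i - \<phi>' i \<in> Q"
  shows "mps_subst \<phi> F - mps_subst \<phi>' F \<in> Q"
proof (rule ord_closedI[OF assms(2)])
  fix n
  let ?p = "\<lambda>\<phi>. \<Sum>k | mdeg k < n. mps_const (mps_coeff F k) * mpow \<phi> k"
  have "?p \<phi> - ?p \<phi>' \<in> Q"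
    by (intro ideal_cong_sum ideal_cong_mult ideal_cong_mpow assms) (simp_all add: is_idealD assms)
  moreover have "(mps_subst \<phi> F - mps_subst \<phi>' F) - (?p \<phi> - ?p \<phi>') \<in> ord_ge n"
    by (intro ideal_cong_diff is_ideal_ord_ge subst_partial_sum assms)
  ultimately show "\<exists>q. mps_subst \<phi> F - mps_subst \<phi>' F - q \<in> ord_ge n \<and> q \<in> Q" by blast
qed

lemma subst_coeffs_in:
  assumes "is_ideal J" "\<forall>i. \<phi> i \<in> mps_max" "F \<in> coeffs_in J"
  shows "mps_subst \<phi> F \<in> coeffs_in J"
  using assms(3)
  by (auto simp: coeffs_in_def mps_coeff_subst[OF assms(2) lessI] intro!: is_idealD(4,7)[OF assms(1)])

text \<open>Induction by the product rule: one more variable contributes its own increment, and the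
  products of two increments are discarded. Integers enter only as factors, never as
  divisors.\<close>

lemma mpow_taylor:
  assumes Q: "is_ideal Q" and \<eta>: "\<And>i j. \<eta> i * \<eta> j \<in> Q" and V: "finite V" "Poly_Mapping.keys m \<subseteq> V"
  shows "mpow (\<lambda>i. y i + \<eta> i) m - (mpow y m + (\<Sum>i\<in>V. of_nat (Poly_Mapping.lookup m i) * \<eta> i *
    mpow y (m - Poly_Mapping.single i (Suc 0)))) \<in> Q"
  using V(2)
proof (induction m rule: monom_induct)
  case zero
  then show ?case by (simp add: is_idealD[OF Q])
next
  case (step j m)
  let ?e = "\<lambda>i. Poly_Mapping.single i (Suc 0)"
  let ?D = "\<lambda>m i. of_nat (Poly_Mapping.lookup m i) * \<eta> i * mpow y (m - ?e i)"
  have j: "j \<in> V" and m: "Poly_Mapping.keys m \<subseteq> V" using step.prems by (auto simp: keys_add_nat)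
  \<comment> \<open>The truncated subtraction of exponents is harmless: where it truncates, the
    exponent in front is 0.\<close>
  have D: "?D (?e j + m) i = y j * ?D m i + (if i = j then \<eta> j * mpow y m else 0)" for i
  proof (cases "i \<in> Poly_Mapping.keys m")
    case True
    have eq: "m = ?e i + (m - ?e i)" using monom_single_diff[OF True] by (simp add: ac_simps)
    have "?e j + m - ?e i = ?e j + (m - ?e i)"
      by (subst eq) (metis add.left_commute add_diff_cancel_left')
    moreover have "y i * mpow y (m - ?e i) = mpow y m" by (subst (2) eq) (simp add: mpow_add)
    ultimately show ?thesis
      by (auto simp: mpow_add lookup_add lookup_single algebra_simps)
  next
    case False
    then show ?thesis
      by (cases "i = j") (auto simp: lookup_add lookup_single in_keys_iff when_def)
  qed
  have "(\<Sum>i\<in>V. ?D (?e j + m) i) = y j * (\<Sum>i\<in>V. ?D m i) + \<eta> j * mpow y m"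
    unfolding D using j V(1) by (simp add: sum.distrib sum_distrib_left)
  moreover have "\<eta> j * (\<Sum>i\<in>V. ?D m i) \<in> Q"
    unfolding sum_distrib_left
  proof (rule is_idealD(7)[OF Q])
    fix i
    have "\<eta> j * ?D m i = \<eta> j * \<eta> i * (of_nat (Poly_Mapping.lookup m i) * mpow y (m - ?e i))"
      by (simp add: algebra_simps)
    then show "\<eta> j * ?D m i \<in> Q" using is_idealD(4)[OF Q \<eta>] by metis
  qed
  moreover have "(y j + \<eta> j) * mpow (\<lambda>i. y i + \<eta> i) m - (y j + \<eta> j) * (mpow y m + (\<Sum>i\<in>V. ?D m i)) \<in> Q"
    by (rule ideal_cong_mult[OF Q]) (auto simp: is_idealD[OF Q] step.IH[OF m])
  ultimately show ?case
    using is_idealD(2)[OF Q] by (fastforce simp: mpow_add algebra_simps)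
qed

lemma subst_taylor:
  assumes Q: "is_ideal Q" "ord_closed Q" and \<eta>: "\<And>i j. \<eta> i * \<eta> j \<in> Q"
    and \<phi>: "\<forall>i. \<phi> i \<in> mps_max" and \<eta>_max: "\<forall>i. \<eta> i \<in> mps_max"
  shows "mps_subst (\<lambda>i. \<phi> i + \<eta> i) F - (mps_subst \<phi> F + (\<Sum>i\<in>UNIV. \<eta> i * mps_subst \<phi> (mps_pderiv i F))) \<in> Q"
proof (rule ord_closedI[OF Q(2)])
  fix n
  let ?e = "\<lambda>i. Poly_Mapping.single i (Suc 0)"
  \<comment> \<open>Truncating \<open>F\<close> below degree \<open>Suc n\<close> corresponds to
    truncating its derivatives below degree \<open>n\<close>.\<close>
  let ?M = "{k. mdeg k < Suc n}"
  let ?p = "\<lambda>\<phi>. \<Sum>k\<in>?M. mps_const (mps_coeff F k) * mpow \<phi> k"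
  let ?d = "\<lambda>i. \<Sum>k | mdeg k < n. mps_const (mps_coeff (mps_pderiv i F) k) * mpow \<phi> k"
  have mx: "\<forall>i. \<phi> i + \<eta> i \<in> mps_max" using \<phi> \<eta>_max by (simp add: mps_max_def)
  have d: "?d i = (\<Sum>k\<in>?M. mps_const (mps_coeff F k) * (of_nat (Poly_Mapping.lookup k i) * mpow \<phi> (k - ?e i)))" for i
  proof -
    have "(\<Sum>k\<in>?M. mps_const (mps_coeff F k) * (of_nat (Poly_Mapping.lookup k i) * mpow \<phi> (k - ?e i)))
      = (\<Sum>k\<in>{k\<in>?M. i \<in> Poly_Mapping.keys k}. mps_const (mps_coeff F k) * (of_nat (Poly_Mapping.lookup k i) * mpow \<phi> (k - ?e i)))"
      using finite_monoms_UNIV(2)[of "Suc n"]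
      by (intro sum.mono_neutral_right) (auto simp: in_keys_iff)
    also have "\<dots> = ?d i"
    proof (rule sum.reindex_bij_witness[of _ "\<lambda>k. k + ?e i" "\<lambda>k. k - ?e i"])
      fix k assume "k \<in> {k\<in>?M. i \<in> Poly_Mapping.keys k}"
      then have k: "k - ?e i + ?e i = k" "mdeg k < Suc n" using monom_single_diff by auto
      then show "k - ?e i + ?e i = k" by simp
      have *: "mdeg (k - ?e i) + 1 = mdeg k" using arg_cong[OF k(1), of mdeg] by (simp add: mdeg_add)
      then show "k - ?e i \<in> {k. mdeg k < n}" using k(2) by simp
      have "Suc (Poly_Mapping.lookup (k - ?e i) i) = Poly_Mapping.lookup k i"
        using arg_cong[OF k(1), of "\<lambda>k. Poly_Mapping.lookup k i"] by (simp add: lookup_add)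
      then show "mps_const (mps_coeff (mps_pderiv i F) (k - ?e i)) * mpow \<phi> (k - ?e i) =
         mps_const (mps_coeff F k) * (of_nat (Poly_Mapping.lookup k i) * mpow \<phi> (k - ?e i))"
        unfolding mps_coeff_pderiv k(1)
        by (simp only: mps_const_mult ring_morphism.of_nat[OF ring_morphism_const] mult_ac)
    qed (auto simp: mdeg_add in_keys_iff lookup_add)
    finally show ?thesis by simp
  qed
  have "?p (\<lambda>i. \<phi> i + \<eta> i) - (\<Sum>k\<in>?M. mps_const (mps_coeff F k) * (mpow \<phi> k +
      (\<Sum>i\<in>UNIV. of_nat (Poly_Mapping.lookup k i) * \<eta> i * mpow \<phi> (k - ?e i)))) \<in> Q"
    by (intro ideal_cong_sum ideal_cong_mult mpow_taylor Q \<eta>) (simp_all add: is_idealD[OF Q(1)])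
  moreover have "(\<Sum>k\<in>?M. mps_const (mps_coeff F k) * (mpow \<phi> k +
      (\<Sum>i\<in>UNIV. of_nat (Poly_Mapping.lookup k i) * \<eta> i * mpow \<phi> (k - ?e i)))) =
      ?p \<phi> + (\<Sum>i\<in>UNIV. \<eta> i * ?d i)"
    unfolding d sum_distrib_left distrib_left sum.distrib
    by (subst (2) sum.swap) (simp add: ac_simps)
  ultimately have "?p (\<lambda>i. \<phi> i + \<eta> i) - (?p \<phi> + (\<Sum>i\<in>UNIV. \<eta> i * ?d i)) \<in> Q" by simp
  moreover have "(mps_subst (\<lambda>i. \<phi> i + \<eta> i) F - (mps_subst \<phi> F + (\<Sum>i\<in>UNIV. \<eta> i * mps_subst \<phi> (mps_pderiv i F))))
     - (?p (\<lambda>i. \<phi> i + \<eta> i) - (?p \<phi> + (\<Sum>i\<in>UNIV. \<eta> i * ?d i))) \<in> ord_ge n"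
    using subst_partial_sum[OF mx, of F "Suc n"] subst_partial_sum[OF \<phi>, of F "Suc n"] ord_ge_antimono[of n "Suc n"]
    by (intro ideal_cong_diff ideal_cong_add ideal_cong_sum ideal_cong_mult is_ideal_ord_ge
        subst_partial_sum \<phi>) (auto simp: is_idealD is_ideal_ord_ge)
  ultimately show "\<exists>q. mps_subst (\<lambda>i. \<phi> i + \<eta> i) F - (mps_subst \<phi> F + (\<Sum>i\<in>UNIV. \<eta> i * mps_subst \<phi> (mps_pderiv i F)))
     - q \<in> ord_ge n \<and> q \<in> Q" by blast
qed

text \<open>The linear part of the equation to be solved by a Newton iteration with fixed derivative: \<^term>\<open>E\<close>
  contains the corrections, \<^term>\<open>M\<close> the deviation from the initial data.\<close>

lemma newton_step:
  fixes \<phi> \<xi> :: "'v :: finite \<Rightarrow> ('a :: comm_ring_1, 'v) mps"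
  assumes E: "is_ideal E" and M: "is_ideal M" "ord_closed M" and Q: "is_ideal Q" "ord_closed Q"
    and EM: "\<And>a b. a \<in> E \<Longrightarrow> b \<in> M \<Longrightarrow> a * b \<in> Q" and EE: "\<And>a b. a \<in> E \<Longrightarrow> b \<in> E \<Longrightarrow> a * b \<in> Q"
    and \<phi>: "\<forall>i. \<phi> i \<in> mps_max" "\<And>i. \<phi> i - mps_var i \<in> M"
    and \<xi>: "\<forall>i. \<xi> i \<in> mps_max" "\<And>i. \<xi> i \<in> E"
    and u: "u - 1 \<in> M" and v: "v \<in> E" and \<gamma>: "\<gamma> \<in> E" "\<And>k. mps_const (mps_coeff \<gamma> k) \<in> E"
    and F: "F - f \<in> M" "\<And>i. mps_pderiv i (F + \<gamma>) - mps_pderiv i f \<in> M"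
  shows "(u + v) * mps_subst (\<lambda>i. \<phi> i + \<xi> i) (F + \<gamma>) -
    (u * mps_subst \<phi> F + (\<Sum>i\<in>UNIV. \<xi> i * mps_pderiv i f) + \<gamma> + v * f) \<in> Q"
proof -
  note Qt = ideal_cong_trans[OF Q(1)]
  interpret \<phi>: ring_morphism "mps_subst \<phi>" using \<phi>(1) by (rule ring_morphism_subst)
  have near: "mps_subst \<phi> G - H \<in> M" if "G - H \<in> M" for G H
  proof -
    have "mps_subst \<phi> G - mps_subst mps_var G \<in> M"
      by (rule subst_cong[OF M \<phi>(1)]) (simp_all add: \<phi>(2))
    then have "mps_subst \<phi> G - G \<in> M" by (simp add: subst_ident)
    with that show ?thesis by (rule ideal_cong_trans[OF M(1), rotated])
  qed
  let ?A = "mps_subst \<phi> F"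
  let ?S = "\<Sum>i\<in>UNIV. \<xi> i * mps_pderiv i f"
  let ?B = "?A + \<gamma> + ?S"
  \<comment> \<open>The substitution \<open>\<phi>\<close> moves each monomial within
    \<open>M\<close>, and the coefficients of \<open>\<gamma>\<close> lie in \<open>E\<close>; hence
    \<open>\<gamma>\<close> is fixed modulo \<open>Q\<close>.\<close>
  have 1: "mps_subst \<phi> \<gamma> - \<gamma> \<in> Q"
  proof (rule ord_closedI[OF Q(2)])
    fix n
    let ?p = "\<lambda>\<phi>. \<Sum>k | mdeg k < n. mps_const (mps_coeff \<gamma> k) * mpow \<phi> k"
    have "?p \<phi> - ?p mps_var \<in> Q"
      unfolding sum_subtractf[symmetric] right_diff_distrib[symmetric]
      by (intro is_idealD(7)[OF Q(1)] EM \<gamma> ideal_cong_mpow M \<phi>)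
    moreover have "(mps_subst \<phi> \<gamma> - mps_subst mps_var \<gamma>) - (?p \<phi> - ?p mps_var) \<in> ord_ge n"
      by (intro ideal_cong_diff is_ideal_ord_ge subst_partial_sum \<phi>(1)) simp
    ultimately show "\<exists>q. mps_subst \<phi> \<gamma> - \<gamma> - q \<in> ord_ge n \<and> q \<in> Q" unfolding subst_ident by blast
  qed
  have 2: "(\<Sum>i\<in>UNIV. \<xi> i * mps_subst \<phi> (mps_pderiv i (F + \<gamma>))) - ?S \<in> Q"
    unfolding sum_subtractf[symmetric] right_diff_distrib[symmetric]
    by (intro is_idealD(7)[OF Q(1)] EM \<xi>(2) near F)
  have "mps_subst (\<lambda>i. \<phi> i + \<xi> i) (F + \<gamma>) -
     (mps_subst \<phi> (F + \<gamma>) + (\<Sum>i\<in>UNIV. \<xi> i * mps_subst \<phi> (mps_pderiv i (F + \<gamma>)))) \<in> Q"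
    by (intro subst_taylor Q EE \<xi> \<phi>(1))
  moreover have "(mps_subst \<phi> (F + \<gamma>) + (\<Sum>i\<in>UNIV. \<xi> i * mps_subst \<phi> (mps_pderiv i (F + \<gamma>)))) - ?B \<in> Q"
    unfolding \<phi>.add by (intro ideal_cong_add Q 1 2) (simp add: is_idealD[OF Q(1)])
  ultimately have "mps_subst (\<lambda>i. \<phi> i + \<xi> i) (F + \<gamma>) - ?B \<in> Q" by (rule Qt)
  then have 3: "(u + v) * mps_subst (\<lambda>i. \<phi> i + \<xi> i) (F + \<gamma>) - (u + v) * ?B \<in> Q"
    by (intro ideal_cong_mult Q) (simp_all add: is_idealD[OF Q(1)])
  have S: "?S \<in> E" by (intro is_idealD(4,7)[OF E] \<xi>(2))
  \<comment> \<open>These three products are the whole price for replacing \<open>u\<close> by 1 and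
    \<open>mps_subst \<phi> F\<close> by \<open>f\<close> in front of the corrections.\<close>
  have "(\<gamma> + ?S) * (u - 1) \<in> Q" by (intro EM u is_idealD(2)[OF E] \<gamma> S)
  moreover have "v * (?A - f) \<in> Q" by (intro EM v near F)
  moreover have "v * (\<gamma> + ?S) \<in> Q" by (intro EE v is_idealD(2)[OF E] \<gamma> S)
  ultimately have "(\<gamma> + ?S) * (u - 1) + v * (?A - f) + v * (\<gamma> + ?S) \<in> Q"
    by (intro is_idealD(2)[OF Q(1)])
  then have "(u + v) * ?B - (u * ?A + ?S + \<gamma> + v * f) \<in> Q"
    by (simp add: algebra_simps)
  with 3 show ?thesis by (rule Qt)
qed

section \<open>Automorphisms and units\<close>

text \<open>An element of the kernel climbs through the whole filtration, so it is 0. A preimage of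
  \<open>y\<close> is the limit of the iteration that adds the current error
  \<open>y - \<Phi> x\<close> to \<open>x\<close>; each round moves the error one level
  deeper.\<close>

lemma (in complete_filtration) unipotent_bij:
  assumes add: "\<And>x y. \<Phi> (x + y) = \<Phi> x + \<Phi> y" and unip: "\<And>n x. x \<in> I n \<Longrightarrow> \<Phi> x - x \<in> I (Suc n)"
  shows "bij \<Phi>"
proof -
  have zero: "\<Phi> 0 = 0" using add[of 0 0] by simp
  have diff: "\<Phi> (x - y) = \<Phi> x - \<Phi> y" for x y using add[of "x - y" y] by (simp add: algebra_simps)
  have mem: "\<Phi> x \<in> I n" if "x \<in> I n" for x n
    using unip[OF that] Suc_subset[of n] that idealD(2)[of "\<Phi> x - x" n x] by auto
  have "inj \<Phi>"
  proof (rule injI)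
    fix x y assume "\<Phi> x = \<Phi> y"
    then have z: "\<Phi> (x - y) = 0" by (simp add: diff)
    have "x - y \<in> I n" for n
    proof (induction n)
      case (Suc n)
      then show ?case using unip[OF Suc] z idealD(5)[of "\<Phi> (x - y) - (x - y)" "Suc n"] by simp
    qed (simp add: I0)
    then show "x = y" by (rule eq_if_cong)
  qed
  moreover have "\<exists>x. y = \<Phi> x" for y
  proof -
    define X where "X = rec_nat 0 (\<lambda>_ x. x + (y - \<Phi> x))"
    have X: "X 0 = 0" "X (Suc n) = X n + (y - \<Phi> (X n))" for n by (simp_all add: X_def)
    have err: "y - \<Phi> (X n) \<in> I n" for n
    proof (induction n)
      case (Suc n)
      have eq: "y - \<Phi> (X (Suc n)) = - (\<Phi> (y - \<Phi> (X n)) - (y - \<Phi> (X n)))"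
        by (simp add: X add diff)
      show ?case unfolding eq by (rule idealD(5)[OF unip[OF Suc]])
    qed (simp add: I0)
    then obtain x where x: "\<forall>n. x - X n \<in> I n" using complete[of X] by (auto simp: X)
    have "y - \<Phi> x \<in> I n" for n
    proof -
      have eq: "y - \<Phi> x = (y - \<Phi> (X n)) - \<Phi> (x - X n)" by (simp add: diff)
      show ?thesis unfolding eq by (intro idealD(6)[OF err] mem) (simp add: x)
    qed
    then show ?thesis using eq_if_cong by blast
  qed
  ultimately show ?thesis by (auto simp: bij_def surj_def)
qed

text \<open>After scaling by \<open>c\<close>, multiplication by \<open>F\<close> is unipotent for
  the order filtration, hence surjective, and 1 is attained.\<close>

lemma mps_unit:
  fixes F :: "('a :: comm_ring_1, 'v) mps"
  assumes "c * mps_coeff F 0 = 1"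
  shows "F dvd 1"
proof -
  interpret complete_filtration "ord_ge :: nat \<Rightarrow> ('a, 'v) mps set" by (rule complete_filtration_ord_ge)
  have 1: "mps_const c * F - 1 \<in> ord_ge 1"
    using assms by (auto simp: ord_ge_def mps_coeff_one)
  have "bij (\<lambda>G. mps_const c * F * G)"
  proof (rule unipotent_bij)
    show "mps_const c * F * G - G \<in> ord_ge (Suc n)" if "G \<in> ord_ge n" for G n
      using ord_ge_mult[OF 1 that] by (simp add: algebra_simps)
  qed (simp add: algebra_simps)
  then obtain G where "1 = mps_const c * F * G" by (metis bij_pointE)
  then show ?thesis by (intro dvdI[of 1 F "mps_const c * G"]) (simp add: ac_simps)
qed

lemma mdeg_eq_1E:
  assumes "mdeg m = 1"
  obtains i where "m = Poly_Mapping.single i (Suc 0)"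
proof -
  have "m \<noteq> 0" using assms by auto
  then obtain i k where ik: "m = Poly_Mapping.single i 1 + k" using monom_nonzeroE by (metis One_nat_def)
  then have "k = 0" using assms by (simp add: mdeg_add)
  with ik that show ?thesis by simp
qed

lemma diff_var_ord_ge_2:
  assumes "F \<in> mps_max" "\<And>k. mps_coeff F (Poly_Mapping.single k (Suc 0)) = (if k = i then 1 else 0)"
  shows "F - mps_var i \<in> ord_ge 2"
proof -
  have "mps_coeff (F - mps_var i) m = 0" if "mdeg m < 2" for m
  proof (cases "m = 0")
    case True
    then show ?thesis using assms(1) True by (simp add: mps_max_def mps_coeff_monom)
  next
    case False
    then have "mdeg m = 1" using that mdeg_eq_0_iff[of m] by linarith
    then obtain k where "m = Poly_Mapping.single k (Suc 0)" by (rule mdeg_eq_1E)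
    then show ?thesis by (simp add: assms(2) mps_coeff_monom)
  qed
  then show ?thesis by (simp add: ord_ge_def)
qed

lemma ord_ge_2_subset_max: "F \<in> ord_ge 2 \<Longrightarrow> F \<in> mps_max"
  by (simp add: ord_ge_def mps_max_def)

text \<open>If the linear part is the identity, the substitution changes a monomial only in higher
  degrees. It is therefore unipotent for the order filtration.\<close>

lemma unipotent_subst_bij:
  fixes \<phi> :: "'v :: finite \<Rightarrow> ('a :: comm_ring_1, 'v) mps"
  assumes "\<forall>i. \<phi> i - mps_var i \<in> ord_ge 2"
  shows "bij (mps_subst \<phi>)"
proof -
  interpret complete_filtration "ord_ge :: nat \<Rightarrow> ('a, 'v) mps set" by (rule complete_filtration_ord_ge)
  have \<phi>: "\<forall>i. \<phi> i \<in> mps_max"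
    by (intro allI ideal_cong_mem[OF is_ideal_mps_max ord_ge_2_subset_max[OF assms[rule_format]] mps_var_max])
  interpret \<phi>: ring_morphism "mps_subst \<phi>" using \<phi> by (rule ring_morphism_subst)
  have pw: "mpow \<phi> k - mps_monom k \<in> ord_ge (Suc (mdeg k))" for k
  proof (induction k rule: monom_induct)
    case (step i k)
    have "\<phi> i * (mpow \<phi> k - mps_monom k) \<in> ord_ge (1 + Suc (mdeg k))"
      by (rule ord_ge_mult) (use \<phi> step in \<open>auto simp: ord_ge_1\<close>)
    moreover have "(\<phi> i - mps_var i) * mps_monom k \<in> ord_ge (2 + mdeg k)"
      by (rule ord_ge_mult) (use assms in \<open>auto simp: mps_monom_ord_ge\<close>)
    ultimately have "\<phi> i * (mpow \<phi> k - mps_monom k) + (\<phi> i - mps_var i) * mps_monom k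
        \<in> ord_ge (Suc (Suc (mdeg k)))" by (intro idealD(2)) auto
    then show ?case by (simp add: mpow_add mps_monom_add mdeg_add algebra_simps)
  qed (simp add: idealD)
  show ?thesis
  proof (rule unipotent_bij)
    fix n and F :: "('a, 'v) mps"
    assume F: "F \<in> ord_ge n"
    have "mps_coeff (mps_subst \<phi> F - mps_subst mps_var F) m = 0" if "mdeg m < Suc n" for m
    proof -
      have *: "mps_coeff F k * (mps_coeff (mpow \<phi> k) m - mps_coeff (mps_monom k) m) = 0" for k
        using F pw[of k] that by (cases "mdeg k < n") (auto simp: ord_ge_def)
      show ?thesis
        using that * by (simp add: mps_coeff_subst[OF \<phi> that] mps_coeff_subst[OF _ that]
            flip: sum_subtractf right_diff_distrib)
    qed
    then show "mps_subst \<phi> F - F \<in> ord_ge (Suc n)" by (simp add: ord_ge_def subst_ident)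
  qed (rule \<phi>.add)
qed

definition linear_coeff :: "('v \<Rightarrow> ('a :: comm_ring_1, 'v) mps) \<Rightarrow> 'v \<Rightarrow> 'v \<Rightarrow> 'a" where
  "linear_coeff \<phi> i j = mps_coeff (\<phi> i) (Poly_Mapping.single j (Suc 0))"

text \<open>Composition with a linear substitution reduces to the unipotent case.\<close>

lemma subst_bij:
  fixes \<phi> :: "'v :: finite \<Rightarrow> ('a :: comm_ring_1, 'v) mps"
  assumes \<phi>: "\<forall>i. \<phi> i \<in> mps_max"
    and left: "\<And>i k. (\<Sum>j\<in>UNIV. L i j * linear_coeff \<phi> j k) = (if i = k then 1 else 0)"
    and right: "\<And>i k. (\<Sum>j\<in>UNIV. linear_coeff \<phi> i j * R j k) = (if i = k then 1 else 0)"
  shows "bij (mps_subst \<phi>)"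
proof -
  interpret \<phi>: ring_morphism "mps_subst \<phi>" using \<phi> by (rule ring_morphism_subst)
  note coeffs = mps_coeff_monom mps_max_def
  \<comment> \<open>\<open>\<psi>\<close> and \<open>\<chi>\<close> are the linear substitutions
    with matrices \<open>L\<close> and \<open>R\<close>. One composite with \<open>\<phi>\<close> is
    unipotent and shows surjectivity, the composite on the other side shows injectivity.\<close>
  define \<psi> where "\<psi> = (\<lambda>i. \<Sum>j\<in>UNIV. mps_const (L i j) * mps_var j)"
  define \<chi> where "\<chi> = (\<lambda>i. \<Sum>j\<in>UNIV. mps_const (R i j) * mps_var j)"
  have \<psi>: "\<forall>i. \<psi> i \<in> mps_max" and \<chi>: "\<forall>i. \<chi> i \<in> mps_max"
    unfolding \<psi>_def \<chi>_def by (auto intro!: is_idealD(3,7)[OF is_ideal_mps_max])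
  interpret \<chi>: ring_morphism "mps_subst \<chi>" using \<chi> by (rule ring_morphism_subst)
  have "bij (mps_subst (\<lambda>i. mps_subst \<phi> (\<psi> i)))"
  proof (intro unipotent_subst_bij allI diff_var_ord_ge_2)
    show "mps_subst \<phi> (\<psi> i) \<in> mps_max" for i using \<phi> \<psi> by (auto intro: subst_mem_max)
    show "mps_coeff (mps_subst \<phi> (\<psi> i)) (Poly_Mapping.single k (Suc 0)) = (if k = i then 1 else 0)" for i k
      using left[of i k] by (auto simp: \<psi>_def \<phi>.sum \<phi>.mult subst_const subst_var \<phi> linear_coeff_def)
  qed
  then have "surj (\<lambda>F. mps_subst \<phi> (mps_subst \<psi> F))"
    by (simp add: subst_comp[OF \<phi> \<psi>] bij_is_surj)
  then have "surj (mps_subst \<phi>)" unfolding surj_def by metis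
  moreover have "bij (mps_subst (\<lambda>i. mps_subst \<chi> (\<phi> i)))"
  proof (intro unipotent_subst_bij allI diff_var_ord_ge_2)
    fix i k :: 'v
    show "mps_subst \<chi> (\<phi> i) \<in> mps_max" using \<phi> \<chi> by (auto intro: subst_mem_max)
    let ?l = "\<Sum>j\<in>UNIV. mps_const (linear_coeff \<phi> i j) * mps_var j"
    let ?k = "Poly_Mapping.single k (Suc 0)"
    have "mps_coeff ?l 0 = 0" by (simp add: coeffs)
    moreover have "mps_coeff ?l (Poly_Mapping.single j (Suc 0)) = linear_coeff \<phi> i j" for j
      by (simp add: coeffs if_distrib[of "\<lambda>x. _ * x"] cong: if_cong)
    ultimately have "mps_coeff (\<phi> i - ?l) m = 0" if "mdeg m < 2" for m
    proof (cases "m = 0")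
      case True
      then show ?thesis using \<phi> \<open>mps_coeff ?l 0 = 0\<close> by (simp add: mps_max_def)
    next
      case False
      then have "mdeg m = 1" using that mdeg_eq_0_iff[of m] by linarith
      then obtain j where "m = Poly_Mapping.single j (Suc 0)" by (rule mdeg_eq_1E)
      then show ?thesis using \<open>\<And>j. mps_coeff ?l (Poly_Mapping.single j (Suc 0)) = linear_coeff \<phi> i j\<close>
        by (simp only: minus_mps.rep_eq) (simp add: linear_coeff_def)
    qed
    then have "\<phi> i - ?l \<in> ord_ge 2" by (simp add: ord_ge_def)
    then have "mps_subst \<chi> (\<phi> i - ?l) \<in> ord_ge 2" by (rule subst_ord_ge[OF \<chi>])
    then have "mps_coeff (mps_subst \<chi> (\<phi> i)) ?k = mps_coeff (mps_subst \<chi> ?l) ?k"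
      by (simp add: \<chi>.minus ord_ge_def)
    also have "\<dots> = (\<Sum>j\<in>UNIV. linear_coeff \<phi> i j * R j k)"
      by (simp add: \<chi>.sum \<chi>.mult subst_const subst_var \<chi>) 
        (simp add: \<chi>_def coeffs if_distrib[of "\<lambda>x. _ * x"] cong: if_cong)
    finally show "mps_coeff (mps_subst \<chi> (\<phi> i)) ?k = (if k = i then 1 else 0)"
      using right[of i k] by auto
  qed
  then have "inj (\<lambda>F. mps_subst \<chi> (mps_subst \<phi> F))"
    by (simp add: subst_comp[OF \<chi> \<phi>] bij_is_inj)
  then have "inj (mps_subst \<phi>)" unfolding inj_def by metis
  ultimately show ?thesis by (simp add: bij_def)
qed

lemma subst_auts:
  assumes "\<forall>i. \<phi> i \<in> mps_max" "bij (mps_subst \<phi>)"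
  shows "mps_subst \<phi> \<in> mps_auts" "mps_subst \<phi> ` mps_max = mps_max"
proof -
  interpret \<phi>: ring_morphism "mps_subst \<phi>" using assms(1) by (rule ring_morphism_subst)
  show "mps_subst \<phi> \<in> mps_auts"
    using assms by (simp add: mps_auts_def \<phi>.add \<phi>.mult subst_const)
  have "F \<in> mps_subst \<phi> ` mps_max" if "F \<in> mps_max" for F
  proof -
    obtain G where G: "F = mps_subst \<phi> G" using assms(2) by (metis bij_pointE)
    then have "G \<in> mps_max" using that subst_coeff_0[OF assms(1), of G] by (simp add: mps_max_def)
    with G show ?thesis by blast
  qed
  then show "mps_subst \<phi> ` mps_max = mps_max" using subst_mem_max[OF assms(1)] by blast
qed

section \<open>Matrices congruent to the identity\<close>

definition is_subring :: "'a :: comm_ring_1 set \<Rightarrow> bool" where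
  "is_subring S \<longleftrightarrow> 1 \<in> S \<and> (\<forall>a\<in>S. \<forall>b\<in>S. a + b \<in> S \<and> a * b \<in> S) \<and> (\<forall>a\<in>S. - a \<in> S)"

lemma is_subringD:
  assumes "is_subring S"
  shows "1 \<in> S" "0 \<in> S" "a \<in> S \<Longrightarrow> b \<in> S \<Longrightarrow> a + b \<in> S" "a \<in> S \<Longrightarrow> b \<in> S \<Longrightarrow> a * b \<in> S"
    "a \<in> S \<Longrightarrow> - a \<in> S" "a \<in> S \<Longrightarrow> b \<in> S \<Longrightarrow> a - b \<in> S" "(\<And>x. x \<in> A \<Longrightarrow> F x \<in> S) \<Longrightarrow> sum F A \<in> S"
    "(\<And>x. x \<in> A \<Longrightarrow> F x \<in> S) \<Longrightarrow> prod F A \<in> S" "a \<in> S \<Longrightarrow> a ^ n \<in> S" "of_nat n \<in> S"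
proof -
  have 0: "1 \<in> S" "\<And>a b. a \<in> S \<Longrightarrow> b \<in> S \<Longrightarrow> a + b \<in> S" "\<And>a b. a \<in> S \<Longrightarrow> b \<in> S \<Longrightarrow> a * b \<in> S"
    "\<And>a. a \<in> S \<Longrightarrow> - a \<in> S" using assms by (auto simp: is_subring_def)
  have z: "0 \<in> S" using 0(2)[OF 0(1) 0(4)[OF 0(1)]] by simp
  show "a \<in> S \<Longrightarrow> b \<in> S \<Longrightarrow> a - b \<in> S" using 0(2)[of a "- b"] 0(4)[of b] by simp
  show "(\<And>x. x \<in> A \<Longrightarrow> F x \<in> S) \<Longrightarrow> sum F A \<in> S"
    by (induction A rule: infinite_finite_induct) (auto intro: 0 z)
  show "(\<And>x. x \<in> A \<Longrightarrow> F x \<in> S) \<Longrightarrow> prod F A \<in> S"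
    by (induction A rule: infinite_finite_induct) (auto intro: 0 z)
  show "a \<in> S \<Longrightarrow> a ^ n \<in> S" by (induction n) (auto intro: 0)
  show "of_nat n \<in> S" by (induction n) (auto intro: 0 z)
  show "0 \<in> S" by (fact z)
qed (use assms in \<open>auto simp: is_subring_def\<close>)

text \<open>A matrix congruent to the identity becomes invertible after inverting one element congruent to 1;
  the induction on the index set is Gaussian elimination without division.\<close>

lemma near_identity_left_inverse:
  fixes A :: "'i \<Rightarrow> 'i \<Rightarrow> 'r :: comm_ring_1"
  assumes "finite X" "is_subring S" "is_ideal M"
    "\<And>i j. i \<in> X \<Longrightarrow> j \<in> X \<Longrightarrow> A i j \<in> S \<and> A i j - (if i = j then 1 else 0) \<in> M"
  shows "\<exists>B h. (\<forall>i j. i \<in> X \<longrightarrow> j \<in> X \<longrightarrow> B i j \<in> S) \<and> h \<in> S \<and> h - 1 \<in> M \<and>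
    (\<forall>i\<in>X. \<forall>k\<in>X. (\<Sum>j\<in>X. B i j * A j k) = (if i = k then h else 0))"
  using assms(1,4)
proof (induction X arbitrary: A rule: finite_induct)
  case empty
  have "\<exists>h. h \<in> S \<and> h - 1 \<in> M"
    using is_subringD(1)[OF assms(2)] is_idealD(1)[OF assms(3)] by (intro exI[of _ 1]) simp
  then show ?case by simp
next
  case (insert x X)
  note S = is_subringD[OF assms(2)] and M = is_idealD[OF assms(3)]
  let ?a = "A x x"
  \<comment> \<open>The Schur complement of the pivot \<open>?a\<close>, multiplied by the pivot to
    avoid a division.\<close>
  let ?A = "\<lambda>i j. ?a * A i j - A i x * A x j"
  have AS: "A i j \<in> S" if "i \<in> insert x X" "j \<in> insert x X" for i j
    using insert.prems[OF that] by blast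
  have AM: "A i j - (if i = j then 1 else 0) \<in> M" if "i \<in> insert x X" "j \<in> insert x X" for i j
    using insert.prems[OF that] by blast
  have "?A i j \<in> S \<and> ?A i j - (if i = j then 1 else 0) \<in> M" if "i \<in> X" "j \<in> X" for i j
  proof
    show "?A i j \<in> S" using that by (intro S(6,4) AS) auto
    have "i \<noteq> x" using that insert.hyps by auto
    have "?A i j - ((if x = x then 1 else 0) * (if i = j then 1 else 0) -
        (if i = x then 1 else 0) * (if x = j then 1 else 0)) \<in> M"
      using that by (intro ideal_cong_diff ideal_cong_mult AM assms(3)) auto
    then show "?A i j - (if i = j then 1 else 0) \<in> M" using \<open>i \<noteq> x\<close> by simp
  qed
  from insert.IH[OF this] obtain B h where B: "\<And>i j. i \<in> X \<Longrightarrow> j \<in> X \<Longrightarrow> B i j \<in> S" and h: "h \<in> S" "h - 1 \<in> M"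
    and BA: "\<And>i k. i \<in> X \<Longrightarrow> k \<in> X \<Longrightarrow> (\<Sum>j\<in>X. B i j * ?A j k) = (if i = k then h else 0)" by blast
  \<comment> \<open>\<open>d i\<close> is what row \<open>i\<close> of \<open>B\<close> leaves in
    the pivot column; it has to be cancelled with the pivot row.\<close>
  define d where "d i = (\<Sum>j\<in>X. B i j * A j x)" for i
  have row: "?a * (\<Sum>j\<in>X. B i j * A j k) - d i * A x k = (if i = k then h else 0)"
    if "i \<in> X" "k \<in> insert x X" for i k
  proof (cases "k = x")
    case True
    then show ?thesis using insert.hyps(2) that by (auto simp: d_def ac_simps)
  next
    case False
    then have k: "k \<in> X" using that by auto
    have "(\<Sum>j\<in>X. B i j * ?A j k) = ?a * (\<Sum>j\<in>X. B i j * A j k) - d i * A x k"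
      unfolding d_def sum_distrib_left sum_distrib_right sum_subtractf[symmetric]
      by (intro sum.cong) (auto simp: algebra_simps)
    then show ?thesis using BA[OF that(1) k] by simp
  qed
  \<comment> \<open>Back substitution without fractions. Rows other than \<open>x\<close> carry the
    factor \<open>?a\<close> once to clear the pivot column and once more to get the common diagonal
    entry \<open>h * ?a\<close>; row \<open>x\<close> then removes the remaining entries of the
    pivot row.\<close>
  define B' where "B' i j = (if i = x
      then (if j = x then h + (\<Sum>i\<in>X. A x i * d i) else - (\<Sum>i\<in>X. A x i * (?a * B i j)))
      else (if j = x then - (?a * d i) else ?a * ?a * B i j))" for i j
  have dS: "d i \<in> S" if "i \<in> X" for i
    unfolding d_def using that by (intro S(7,4) B AS) auto
  have "B' i j \<in> S" if "i \<in> insert x X" "j \<in> insert x X" for i j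
    using that unfolding B'_def by (auto intro!: S(3-7) B AS dS h)
  moreover have "h * ?a \<in> S" by (intro S h AS) auto
  moreover have "h * ?a - 1 * (if x = x then 1 else 0) \<in> M" by (intro ideal_cong_mult AM h assms(3)) auto
  moreover have "(\<Sum>j\<in>insert x X. B' i j * A j k) = (if i = k then h * ?a else 0)"
    if ik: "i \<in> insert x X" "k \<in> insert x X" for i k
  proof (cases "i = x")
    case True
    have "(\<Sum>j\<in>X. B' x j * A j k) = - (\<Sum>j\<in>X. \<Sum>i\<in>X. A x i * (?a * (B i j * A j k)))"
      unfolding sum_negf[symmetric]
      by (rule sum.cong) (use insert.hyps(2) in \<open>auto simp: B'_def sum_distrib_right sum_distrib_left ac_simps sum_negf\<close>)
    also have "\<dots> = - (\<Sum>i\<in>X. A x i * (?a * (\<Sum>j\<in>X. B i j * A j k)))"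
      by (subst sum.swap) (simp add: sum_distrib_left)
    also have "\<dots> = - (\<Sum>i\<in>X. A x i * (d i * A x k + (if i = k then h else 0)))"
      using row[OF _ ik(2)] by (intro arg_cong[of _ _ uminus] sum.cong) (auto simp: algebra_simps)
    also have "(\<Sum>i\<in>X. A x i * (d i * A x k + (if i = k then h else 0))) =
        (\<Sum>i\<in>X. A x i * d i) * A x k + (if k \<in> X then h * A x k else 0)"
    proof -
      have "(\<Sum>i\<in>X. A x i * (if i = k then h else 0)) = (\<Sum>i\<in>X. if i = k then h * A x k else 0)"
        by (rule sum.cong) (auto simp: ac_simps)
      then show ?thesis
        using insert.hyps(1) by (simp add: distrib_left sum.distrib sum_distrib_right mult.assoc)
    qed
    finally have "(\<Sum>j\<in>X. B' x j * A j k) =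
        - ((\<Sum>i\<in>X. A x i * d i) * A x k + (if k \<in> X then h * A x k else 0))" .
    then show ?thesis using insert.hyps True ik(2) by (auto simp: B'_def algebra_simps)
  next
    case False
    then have i: "i \<in> X" using ik by auto
    have "(\<Sum>j\<in>X. B' i j * A j k) = ?a * (?a * (\<Sum>j\<in>X. B i j * A j k))"
      unfolding sum_distrib_left
      by (rule sum.cong) (use insert.hyps(2) False in \<open>auto simp: B'_def ac_simps\<close>)
    also have "?a * (\<Sum>j\<in>X. B i j * A j k) = d i * A x k + (if i = k then h else 0)"
      using row[OF i ik(2)] by (simp add: algebra_simps)
    finally show ?thesis using insert.hyps False
      by (auto simp: B'_def algebra_simps)
  qed
  ultimately show ?case by (intro exI[of _ B'] exI[of _ "h * ?a"]) auto
qed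

lemma near_identity_right_inverse:
  fixes A :: "'i \<Rightarrow> 'i \<Rightarrow> 'r :: comm_ring_1"
  assumes "finite X" "is_subring S" "is_ideal M"
    "\<And>i j. i \<in> X \<Longrightarrow> j \<in> X \<Longrightarrow> A i j \<in> S \<and> A i j - (if i = j then 1 else 0) \<in> M"
  shows "\<exists>B h. (\<forall>i j. i \<in> X \<longrightarrow> j \<in> X \<longrightarrow> B i j \<in> S) \<and> h \<in> S \<and> h - 1 \<in> M \<and>
    (\<forall>i\<in>X. \<forall>k\<in>X. (\<Sum>j\<in>X. A i j * B j k) = (if i = k then h else 0))"
proof -
  have "A j i \<in> S \<and> A j i - (if i = j then 1 else 0) \<in> M" if "i \<in> X" "j \<in> X" for i j
    using assms(4)[OF that(2,1)] by (auto simp: eq_commute)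
  from near_identity_left_inverse[OF assms(1-3), of "\<lambda>i j. A j i", OF this]
  obtain B h where B: "\<And>i j. i \<in> X \<Longrightarrow> j \<in> X \<Longrightarrow> B i j \<in> S" and h: "h \<in> S" "h - 1 \<in> M"
    and BA: "\<And>i k. i \<in> X \<Longrightarrow> k \<in> X \<Longrightarrow> (\<Sum>j\<in>X. B i j * A k j) = (if i = k then h else 0)" by blast
  have "(\<Sum>j\<in>X. A i j * B k j) = (if i = k then h else 0)" if "i \<in> X" "k \<in> X" for i k
    using BA[OF that(2,1)] by (auto simp: mult.commute)
  then show ?thesis using B h by (intro exI[of _ "\<lambda>i j. B j i"] exI[of _ h]) auto
qed

section \<open>The equivalence relation given by the group action\<close>

lemma auts_ring_morphism:
  assumes "\<Phi> \<in> mps_auts"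
  shows "ring_morphism \<Phi>"
proof -
  have "\<Phi> (mps_const 1) = mps_const 1" using assms unfolding mps_auts_def by blast
  then show ?thesis using assms by (simp add: ring_morphism_def mps_auts_def)
qed

lemma G_equivalent_trans:
  assumes "G_equivalent G f g" "G_equivalent G g h"
  shows "G_equivalent G f h"
proof -
  obtain \<Phi> u \<Psi> v where \<Phi>: "\<Phi> \<in> mps_auts" "u dvd 1" "G = Right_Equiv \<longrightarrow> u = 1" "g = u * \<Phi> f"
    and \<Psi>: "\<Psi> \<in> mps_auts" "v dvd 1" "G = Right_Equiv \<longrightarrow> v = 1" "h = v * \<Psi> g"
    using assms unfolding G_equivalent_def by blast
  interpret \<Psi>: ring_morphism \<Psi> using \<Psi>(1) by (rule auts_ring_morphism)
  have "\<Psi> \<circ> \<Phi> \<in> mps_auts"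
    using \<Phi>(1) \<Psi>(1) by (auto simp: mps_auts_def intro: bij_comp)
  moreover have "v * \<Psi> u dvd 1"
  proof -
    obtain u' where "1 = u * u'" using \<Phi>(2) by (auto elim: dvdE)
    then have "\<Psi> u dvd 1" using \<Psi>.mult[of u u'] \<Psi>.one by (metis dvd_triv_left)
    with \<Psi>(2) show ?thesis using mult_dvd_mono[of v 1 "\<Psi> u" 1] by simp
  qed
  ultimately show ?thesis
    unfolding G_equivalent_def
    by (intro bexI[of _ "\<Psi> \<circ> \<Phi>"] exI[of _ "v * \<Psi> u"]) (auto simp: \<Phi> \<Psi> \<Psi>.mult \<Psi>.one mult.assoc)
qed

lemma G_equivalent_sym:
  assumes "G_equivalent G f g"
  shows "G_equivalent G g f"
proof -
  obtain \<Phi> u where \<Phi>: "\<Phi> \<in> mps_auts" "u dvd 1" "G = Right_Equiv \<longrightarrow> u = 1" "g = u * \<Phi> f"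
    using assms unfolding G_equivalent_def by blast
  interpret \<Phi>: ring_morphism \<Phi> using \<Phi>(1) by (rule auts_ring_morphism)
  have bij: "bij \<Phi>" and const: "\<And>c. \<Phi> (mps_const c) = mps_const c"
    using \<Phi>(1) by (auto simp: mps_auts_def)
  let ?\<Psi> = "inv \<Phi>"
  have inv: "\<Phi> (?\<Psi> x) = x" "?\<Psi> (\<Phi> x) = x" for x
    using bij by (simp_all add: bij_is_surj surj_f_inv_f bij_is_inj)
  have \<Psi>: "ring_morphism ?\<Psi>"
    by standard (metis inv \<Phi>.one \<Phi>.add \<Phi>.mult)+
  interpret \<Psi>: ring_morphism ?\<Psi> by fact
  obtain u' where u': "1 = u * u'" using \<Phi>(2) by (auto elim: dvdE)
  have "?\<Psi> \<in> mps_auts"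
    using bij_imp_bij_inv[OF bij] inv(2) const by (auto simp: mps_auts_def \<Psi>.add \<Psi>.mult) metis
  moreover have "?\<Psi> u' dvd 1" using \<Psi>.mult[of u u'] u' \<Psi>.one by (metis dvd_triv_right)
  moreover have "f = ?\<Psi> u' * ?\<Psi> g"
    unfolding \<Phi>(4) \<Psi>.mult[symmetric] using u' inv by (metis mult.assoc mult.commute mult_1)
  moreover have "G = Right_Equiv \<longrightarrow> ?\<Psi> u' = 1" using \<Phi>(3) u' \<Psi>.one by auto
  ultimately show ?thesis unfolding G_equivalent_def by blast
qed

lemma (in complete_filtration) coeffs_in_limit:
  fixes X :: "nat \<Rightarrow> ('r, 'v) mps"
  assumes "\<And>n. X (Suc n) - X n \<in> coeffs_in (I n)"
  shows "\<exists>X'. \<forall>n. X' - X n \<in> coeffs_in (I n)"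
proof -
  have "\<exists>x. \<forall>n. x - mps_coeff (X n) m \<in> I n" for m
    using assms by (intro complete) (simp add: coeffs_in_def)
  then obtain x where "\<And>m n. x m - mps_coeff (X n) m \<in> I n" by metis
  then show ?thesis by (intro exI[of _ "Abs_mps x"]) (simp add: coeffs_in_def Abs_mps_inverse)
qed

section \<open>The tangent image and finite codimension\<close>

lemma is_ideal_lincomb:
  fixes e :: "'i \<Rightarrow> 'r :: comm_ring_1"
  assumes "is_ideal I"
  shows "is_ideal {\<Sum>i\<in>X. c i * e i | c. \<forall>i. c i \<in> I}"
proof (rule is_idealI)
  note I = is_idealD[OF assms]
  show "0 \<in> {\<Sum>i\<in>X. c i * e i | c. \<forall>i. c i \<in> I}"
    by (auto intro!: exI[of _ "\<lambda>_. 0"] simp: I)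
  show "a + b \<in> {\<Sum>i\<in>X. c i * e i | c. \<forall>i. c i \<in> I}"
    if ab: "a \<in> {\<Sum>i\<in>X. c i * e i | c. \<forall>i. c i \<in> I}" "b \<in> {\<Sum>i\<in>X. c i * e i | c. \<forall>i. c i \<in> I}" for a b
  proof -
    obtain c c' where "a = (\<Sum>i\<in>X. c i * e i)" "b = (\<Sum>i\<in>X. c' i * e i)" "\<forall>i. c i \<in> I" "\<forall>i. c' i \<in> I"
      using ab by blast
    then show ?thesis
      by (auto intro!: exI[of _ "\<lambda>i. c i + c' i"] simp: I sum.distrib distrib_right)
  qed
  show "r * a \<in> {\<Sum>i\<in>X. c i * e i | c. \<forall>i. c i \<in> I}"
    if a: "a \<in> {\<Sum>i\<in>X. c i * e i | c. \<forall>i. c i \<in> I}" for r a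
  proof -
    obtain c where "a = (\<Sum>i\<in>X. c i * e i)" "\<forall>i. c i \<in> I" using a by blast
    then show ?thesis
      by (auto intro!: exI[of _ "\<lambda>i. r * c i"] simp: I sum_distrib_left mult.assoc)
  qed
qed

lemma jacobian_ideal_lincomb:
  fixes f :: "('k :: field, 'v :: finite) mps"
  shows "jacobian_ideal f \<subseteq> {\<Sum>i\<in>UNIV. c i * mps_pderiv i f | c. \<forall>i. c i \<in> UNIV}"
  unfolding jacobian_ideal_def
proof (rule ideal_gen_minimal[OF _ is_ideal_lincomb[OF is_ideal_UNIV]], clarify)
  fix i
  have "(\<Sum>j\<in>UNIV. (if j = i then 1 else 0) * mps_pderiv j f) = mps_pderiv i f"
    by (simp add: if_distrib[of "\<lambda>x. x * _"] cong: if_cong)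
  then show "\<exists>c. mps_pderiv i f = (\<Sum>i\<in>UNIV. c i * mps_pderiv i f) \<and> (\<forall>i. c i \<in> UNIV)"
    by (intro exI[of _ "\<lambda>j. if j = i then 1 else 0"]) simp
qed

lemma pderiv_mem_jacobian: "mps_pderiv i f \<in> jacobian_ideal f"
  unfolding jacobian_ideal_def by (rule module.span_base[OF module_times]) auto

definition tangent_image :: "equiv_kind \<Rightarrow> ('k :: field, 'v) mps \<Rightarrow> ('k, 'v) mps set" where
  "tangent_image G f = (case G of Right_Equiv \<Rightarrow> ideal_prod mps_max (jacobian_ideal f)
    | Contact_Equiv \<Rightarrow> ideal_gen ({f} \<union> ideal_prod mps_max (jacobian_ideal f)))"

lemma is_ideal_tangent_image: "is_ideal (tangent_image G f)"
  by (cases G) (simp_all add: tangent_image_def is_ideal_ideal_prod is_ideal_ideal_gen)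

lemma ideal_prod_subset_tangent_image: "ideal_prod mps_max (jacobian_ideal f) \<subseteq> tangent_image G f"
  by (cases G) (auto simp: tangent_image_def intro!: module.span_base[OF module_times])

lemma mem_contact_tangent_image: "f \<in> tangent_image Contact_Equiv f"
  by (auto simp: tangent_image_def intro!: module.span_base[OF module_times])

lemma mem_tangent_image_iff:
  fixes f :: "('k :: field, 'v :: finite) mps"
  shows "h \<in> tangent_image G f \<longleftrightarrow> (\<exists>\<xi> v. (\<forall>i. \<xi> i \<in> mps_max) \<and> (G = Right_Equiv \<longrightarrow> v = 0) \<and>
    h = (\<Sum>i\<in>UNIV. \<xi> i * mps_pderiv i f) + v * f)" (is "_ \<longleftrightarrow> ?R h")
proof
  let ?J = "{\<Sum>i\<in>UNIV. c i * mps_pderiv i f | c. \<forall>i. c i \<in> mps_max}"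
  have J: "is_ideal ?J" by (rule is_ideal_lincomb[OF is_ideal_mps_max])
  have prod: "ideal_prod mps_max (jacobian_ideal f) \<subseteq> ?J"
  proof (rule ideal_prod_least[OF J])
    fix a b :: "('k, 'v) mps"
    assume a: "a \<in> mps_max" and "b \<in> jacobian_ideal f"
    then obtain c where "b = (\<Sum>i\<in>UNIV. c i * mps_pderiv i f)" using jacobian_ideal_lincomb by blast
    then have "a * b = (\<Sum>i\<in>UNIV. (a * c i) * mps_pderiv i f)" by (simp add: sum_distrib_left mult.assoc)
    then show "a * b \<in> ?J" using a by (auto intro!: exI[of _ "\<lambda>i. a * c i"] is_idealD[OF is_ideal_mps_max])
  qed
  assume h: "h \<in> tangent_image G f"
  show "?R h"
  proof (cases G)
    case Right_Equiv
    then have "h \<in> ?J" using prod h by (auto simp: tangent_image_def)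
    then obtain c where "\<forall>i. c i \<in> mps_max" "h = (\<Sum>i\<in>UNIV. c i * mps_pderiv i f)" by blast
    then show ?thesis by (intro exI[of _ c] exI[of _ 0]) simp
  next
    case Contact_Equiv
    let ?K = "{p + v * f | p v. p \<in> ?J}"
    have "is_ideal ?K"
    proof (rule is_idealI)
      show "0 \<in> ?K" using is_idealD(1)[OF J] by (smt (verit) add_0 mem_Collect_eq mult_zero_left)
      show "a + b \<in> ?K" if ab: "a \<in> ?K" "b \<in> ?K" for a b
      proof -
        obtain p v p' v' where "a = p + v * f" "b = p' + v' * f" "p \<in> ?J" "p' \<in> ?J" using ab by blast
        moreover from this have "a + b = (p + p') + (v + v') * f" by (simp add: algebra_simps)
        ultimately show ?thesis using is_idealD(2)[OF J] by blast
      qed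
      show "r * a \<in> ?K" if a: "a \<in> ?K" for r a
      proof -
        obtain p v where "a = p + v * f" "p \<in> ?J" using a by blast
        moreover from this have "r * a = (r * p) + (r * v) * f" by (simp add: algebra_simps)
        ultimately show ?thesis using is_idealD(3)[OF J] by blast
      qed
    qed
    moreover have "{f} \<union> ideal_prod mps_max (jacobian_ideal f) \<subseteq> ?K"
    proof -
      have "f = 0 + 1 * f" "\<And>p. p = p + 0 * f" by simp_all
      then show ?thesis using prod is_idealD(1)[OF J] by blast
    qed
    ultimately have "ideal_gen ({f} \<union> ideal_prod mps_max (jacobian_ideal f)) \<subseteq> ?K"
      by (intro ideal_gen_minimal)
    then have "h \<in> ?K" using h Contact_Equiv by (auto simp: tangent_image_def)
    then obtain c v where "\<forall>i. c i \<in> mps_max" "h = (\<Sum>i\<in>UNIV. c i * mps_pderiv i f) + v * f" by blast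
    then show ?thesis using Contact_Equiv by (intro exI[of _ c] exI[of _ v]) simp
  qed
next
  assume "?R h"
  then obtain \<xi> v where \<xi>: "\<forall>i. \<xi> i \<in> mps_max" "G = Right_Equiv \<longrightarrow> v = 0"
    "h = (\<Sum>i\<in>UNIV. \<xi> i * mps_pderiv i f) + v * f" by blast
  have "v * f \<in> tangent_image G f"
    using \<xi>(2) mem_contact_tangent_image[of f] is_idealD(1,3)[OF is_ideal_tangent_image[of G f]] by (cases G) auto
  moreover have "(\<Sum>i\<in>UNIV. \<xi> i * mps_pderiv i f) \<in> tangent_image G f"
    using \<xi>(1) ideal_prod_subset_tangent_image[of f G]
    by (intro is_idealD(7)[OF is_ideal_tangent_image]) (auto intro: ideal_prodI pderiv_mem_jacobian)
  ultimately show "h \<in> tangent_image G f"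
    unfolding \<xi>(3) by (intro is_idealD(2)[OF is_ideal_tangent_image])
qed

text \<open>Gaussian elimination: one equation is used to express a pivot unknown \<open>p\<close>
  by the others, which removes one equation and one unknown.\<close>

lemma homogeneous_system_solution:
  fixes C :: "'j \<Rightarrow> 'i \<Rightarrow> 'k :: field"
  assumes "finite I" "finite J" "card I < card J"
  shows "\<exists>c. (\<exists>j\<in>J. c j \<noteq> 0) \<and> (\<forall>i\<in>I. (\<Sum>j\<in>J. c j * C j i) = 0)"
  using assms
proof (induction I arbitrary: J C rule: finite_induct)
  case empty
  then obtain j where "j \<in> J" by fastforce
  then show ?case by (intro exI[of _ "\<lambda>_. 1"]) auto
next
  case (insert i I)
  show ?case
  proof (cases "\<forall>j\<in>J. C j i = 0")
    case True
    then show ?thesis using insert.IH[of J C] insert.prems insert.hyps by auto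
  next
    case False
    then obtain p where p: "p \<in> J" "C p i \<noteq> 0" by blast
    let ?C = "\<lambda>j k. C j k - C j i / C p i * C p k"
    have "card I < card (J - {p})" using insert.prems insert.hyps p by simp
    then obtain c where c: "\<exists>j\<in>J - {p}. c j \<noteq> 0" "\<forall>k\<in>I. (\<Sum>j\<in>J - {p}. c j * ?C j k) = 0"
      using insert.IH[of "J - {p}" ?C] insert.prems by blast
    let ?s = "\<Sum>j\<in>J - {p}. c j * C j i"
    let ?c = "c(p := - ?s / C p i)"
    have "(\<Sum>j\<in>J. ?c j * C j k) = 0" if "k \<in> insert i I" for k
    proof -
      have "(\<Sum>j\<in>J. ?c j * C j k) = - ?s / C p i * C p k + (\<Sum>j\<in>J - {p}. c j * C j k)"
        using p insert.prems by (subst sum.remove[of _ p]) auto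
      also have "\<dots> = (\<Sum>j\<in>J - {p}. c j * ?C j k)"
        by (simp add: algebra_simps sum_subtractf sum_distrib_left sum_distrib_right sum_divide_distrib)
      also have "\<dots> = 0" using that c(2) p(2) by auto
      finally show ?thesis .
    qed
    moreover have "\<exists>j\<in>J. ?c j \<noteq> 0" using c(1) by auto
    ultimately show ?thesis by blast
  qed
qed

text \<open>The initial products of a monomial of degree \<^term>\<open>D\<close> are \<^term>\<open>D + 1\<close> elements of a quotient of
  dimension at most \<^term>\<open>D\<close>; the first product occurring in a linear relation lies in \<^term>\<open>J\<close>.\<close>

lemma monom_mem_of_finite_codim:
  fixes J :: "('k :: field, 'v) mps set"
  assumes J: "is_ideal J"
    and gen: "\<And>a. mdeg a \<le> mdeg \<alpha> \<Longrightarrow> \<exists>c. mps_monom a - (\<Sum>i<D. mps_const (c i) * b i) \<in> J"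
    and "D \<le> mdeg \<alpha>"
  shows "mps_monom \<alpha> \<in> J"
proof -
  let ?N = "mdeg \<alpha>"
  obtain a where a: "a 0 = 0" "a ?N = \<alpha>" "\<forall>j<?N. \<exists>i. a (Suc j) = a j + Poly_Mapping.single i 1"
    using monom_chain[of \<alpha>] by auto
  have chain: "\<exists>r. a (j + k) = a j + r \<and> mdeg r = k" if "j + k \<le> ?N" for j k
    using that
  proof (induction k)
    case (Suc k)
    then obtain r i where "a (j + k) = a j + r" "mdeg r = k" "a (Suc (j + k)) = a (j + k) + Poly_Mapping.single i 1"
      using a(3) by (metis Suc_le_lessD Suc_leD add_Suc_right)
    then show ?case by (intro exI[of _ "r + Poly_Mapping.single i 1"]) (simp add: mdeg_add add.assoc)
  qed simp
  have deg: "mdeg (a j) = j" if "j \<le> ?N" for j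
    using chain[of 0 j] that a(1) by auto
  have "\<forall>j. \<exists>c. j \<le> ?N \<longrightarrow> mps_monom (a j) - (\<Sum>i<D. mps_const (c i) * b i) \<in> J"
    using gen deg by auto
  then obtain C where C: "\<And>j. j \<le> ?N \<Longrightarrow> mps_monom (a j) - (\<Sum>i<D. mps_const (C j i) * b i) \<in> J" by metis
  obtain c where c: "\<exists>j\<le>?N. c j \<noteq> 0" "\<forall>i<D. (\<Sum>j\<le>?N. c j * C j i) = 0"
    using homogeneous_system_solution[of "{..<D}" "{..?N}" C] assms(3) by auto
  interpret const: ring_morphism "mps_const :: 'k \<Rightarrow> ('k, 'v) mps" by (rule ring_morphism_const)
  let ?P = "\<Sum>j\<le>?N. mps_const (c j) * mps_monom (a j)"
  have "?P - (\<Sum>j\<le>?N. mps_const (c j) * (\<Sum>i<D. mps_const (C j i) * b i)) \<in> J"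
    by (intro ideal_cong_sum ideal_cong_mult J C) (simp_all add: is_idealD[OF J])
  moreover have "(\<Sum>j\<le>?N. mps_const (c j) * (\<Sum>i<D. mps_const (C j i) * b i)) =
      (\<Sum>i<D. mps_const (\<Sum>j\<le>?N. c j * C j i) * b i)"
    unfolding sum_distrib_left const.sum sum_distrib_right
    by (subst sum.swap) (simp add: const.mult mult.assoc)
  ultimately have P: "?P \<in> J" using c(2) by simp
  define j where "j = (LEAST j. c j \<noteq> 0)"
  obtain j' where "j' \<le> ?N" "c j' \<noteq> 0" using c(1) by blast
  then have j: "c j \<noteq> 0" "j \<le> ?N" "\<And>i. i < j \<Longrightarrow> c i = 0"
    unfolding j_def using LeastI[of "\<lambda>j. c j \<noteq> 0" j'] Least_le[of "\<lambda>j. c j \<noteq> 0" j'] not_less_Least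
    by (auto dest: order_trans)
  have "\<exists>r. \<forall>k. j \<le> k \<longrightarrow> k \<le> ?N \<longrightarrow> a k = a j + r k \<and> mdeg (r k) = k - j"
    using chain[of j "_ - j"] by (metis le_add_diff_inverse)
  then obtain r where r: "\<And>k. j \<le> k \<Longrightarrow> k \<le> ?N \<Longrightarrow> a k = a j + r k \<and> mdeg (r k) = k - j" by blast
  let ?u = "\<Sum>k\<in>{j..?N}. mps_const (c k) * mps_monom (r k)"
  have "?P = (\<Sum>k\<in>{j..?N}. mps_const (c k) * mps_monom (a k))"
    using j(3) by (intro sum.mono_neutral_right) (auto simp: not_le)
  also have "\<dots> = mps_monom (a j) * ?u"
    unfolding sum_distrib_left
  proof (rule sum.cong)
    fix k assume "k \<in> {j..?N}"
    then have "a k = a j + r k" using r[of k] by simp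
    then show "mps_const (c k) * mps_monom (a k) = mps_monom (a j) * (mps_const (c k) * mps_monom (r k))"
      by (simp add: mps_monom_add ac_simps)
  qed simp
  finally have Pu: "?P = mps_monom (a j) * ?u" .
  \<comment> \<open>The quotients \<open>r k\<close> with \<open>k > j\<close> have positive degree.
    So the constant term of \<open>?u\<close> is the nonzero number \<open>c j\<close>, and
    \<open>?u\<close> is a unit.\<close>
  have "mps_coeff ?u 0 = (\<Sum>k\<in>{j..?N}. if k = j then c j else 0)"
    unfolding mps_coeff_sum
  proof (rule sum.cong)
    fix k assume k: "k \<in> {j..?N}"
    have "0 = r k \<longleftrightarrow> k = j" using r[of k] k by (auto simp flip: mdeg_eq_0_iff)
    then show "mps_coeff (mps_const (c k) * mps_monom (r k)) 0 = (if k = j then c j else 0)"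
      by (auto simp: mps_coeff_monom)
  qed simp
  then have "mps_coeff ?u 0 = c j" using j(2) by simp
  then have "?u dvd 1" using j(1) by (intro mps_unit[of "inverse (c j)"]) simp
  then obtain w where "1 = ?u * w" by (auto elim: dvdE)
  then have "mps_monom (a j) = ?P * w" unfolding Pu by (simp add: mult.assoc)
  then have "mps_monom (a j) \<in> J" using is_idealD(4)[OF J P] by metis
  moreover have "\<alpha> = a j + r ?N" using r[of ?N] j(2) a(2) by auto
  then have "mps_monom \<alpha> = mps_monom (a j) * (mps_monom (r ?N) :: ('k, 'v) mps)"
    by (metis mps_monom_add)
  ultimately show ?thesis using is_idealD(4)[OF J] by metis
qed

lemma quot_dim_finite_monom:
  fixes J :: "('k :: field, 'v) mps set"
  assumes "is_ideal J" "quot_dim UNIV J < \<infinity>"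
  shows "\<exists>d. \<forall>\<alpha>. mdeg \<alpha> = d \<longrightarrow> mps_monom \<alpha> \<in> J"
proof -
  \<comment> \<open>The infimum of the empty set is infinite, so a finite value of
    \<open>quot_dim\<close> yields a basis.\<close>
  have "{enat l |l. \<exists>g. quot_basis UNIV J l g} \<noteq> {}"
  proof
    assume "{enat l |l. \<exists>g. quot_basis UNIV J l g} = {}"
    then have "quot_dim UNIV J = \<infinity>" by (simp only: quot_dim_def Inf_enat_def) simp
    with assms(2) show False by simp
  qed
  then obtain D b where "quot_basis UNIV J D b" by blast
  then have "\<And>h. \<exists>c. h - (\<Sum>i<D. mps_const (c i) * b i) \<in> J"
    unfolding quot_basis_def quot_generators_def by blast
  then have "mps_monom \<alpha> \<in> J" if "mdeg \<alpha> = D" for \<alpha>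
    using that by (intro monom_mem_of_finite_codim[of J \<alpha> b D] assms(1)) auto
  then show ?thesis by blast
qed

definition finite_codim :: "equiv_kind \<Rightarrow> ('k :: field, 'v) mps \<Rightarrow> bool" where
  "finite_codim G f \<longleftrightarrow> (case G of Right_Equiv \<Rightarrow> milnor_number f < \<infinity> | Contact_Equiv \<Rightarrow> tjurina_number f < \<infinity>)"

text \<open>The finiteness hypothesis concerns the jacobian ideal itself, the tangent image uses its
  product with the maximal ideal. One extra variable factor bridges the gap, hence the degree
  \<open>Suc d\<close>, which is also positive as needed later.\<close>

lemma finite_codim_monom:
  fixes f :: "('k :: field, 'v) mps"
  assumes "finite_codim G f"
  shows "\<exists>d\<ge>1. \<forall>\<alpha>. mdeg \<alpha> = d \<longrightarrow> mps_monom \<alpha> \<in> tangent_image G f"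
proof -
  let ?J = "case G of Right_Equiv \<Rightarrow> jacobian_ideal f | Contact_Equiv \<Rightarrow> ideal_gen ({f} \<union> jacobian_ideal f)"
  have "is_ideal ?J" by (cases G) (auto simp: jacobian_ideal_def is_ideal_ideal_gen)
  moreover have "quot_dim UNIV ?J < \<infinity>"
    using assms by (cases G) (auto simp: finite_codim_def milnor_number_def tjurina_number_def)
  ultimately obtain d where d: "\<And>\<alpha>. mdeg \<alpha> = d \<Longrightarrow> mps_monom \<alpha> \<in> ?J"
    using quot_dim_finite_monom by blast
  have T: "mps_var i * p \<in> tangent_image G f" if "p \<in> ?J" for i p
  proof (cases G)
    case Right_Equiv
    then show ?thesis using that by (auto simp: tangent_image_def intro!: ideal_prodI)
  next
    case Contact_Equiv
    let ?K = "{p. mps_var i * p \<in> tangent_image G f}"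
    note T = is_idealD[OF is_ideal_tangent_image]
    have "is_ideal ?K"
    proof (rule is_idealI)
      show "r * a \<in> ?K" if "a \<in> ?K" for r a
        using T(3)[of "mps_var i * a" G f r] that by (simp add: ac_simps)
    qed (auto simp: T distrib_left)
    moreover have "{f} \<union> jacobian_ideal f \<subseteq> ?K"
      using T(3)[OF mem_contact_tangent_image] ideal_prod_subset_tangent_image[of f G] Contact_Equiv
      by (auto intro!: ideal_prodI)
    ultimately have "ideal_gen ({f} \<union> jacobian_ideal f) \<subseteq> ?K" by (intro ideal_gen_minimal)
    then show ?thesis using that Contact_Equiv by auto
  qed
  have "mps_monom \<alpha> \<in> tangent_image G f" if "mdeg \<alpha> = Suc d" for \<alpha>
  proof -
    have "\<alpha> \<noteq> 0" using that by auto
    then obtain i k where ik: "\<alpha> = Poly_Mapping.single i 1 + k" using monom_nonzeroE by (metis One_nat_def)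
    with that have "mdeg k = d" by (simp add: mdeg_add)
    then show ?thesis using T[OF d, of k i] by (simp add: ik mps_monom_add)
  qed
  then show ?thesis by (intro exI[of _ "Suc d"]) simp
qed

text \<open>The order bounds allow to sum up the solutions for all monomials with coefficients in any algebra.\<close>

locale tangent_solution =
  fixes G :: equiv_kind and f :: "('k :: field, 'v :: finite) mps" and l :: nat
    and g :: "nat \<Rightarrow> ('k, 'v) mps" and d :: nat
    and \<Xi> :: "('v \<Rightarrow>\<^sub>0 nat) \<Rightarrow> 'v \<Rightarrow> ('k, 'v) mps" and C :: "('v \<Rightarrow>\<^sub>0 nat) \<Rightarrow> nat \<Rightarrow> 'k"
    and U :: "('v \<Rightarrow>\<^sub>0 nat) \<Rightarrow> ('k, 'v) mps"
  assumes f_max: "f \<in> mps_max" and g_max: "j < l \<Longrightarrow> g j \<in> mps_max" and d_pos: "1 \<le> d"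
    and solution: "\<beta> \<noteq> 0 \<Longrightarrow> mps_monom \<beta> = (\<Sum>i\<in>UNIV. \<Xi> \<beta> i * mps_pderiv i f) +
      (\<Sum>j<l. mps_const (C \<beta> j) * g j) + U \<beta> * f"
    and \<Xi>_max: "\<Xi> \<beta> i \<in> mps_max" and \<Xi>_ord: "\<Xi> \<beta> i \<in> ord_ge (mdeg \<beta> - d)"
    and U_ord: "U \<beta> \<in> ord_ge (mdeg \<beta> - d)" and U_Right: "G = Right_Equiv \<Longrightarrow> U \<beta> = 0"
    and C_high: "d \<le> mdeg \<beta> \<Longrightarrow> C \<beta> j = 0"

text \<open>From degree \<open>d\<close> on, a monomial is written as a multiple of one of degree
  exactly \<open>d\<close>, whose solution without generators is multiplied by the cofactor; this
  gives the order bounds and \<open>c = 0\<close>. Below degree \<open>d\<close> the generators are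
  used, and the bounds are void because \<open>mdeg \<beta> - d\<close> is 0.\<close>

lemma ex_tangent_solution:
  fixes f :: "('k :: field, 'v :: finite) mps"
  assumes "f \<in> mps_max" "1 \<le> d" "\<And>\<alpha>. mdeg \<alpha> = d \<Longrightarrow> mps_monom \<alpha> \<in> tangent_image G f"
    and g: "quot_generators mps_max (tangent_image G f) l g"
  shows "\<exists>\<Xi> C U. tangent_solution G f l g d \<Xi> C U"
proof -
  let ?P = "\<lambda>\<beta> (\<xi>, c, u). (\<beta> \<noteq> 0 \<longrightarrow> mps_monom \<beta> = (\<Sum>i\<in>UNIV. \<xi> i * mps_pderiv i f) +
      (\<Sum>j<l. mps_const (c j) * g j) + u * f) \<and> (\<forall>i. \<xi> i \<in> mps_max \<and> \<xi> i \<in> ord_ge (mdeg \<beta> - d)) \<and>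
      u \<in> ord_ge (mdeg \<beta> - d) \<and> (G = Right_Equiv \<longrightarrow> u = 0) \<and> (d \<le> mdeg \<beta> \<longrightarrow> (\<forall>j :: nat. c j = 0))"
  have ex: "\<exists>s. ?P \<beta> s" for \<beta>
  proof (cases "\<beta> = 0")
    case True
    then show ?thesis
      \<comment> \<open>There is no equation for the monomial 1; zeros fulfil the remaining
        conditions.\<close>
      by (intro exI[of _ "(\<lambda>_. 0, \<lambda>_. 0, 0)"]) (auto simp: is_idealD[OF is_ideal_mps_max])
  next
    case False
    show ?thesis
    proof (cases "d \<le> mdeg \<beta>")
      case True
      then obtain a b where ab: "\<beta> = a + b" "mdeg b = d" using monom_split_deg by blast
      then have deg: "mdeg \<beta> - d = mdeg a" by (simp add: mdeg_add)
      obtain \<xi> v where "\<forall>i. \<xi> i \<in> mps_max" "G = Right_Equiv \<longrightarrow> v = 0"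
        "mps_monom b = (\<Sum>i\<in>UNIV. \<xi> i * mps_pderiv i f) + v * f"
        using assms(3)[OF ab(2)] unfolding mem_tangent_image_iff by blast
      then have "?P \<beta> (\<lambda>i. mps_monom a * \<xi> i, \<lambda>_. 0, mps_monom a * v)"
        unfolding deg
        by (auto simp: ab(1) mps_monom_add sum_distrib_left distrib_left mult.assoc
            is_idealD[OF is_ideal_mps_max] is_idealD[OF is_ideal_ord_ge] mps_monom_ord_ge)
      then show ?thesis by (rule exI)
    next
      case nd: False
      then have deg: "mdeg \<beta> - d = 0" by simp
      have "mps_monom \<beta> \<in> mps_max" using False by (simp add: mps_max_def mps_coeff_monom)
      then obtain c where "mps_monom \<beta> - (\<Sum>i<l. mps_const (c i) * g i) \<in> tangent_image G f"
        using g unfolding quot_generators_def by blast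
      then obtain \<xi> v where "\<forall>i. \<xi> i \<in> mps_max" "G = Right_Equiv \<longrightarrow> v = 0"
        "mps_monom \<beta> - (\<Sum>i<l. mps_const (c i) * g i) = (\<Sum>i\<in>UNIV. \<xi> i * mps_pderiv i f) + v * f"
        unfolding mem_tangent_image_iff by blast
      then have "?P \<beta> (\<xi>, c, v)" using nd by (auto simp: deg algebra_simps)
      then show ?thesis by (rule exI)
    qed
  qed
  define s where "s \<beta> = (SOME s. ?P \<beta> s)" for \<beta>
  have s: "?P \<beta> (s \<beta>)" for \<beta>
    unfolding s_def by (rule someI_ex, rule ex)
  have "tangent_solution G f l g d (\<lambda>\<beta>. fst (s \<beta>)) (\<lambda>\<beta>. fst (snd (s \<beta>))) (\<lambda>\<beta>. snd (snd (s \<beta>)))"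
  proof unfold_locales
    fix \<beta> i j
    show "j < l \<Longrightarrow> g j \<in> mps_max" using g by (simp add: quot_generators_def)
    show "\<beta> \<noteq> 0 \<Longrightarrow> mps_monom \<beta> = (\<Sum>i\<in>UNIV. fst (s \<beta>) i * mps_pderiv i f) +
        (\<Sum>j<l. mps_const (fst (snd (s \<beta>)) j) * g j) + snd (snd (s \<beta>)) * f"
      "fst (s \<beta>) i \<in> mps_max" "fst (s \<beta>) i \<in> ord_ge (mdeg \<beta> - d)"
      "snd (snd (s \<beta>)) \<in> ord_ge (mdeg \<beta> - d)" "G = Right_Equiv \<Longrightarrow> snd (snd (s \<beta>)) = 0"
      "d \<le> mdeg \<beta> \<Longrightarrow> fst (snd (s \<beta>)) j = 0"
      using s[of \<beta>] by (simp_all add: case_prod_unfold)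
  qed (use assms in auto)
  then show ?thesis by blast
qed

text \<open>A sum over all monomials, taken coefficientwise. If \<open>X \<beta>\<close> has order
  at least \<open>mdeg \<beta> - d\<close>, then no index outside the finite range contributes to
  the coefficient of \<open>m\<close>.\<close>

definition msum :: "nat \<Rightarrow> (('v \<Rightarrow>\<^sub>0 nat) \<Rightarrow> ('a :: comm_ring_1, 'v) mps) \<Rightarrow> ('a, 'v) mps" where
  "msum d X = Abs_mps (\<lambda>m. \<Sum>\<beta> | mdeg \<beta> \<le> mdeg m + d. mps_coeff (X \<beta>) m)"

lemma mps_coeff_msum: "mps_coeff (msum d X) m = (\<Sum>\<beta> | mdeg \<beta> \<le> mdeg m + d. mps_coeff (X \<beta>) m)"
  by (simp add: msum_def Abs_mps_inverse)

lemma msum_partial_sum: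
  fixes X :: "('v :: finite \<Rightarrow>\<^sub>0 nat) \<Rightarrow> ('a :: comm_ring_1, 'v) mps"
  assumes "\<And>\<beta>. X \<beta> \<in> ord_ge (mdeg \<beta> - d)"
  shows "msum d X - (\<Sum>\<beta> | mdeg \<beta> < n + d. X \<beta>) \<in> ord_ge n"
proof -
  have "mps_coeff (msum d X) m = (\<Sum>\<beta> | mdeg \<beta> < n + d. mps_coeff (X \<beta>) m)" if "mdeg m < n" for m
    unfolding mps_coeff_msum
  proof (rule sum.mono_neutral_left)
    show "\<forall>\<beta>\<in>{\<beta>. mdeg \<beta> < n + d} - {\<beta>. mdeg \<beta> \<le> mdeg m + d}. mps_coeff (X \<beta>) m = 0"
    proof
      fix \<beta> :: "'v \<Rightarrow>\<^sub>0 nat" assume "\<beta> \<in> {\<beta>. mdeg \<beta> < n + d} - {\<beta>. mdeg \<beta> \<le> mdeg m + d}"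
      then have "mdeg m < mdeg \<beta> - d" by auto
      then show "mps_coeff (X \<beta>) m = 0" using assms[of \<beta>] by (auto simp: ord_ge_def)
    qed
  qed (use that in \<open>auto simp: finite_monoms_UNIV\<close>)
  then show ?thesis by (simp add: ord_ge_def)
qed

context tangent_solution
begin

text \<open>Superposition: each coefficient of \<open>e\<close> multiplies the solution for its
  monomial. Thus the solution inherits from \<open>e\<close> the property of having coefficients in
  \<open>J\<close>, for every ideal \<open>J\<close> of every K-algebra. A vanishing constant term
  is required because the monomial 1 has no solution.\<close>

lemma solve_linear:
  fixes \<iota> :: "'k \<Rightarrow> 'b :: comm_ring_1" and e :: "('b, 'v) mps"
  assumes \<iota>: "ring_morphism \<iota>" and J: "is_ideal J" and e: "e \<in> mps_max" "e \<in> coeffs_in J"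
  shows "\<exists>\<xi> c v. (\<forall>i. \<xi> i \<in> mps_max) \<and> (\<forall>i. \<xi> i \<in> coeffs_in J) \<and> (\<forall>j. c j \<in> J) \<and> v \<in> coeffs_in J \<and>
    (G = Right_Equiv \<longrightarrow> v = 0) \<and> e = (\<Sum>i\<in>UNIV. \<xi> i * mps_pderiv i (mps_map \<iota> f)) +
      (\<Sum>j<l. mps_const (c j) * mps_map \<iota> (g j)) + v * mps_map \<iota> f"
proof -
  interpret \<iota>: ring_morphism \<iota> by fact
  interpret m\<iota>: ring_morphism "mps_map \<iota> :: ('k, 'v) mps \<Rightarrow> _" by (rule ring_morphism_mps_map) fact
  interpret const: ring_morphism "mps_const :: 'b \<Rightarrow> ('b, 'v) mps" by (rule ring_morphism_const)
  interpret complete_filtration "ord_ge :: nat \<Rightarrow> ('b, 'v) mps set" by (rule complete_filtration_ord_ge)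
  let ?t = "\<lambda>X \<beta>. mps_const (mps_coeff e \<beta>) * mps_map \<iota> (X \<beta>)"
  define \<xi> where "\<xi> i = msum d (?t (\<lambda>\<beta>. \<Xi> \<beta> i))" for i
  define v where "v = msum d (?t U)"
  \<comment> \<open>The sum is finite since \<open>C\<close> vanishes from degree \<open>d\<close>
    on; so \<open>c j\<close> lies in \<open>J\<close> without any limit in the base ring.\<close>
  define c where "c j = (\<Sum>\<beta> | mdeg \<beta> < d. mps_coeff e \<beta> * \<iota> (C \<beta> j))" for j
  let ?f = "mps_map \<iota> f" and ?g = "\<lambda>j. mps_map \<iota> (g j)"
  have t_ord: "?t X \<beta> \<in> ord_ge n" if "X \<beta> \<in> ord_ge n" for X \<beta> n
    using that by (auto simp: ord_ge_def \<iota>.zero)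
  have msumJ: "msum d (?t X) \<in> coeffs_in J" for X
    using e(2) by (auto simp: coeffs_in_def mps_coeff_msum intro!: is_idealD(4,7)[OF J])
  have \<xi>_max: "\<xi> i \<in> mps_max" for i
    using \<Xi>_max[of _ i] by (simp add: \<xi>_def mps_max_def mps_coeff_msum \<iota>.zero)
  have e_sum: "e - (\<Sum>\<beta> | mdeg \<beta> < n. mps_const (mps_coeff e \<beta>) * mps_monom \<beta>) \<in> ord_ge n" for n
    using subst_partial_sum[of mps_var e n] by (simp add: subst_ident)
  have "e - ((\<Sum>i\<in>UNIV. \<xi> i * mps_pderiv i ?f) + (\<Sum>j<l. mps_const (c j) * ?g j) + v * ?f) \<in> ord_ge n" for n
  proof -
    \<comment> \<open>The shift by \<open>d\<close> compensates for the order lost in passing from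
      \<open>\<beta>\<close> to \<open>\<Xi> \<beta>\<close> and \<open>U \<beta>\<close>.\<close>
    let ?M = "{\<beta> :: 'v \<Rightarrow>\<^sub>0 nat. mdeg \<beta> < n + d}"
    let ?X = "\<lambda>i. \<Sum>\<beta>\<in>?M. ?t (\<lambda>\<beta>. \<Xi> \<beta> i) \<beta>" and ?V = "\<Sum>\<beta>\<in>?M. ?t U \<beta>"
    have c: "(\<Sum>j<l. mps_const (c j) * ?g j) =
        (\<Sum>\<beta>\<in>?M. mps_const (mps_coeff e \<beta>) * (\<Sum>j<l. mps_const (\<iota> (C \<beta> j)) * ?g j))"
    proof -
      have "c j = (\<Sum>\<beta>\<in>?M. mps_coeff e \<beta> * \<iota> (C \<beta> j))" for j
        unfolding c_def using finite_monoms_UNIV(2)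
        by (intro sum.mono_neutral_left) (auto simp: C_high \<iota>.zero)
      then show ?thesis
        unfolding const.sum sum_distrib_right sum_distrib_left
        by (subst sum.swap) (simp add: const.sum sum_distrib_right const.mult mult.assoc)
    qed
    have sol: "mps_const (mps_coeff e \<beta>) * mps_monom \<beta> = (\<Sum>i\<in>UNIV. ?t (\<lambda>\<beta>. \<Xi> \<beta> i) \<beta> * mps_pderiv i ?f) +
        mps_const (mps_coeff e \<beta>) * (\<Sum>j<l. mps_const (\<iota> (C \<beta> j)) * ?g j) + ?t U \<beta> * ?f" for \<beta>
    proof (cases "\<beta> = 0")
      case True
      then show ?thesis using e(1) by (simp add: mps_max_def)
    next
      case False
      have "(mps_monom \<beta> :: ('b, 'v) mps) = mps_map \<iota> (mps_monom \<beta>)"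
        by (simp add: mps_map_monom[OF \<iota>])
      also have "\<dots> = (\<Sum>i\<in>UNIV. mps_map \<iota> (\<Xi> \<beta> i) * mps_pderiv i ?f) +
          (\<Sum>j<l. mps_const (\<iota> (C \<beta> j)) * ?g j) + mps_map \<iota> (U \<beta>) * ?f"
        unfolding solution[OF False]
        by (simp add: m\<iota>.add m\<iota>.sum m\<iota>.mult mps_map_const[OF \<iota>] mps_map_pderiv[OF \<iota>])
      finally show ?thesis by (simp add: distrib_left sum_distrib_left mult.assoc)
    qed
    have A: "e - (\<Sum>\<beta>\<in>?M. mps_const (mps_coeff e \<beta>) * mps_monom \<beta>) \<in> ord_ge n"
      using e_sum[of "n + d"] antimono[of n "n + d"] by auto
    have B: "(\<Sum>\<beta>\<in>?M. mps_const (mps_coeff e \<beta>) * mps_monom \<beta>) =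
        (\<Sum>i\<in>UNIV. ?X i * mps_pderiv i ?f) + (\<Sum>j<l. mps_const (c j) * ?g j) + ?V * ?f"
      unfolding sol sum.distrib c sum_distrib_right by (subst (2) sum.swap) simp
    have "((\<Sum>i\<in>UNIV. ?X i * mps_pderiv i ?f) + (\<Sum>j<l. mps_const (c j) * ?g j) + ?V * ?f) -
        ((\<Sum>i\<in>UNIV. \<xi> i * mps_pderiv i ?f) + (\<Sum>j<l. mps_const (c j) * ?g j) + v * ?f) \<in> ord_ge n"
      unfolding \<xi>_def v_def
      by (intro ideal_cong_add ideal_cong_sum ideal_cong_mult ideal ideal_cong_sym[OF ideal msum_partial_sum]
          t_ord \<Xi>_ord U_ord) (simp_all add: idealD)
    with A[unfolded B] show ?thesis by (rule ideal_cong_trans[OF ideal])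
  qed
  then have "e = (\<Sum>i\<in>UNIV. \<xi> i * mps_pderiv i ?f) + (\<Sum>j<l. mps_const (c j) * ?g j) + v * ?f"
    by (rule eq_if_cong)
  moreover have "c j \<in> J" for j
    using e(2) by (auto simp: c_def coeffs_in_def intro!: is_idealD(4,7)[OF J])
  moreover have "G = Right_Equiv \<longrightarrow> v = 0"
    by (auto simp: v_def U_Right m\<iota>.zero intro!: mps_eqI simp: mps_coeff_msum)
  moreover have "\<xi> i \<in> coeffs_in J" "v \<in> coeffs_in J" for i
    unfolding \<xi>_def v_def by (rule msumJ)+
  ultimately show ?thesis using \<xi>_max by (intro exI[of _ \<xi>] exI[of _ c] exI[of _ v]) auto
qed

end

section \<open>Formal versality\<close>

lemma ideal_power_1: "is_ideal I \<Longrightarrow> ideal_power I 1 = I"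
  using ideal_prod_least[of I I UNIV] ideal_prodI[of _ I 1 UNIV] by (auto simp: is_idealD)

locale complete_local =
  fixes \<iota> :: "'k :: field \<Rightarrow> 'b :: comm_ring_1"
  assumes cla: "complete_local_algebra \<iota>"
begin

lemma ideal_max: "is_ideal (max_ideal :: 'b set)"
  using cla by (simp add: complete_local_algebra_def)

lemma unit_if_not_max: "(x :: 'b) \<notin> max_ideal \<Longrightarrow> \<exists>y. y * x = 1"
  by (auto simp: nonunits_def mult.commute)

lemma one_not_max: "(1 :: 'b) \<notin> max_ideal"
  by (auto simp: nonunits_def)

lemma unit_if_near_1: "x - 1 \<in> max_ideal \<Longrightarrow> \<exists>y. y * (x :: 'b) = 1"
  using unit_if_not_max[of x] ideal_cong_mem[OF ideal_max ideal_cong_sym[OF ideal_max, of x 1]] one_not_max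
  by blast

sublocale base: ring_morphism \<iota>
proof
  show "\<iota> 1 = 1" using cla unfolding complete_local_algebra_def by (elim conjE)
  show "\<iota> (c + d) = \<iota> c + \<iota> d" for c d
    using cla unfolding complete_local_algebra_def by (elim conjE) simp
  show "\<iota> (c * d) = \<iota> c * \<iota> d" for c d
    using cla unfolding complete_local_algebra_def by (elim conjE) simp
qed

sublocale complete_filtration "ideal_power (max_ideal :: 'b set)"
proof
  have compl0: "\<forall>b :: nat \<Rightarrow> 'b. (\<forall>n. b (Suc n) - b n \<in> ideal_power max_ideal n) \<longrightarrow>
      (\<exists>!b'. \<forall>n. b' - b n \<in> ideal_power max_ideal n)"
    using cla unfolding complete_local_algebra_def by (elim conjE)
  have compl: "\<exists>!b'. \<forall>n. b' - b n \<in> ideal_power max_ideal n"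
    if "\<forall>n. b (Suc n) - b n \<in> ideal_power max_ideal n" for b :: "nat \<Rightarrow> 'b"
    by (rule compl0[THEN spec, of b, THEN mp, OF that])
  show "\<exists>x'. \<forall>n. x' - x n \<in> ideal_power max_ideal n"
    if "\<And>n. x (Suc n) - x n \<in> ideal_power max_ideal n" for x :: "nat \<Rightarrow> 'b"
    by (rule ex1_implies_ex[OF compl]) (simp add: that)
  show "r = 0" if "\<And>n. r \<in> ideal_power max_ideal n" for r :: 'b
  proof -
    have zero: "\<forall>n. (0 :: 'b) \<in> ideal_power max_ideal n"
      by (simp add: is_idealD(1)[OF is_ideal_ideal_power])
    then have "\<exists>!b'. \<forall>n. b' - (0 :: 'b) \<in> ideal_power max_ideal n"
      using compl[of "\<lambda>_. 0"] by simp
    then show ?thesis using that zero by (elim ex1E) (metis diff_zero)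
  qed
  show "\<And>n. ideal_power (max_ideal:: 'b set) (Suc n) \<subseteq> ideal_power max_ideal n"
    by (rule ideal_power_Suc_subset)
qed (simp_all add: is_ideal_ideal_power ideal_power_mult)

lemma power_1: "ideal_power (max_ideal :: 'b set) 1 = max_ideal"
  by (rule ideal_power_1[OF ideal_max])

end

lemma local_alg_hom_ring_morphism: "local_alg_hom \<iota> UNIV \<iota>' \<pi> \<Longrightarrow> ring_morphism \<pi>"
  by unfold_locales (simp_all add: local_alg_hom_def)

text \<open>Continuity for the adic filtrations. It allows a limit taken in B to be compared with
  the prescribed data in C.\<close>

lemma local_alg_hom_ideal_power:
  assumes "local_alg_hom \<iota> UNIV \<iota>' \<pi>" "x \<in> ideal_power max_ideal n"
  shows "\<pi> x \<in> ideal_power max_ideal n"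
  using assms(2)
proof (induction n arbitrary: x)
  case (Suc n)
  interpret \<pi>: ring_morphism \<pi> using assms(1) by (rule local_alg_hom_ring_morphism)
  let ?J = "{x. \<pi> x \<in> ideal_prod max_ideal (ideal_power max_ideal n)}"
  have "is_ideal ?J"
    by (rule is_idealI) (simp_all add: \<pi>.hom_simps is_idealD[OF is_ideal_ideal_prod])
  moreover have "a * b \<in> ?J" if "a \<in> max_ideal" "b \<in> ideal_power max_ideal n" for a b
    using that assms(1) Suc.IH by (auto simp: \<pi>.mult local_alg_hom_def intro!: ideal_prodI)
  ultimately have "ideal_prod max_ideal (ideal_power max_ideal n) \<subseteq> ?J" by (rule ideal_prod_least)
  with Suc.prems show ?case by auto
qed simp

section \<open>The formal base ring and pullbacks of the family\<close>

lemma power_series_ring_supp_on: "power_series_ring l = supp_on {..<l}"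
  by (simp add: power_series_ring_def supp_on_def)

text \<open>An inverse found in the ambient ring may be truncated to the monomials in
  \<open>V\<close>: a monomial in \<open>V\<close> splits only into monomials in \<open>V\<close>,
  so the product is unaffected there.\<close>

lemma nonunits_supp_on_iff:
  fixes a :: "('k :: field, 'v) mps"
  assumes a: "a \<in> supp_on V"
  shows "a \<in> nonunits (supp_on V) \<longleftrightarrow> mps_coeff a 0 = 0"
proof
  assume "mps_coeff a 0 = 0"
  then have "a * b \<noteq> 1" for b
    using mps_coeff_mult_0[of a b] by (metis mps_coeff_one mult_zero_left zero_neq_one)
  with a show "a \<in> nonunits (supp_on V)" by (simp add: nonunits_def)
next
  assume nu: "a \<in> nonunits (supp_on V)"
  show "mps_coeff a 0 = 0"
  proof (rule ccontr)
    assume "mps_coeff a 0 \<noteq> 0"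
    then have "a dvd 1" by (intro mps_unit[of "inverse (mps_coeff a 0)"]) simp
    then obtain b where b: "1 = a * b" by (auto elim: dvdE)
    define c where "c = Abs_mps (\<lambda>m. if Poly_Mapping.keys m \<subseteq> V then mps_coeff b m else 0)"
    have c: "mps_coeff c m = (if Poly_Mapping.keys m \<subseteq> V then mps_coeff b m else 0)" for m
      by (simp add: c_def Abs_mps_inverse)
    then have cV: "c \<in> supp_on V" by (auto simp: supp_on_def)
    have "a * c = 1"
    proof (rule mps_eqI)
      fix m
      show "mps_coeff (a * c) m = mps_coeff 1 m"
      proof (cases "Poly_Mapping.keys m \<subseteq> V")
        case True
        have "mps_coeff (a * c) m = mps_coeff (a * b) m"
          unfolding mps_coeff_mult by (rule sum.cong) (use True in \<open>auto simp: c keys_add_nat\<close>)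
        with b show ?thesis by simp
      next
        case False
        then have "mps_coeff (a * c) m = 0"
          using supp_on_mult[OF a cV] by (auto simp: supp_on_def)
        moreover have "m \<noteq> 0" using False by auto
        ultimately show ?thesis by (simp add: mps_coeff_one)
      qed
    qed
    with nu cV show False by (auto simp: nonunits_def)
  qed
qed

lemma mps_var_nonunit:
  "j < l \<Longrightarrow> mps_var j \<in> nonunits (power_series_ring l :: ('k :: field, nat) mps set)"
  unfolding power_series_ring_supp_on
  by (subst nonunits_supp_on_iff) (auto intro: supp_on_monom simp: mps_coeff_monom)

text \<open>The pullback of the linear unfolding along the map sending the parameter
  \<open>t\<close> with index \<open>j\<close> to \<open>b j\<close>, over an arbitrary K-algebra.
  It describes deformations over B and C, families over polynomial rings, and, with
  \<open>\<iota>\<close> the identity, single fibres.\<close>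

definition linear_family ::
    "('k \<Rightarrow> 'b :: comm_ring_1) \<Rightarrow> ('k, 'v) mps \<Rightarrow> nat \<Rightarrow> (nat \<Rightarrow> ('k, 'v) mps) \<Rightarrow> (nat \<Rightarrow> 'b) \<Rightarrow> ('b, 'v) mps" where
  "linear_family \<iota> f l g b = mps_map \<iota> f + (\<Sum>j<l. mps_const (b j) * mps_map \<iota> (g j))"

lemma mps_coeff_of_mpoly [simp]: "mps_coeff (mps_of_mpoly p) m = Poly_Mapping.lookup p m"
  by (simp add: mps_of_mpoly_def Abs_mps_inverse)

lemma mps_of_mpoly_add: "mps_of_mpoly (p + q) = mps_of_mpoly p + mps_of_mpoly q"
  by (rule mps_eqI) (simp add: lookup_add)

lemma mps_of_mpoly_sum: "mps_of_mpoly (sum p A) = (\<Sum>x\<in>A. mps_of_mpoly (p x))"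
  by (rule mps_eqI) (simp add: lookup_sum)

lemma mps_of_mpoly_single: "mps_of_mpoly (Poly_Mapping.single m c) = mps_const c * mps_monom m"
  by (rule mps_eqI) (simp add: lookup_single mps_coeff_monom when_def)

lemma linear_unfolding_coeff:
  "mps_coeff (linear_unfolding f l g) m =
    mpoly_const (mps_coeff f m) + (\<Sum>i<l. mpoly_var i * mpoly_const (Poly_Mapping.lookup (g i) m))"
  by (simp add: linear_unfolding_def)

lemma formal_family_coeff:
  "mps_coeff (formal_family (linear_unfolding f l g)) m =
    mps_const (mps_coeff f m) + (\<Sum>i<l. mps_var i * mps_const (Poly_Mapping.lookup (g i) m))"
  by (simp add: formal_family_def linear_unfolding_coeff mps_of_mpoly_add mps_of_mpoly_sum
      mpoly_const_def mpoly_var_def mult_single mps_of_mpoly_single mult.commute)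

lemma formal_family_coeff_supp: "mps_coeff (formal_family (linear_unfolding f l g)) m \<in> supp_on {..<l}"
  unfolding formal_family_coeff
  by (intro supp_on_add supp_on_sum supp_on_mult supp_on_const supp_on_monom) auto

lemma hom_formal_family:
  assumes h: "local_alg_hom mps_const (power_series_ring l) \<iota> h" and \<iota>: "ring_morphism \<iota>"
  shows "mps_map h (formal_family (linear_unfolding f l g)) =
    linear_family \<iota> f l (\<lambda>i. mps_of_mpoly (g i)) (\<lambda>j. h (mps_var j))"
proof (rule mps_eqI)
  fix m
  interpret \<iota>: ring_morphism \<iota> by fact
  have add: "h (a + b) = h a + h b" if "a \<in> supp_on {..<l}" "b \<in> supp_on {..<l}" for a b
    using h that by (simp add: local_alg_hom_def power_series_ring_supp_on)
  have mult: "h (a * b) = h a * h b" if "a \<in> supp_on {..<l}" "b \<in> supp_on {..<l}" for a b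
    using h that by (simp add: local_alg_hom_def power_series_ring_supp_on)
  have const: "h (mps_const c) = \<iota> c" for c using h by (simp add: local_alg_hom_def)
  have zero: "h 0 = 0" using const[of 0] \<iota>.zero by simp
  have vc: "mps_var i * mps_const c \<in> supp_on {..<l}" if "i < l" for i c
    using that by (intro supp_on_mult supp_on_const supp_on_monom) auto
  have "h (mps_const (mps_coeff f m) + (\<Sum>i<l. mps_var i * mps_const (Poly_Mapping.lookup (g i) m))) =
      h (mps_const (mps_coeff f m)) + h (\<Sum>i<l. mps_var i * mps_const (Poly_Mapping.lookup (g i) m))"
    by (intro add supp_on_const supp_on_sum vc) auto
  also have "h (\<Sum>i<l. mps_var i * mps_const (Poly_Mapping.lookup (g i) m)) =
      (\<Sum>i<l. h (mps_var i * mps_const (Poly_Mapping.lookup (g i) m)))"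
    by (rule additive_on_supp_sum[where V = "{..<l}"]) (auto simp: zero add vc)
  also have "\<dots> = (\<Sum>i<l. h (mps_var i) * \<iota> (Poly_Mapping.lookup (g i) m))"
    by (intro sum.cong) (auto simp: mult supp_on_const supp_on_monom const)
  finally show "mps_coeff (mps_map h (formal_family (linear_unfolding f l g))) m =
      mps_coeff (linear_family \<iota> f l (\<lambda>i. mps_of_mpoly (g i)) (\<lambda>j. h (mps_var j))) m"
    by (simp add: formal_family_coeff linear_family_def const)
qed

lemma formal_family_deformation:
  fixes f :: "('k :: field, 'v) mps"
  assumes "f \<in> mps_max" "\<And>i. i < l \<Longrightarrow> mps_of_mpoly (g i) \<in> mps_max"
  shows "deformation f mps_const (power_series_ring l) (formal_family (linear_unfolding f l g))"
proof -
  let ?F = "formal_family (linear_unfolding f l g)"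
  have "mps_coeff ?F m - mps_const (mps_coeff f m) \<in> nonunits (supp_on {..<l})" for m
  proof (subst nonunits_supp_on_iff)
    show "mps_coeff ?F m - mps_const (mps_coeff f m) \<in> supp_on {..<l}"
      by (intro supp_on_diff formal_family_coeff_supp supp_on_const)
    have "(mps_var i :: ('k, nat) mps) \<in> mps_max" for i by simp
    then show "mps_coeff (mps_coeff ?F m - mps_const (mps_coeff f m)) 0 = 0"
      by (simp add: formal_family_coeff mps_coeff_mult_0 mps_max_def)
  qed
  moreover have "mps_coeff ?F 0 = 0"
    using assms by (simp add: formal_family_coeff mps_max_def)
  ultimately show ?thesis
    using formal_family_coeff_supp[of f l g]
    by (simp add: deformation_def power_series_ring_supp_on mps_max_def)
qed

section \<open>Newton iteration over a complete local algebra\<close>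

context tangent_solution
begin

lemma linear_family_max: "ring_morphism \<iota> \<Longrightarrow> linear_family \<iota> f l g b \<in> mps_max"
  using f_max g_max by (simp add: linear_family_def mps_max_def ring_morphism.zero)

lemma linear_family_add:
  "linear_family \<iota> f l g (\<lambda>j. b j + c j) = linear_family \<iota> f l g b + (\<Sum>j<l. mps_const (c j) * mps_map \<iota> (g j))"
  by (simp add: linear_family_def mps_const_add distrib_right sum.distrib)

lemma linear_family_cong:
  assumes "is_ideal J" "\<And>j. j < l \<Longrightarrow> b j - c j \<in> J"
  shows "linear_family \<iota> f l g b - linear_family \<iota> f l g c \<in> coeffs_in J"
proof -
  have "mps_coeff (linear_family \<iota> f l g b - linear_family \<iota> f l g c) m =
      (\<Sum>j<l. (b j - c j) * \<iota> (mps_coeff (g j) m))" for m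
    by (simp add: linear_family_def sum_subtractf left_diff_distrib)
  then show ?thesis
    using assms(2) by (auto simp: coeffs_in_def simp del: mps_coeff_simps intro!: is_idealD(4,7)[OF assms(1)])
qed

text \<open>Continuity of the action in all its data at once; it turns the approximate solutions of
  the iteration into an exact one in the limit.\<close>

lemma family_action_cong:
  fixes \<phi> \<phi>' :: "'v \<Rightarrow> ('b :: comm_ring_1, 'v) mps"
  assumes J: "is_ideal J" and \<phi>: "\<forall>i. \<phi> i \<in> mps_max" "\<forall>i. \<phi>' i \<in> mps_max" "\<And>i. \<phi> i - \<phi>' i \<in> coeffs_in J"
    and u: "u - u' \<in> coeffs_in J" and b: "\<And>j. j < l \<Longrightarrow> b j - b' j \<in> J"
  shows "u * mps_subst \<phi> (linear_family \<iota> f l g b) - u' * mps_subst \<phi>' (linear_family \<iota> f l g b') \<in> coeffs_in J"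
proof -
  interpret \<phi>': ring_morphism "mps_subst \<phi>'" using \<phi>(2) by (rule ring_morphism_subst)
  have "mps_subst \<phi> (linear_family \<iota> f l g b) - mps_subst \<phi>' (linear_family \<iota> f l g b) \<in> coeffs_in J"
    by (intro subst_cong is_ideal_coeffs_in ord_closed_coeffs_in J \<phi>)
  moreover have "mps_subst \<phi>' (linear_family \<iota> f l g b) - mps_subst \<phi>' (linear_family \<iota> f l g b') \<in> coeffs_in J"
    unfolding \<phi>'.minus[symmetric] by (intro subst_coeffs_in J \<phi> linear_family_cong b)
  ultimately have "mps_subst \<phi> (linear_family \<iota> f l g b) - mps_subst \<phi>' (linear_family \<iota> f l g b') \<in> coeffs_in J"
    by (rule ideal_cong_trans[OF is_ideal_coeffs_in[OF J]])
  then show ?thesis by (intro ideal_cong_mult is_ideal_coeffs_in J u)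
qed

text \<open>The linear equation at \<open>f\<close> is solved exactly with the current error as
  right-hand side. What remains is the remainder of \<open>newton_step\<close> with corrections in
  \<open>J\<close> and deviations in \<open>m\<close>, hence a new error in
  \<open>ideal_prod m J\<close>.\<close>

lemma formal_newton_step:
  fixes \<iota> :: "'k \<Rightarrow> 'b :: comm_ring_1" and J m :: "'b set"
  assumes \<iota>: "ring_morphism \<iota>" and m: "is_ideal m" and J: "is_ideal J" "J \<subseteq> m"
    and \<phi>: "\<forall>i. \<phi> i \<in> mps_max" "\<And>i. \<phi> i - mps_var i \<in> coeffs_in m"
    and u: "u - 1 \<in> coeffs_in m" and b: "\<And>j. b j \<in> m" and H: "H \<in> mps_max"
    and err: "H - u * mps_subst \<phi> (linear_family \<iota> f l g b) \<in> coeffs_in J"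
  shows "\<exists>\<xi> c v. (\<forall>i. \<xi> i \<in> mps_max) \<and> (\<forall>i. \<xi> i \<in> coeffs_in J) \<and> (\<forall>j. c j \<in> J) \<and> v \<in> coeffs_in J \<and>
    (G = Right_Equiv \<longrightarrow> v = 0) \<and>
    H - (u + v) * mps_subst (\<lambda>i. \<phi> i + \<xi> i) (linear_family \<iota> f l g (\<lambda>j. b j + c j)) \<in> coeffs_in (ideal_prod m J)"
proof -
  let ?F = "linear_family \<iota> f l g b" and ?f = "mps_map \<iota> f"
  let ?e = "H - u * mps_subst \<phi> ?F"
  have "?e \<in> mps_max"
    by (intro is_idealD(3,6)[OF is_ideal_mps_max] H subst_mem_max \<phi> linear_family_max \<iota>)
  from solve_linear[OF \<iota> J(1) this err] obtain \<xi> c v where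
    \<xi>: "\<forall>i. \<xi> i \<in> mps_max" "\<forall>i. \<xi> i \<in> coeffs_in J" and c: "\<forall>j. c j \<in> J" and v: "v \<in> coeffs_in J"
    "G = Right_Equiv \<longrightarrow> v = 0" and e: "?e = (\<Sum>i\<in>UNIV. \<xi> i * mps_pderiv i ?f) +
      (\<Sum>j<l. mps_const (c j) * mps_map \<iota> (g j)) + v * ?f" by blast
  let ?\<gamma> = "\<Sum>j<l. mps_const (c j) * mps_map \<iota> (g j)"
  let ?Q = "coeffs_in (ideal_prod m J) :: ('b, 'v) mps set"
  have Q: "is_ideal ?Q" by (intro is_ideal_coeffs_in is_ideal_ideal_prod)
  have \<gamma>J: "?\<gamma> \<in> coeffs_in J"
    using c by (auto simp: coeffs_in_def intro!: is_idealD(4,7)[OF J(1)])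
  have F: "?F - ?f \<in> coeffs_in m" "?F + ?\<gamma> - ?f \<in> coeffs_in m"
    using b c J(2) by (auto simp: linear_family_def coeffs_in_def intro!: is_idealD(2,4,7)[OF m])
  have der: "mps_pderiv i (?F + ?\<gamma>) - mps_pderiv i ?f \<in> coeffs_in m" for i
    using F(2) unfolding mps_pderiv_diff[symmetric]
    by (simp only: coeffs_in_def mem_Collect_eq mps_coeff_pderiv) (intro allI is_idealD(3)[OF m], simp)
  have N: "(u + v) * mps_subst (\<lambda>i. \<phi> i + \<xi> i) (?F + ?\<gamma>) -
    (u * mps_subst \<phi> ?F + (\<Sum>i\<in>UNIV. \<xi> i * mps_pderiv i ?f) + ?\<gamma> + v * ?f) \<in> ?Q"
  proof (rule newton_step[where E = "coeffs_in J" and M = "coeffs_in m"])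
    show "a * b \<in> ?Q" if "a \<in> coeffs_in J" "b \<in> coeffs_in m" for a b :: "('b, 'v) mps"
      using coeffs_in_mult[OF that(2,1)] by (simp add: mult.commute)
    show "a * b \<in> ?Q" if "a \<in> coeffs_in J" "b \<in> coeffs_in J" for a b :: "('b, 'v) mps"
      using coeffs_in_mult[of a m b J] that J(2) by (auto simp: coeffs_in_def)
    show "mps_const (mps_coeff ?\<gamma> k) \<in> coeffs_in J" for k
      using \<gamma>J J(1) by (intro coeffs_in_const) (auto simp: coeffs_in_def)
  qed (use \<xi> \<phi> v \<gamma>J F der u J m in \<open>auto simp: is_ideal_coeffs_in ord_closed_coeffs_in is_ideal_ideal_prod\<close>)
  have E: "u * mps_subst \<phi> ?F + (\<Sum>i\<in>UNIV. \<xi> i * mps_pderiv i ?f) + ?\<gamma> + v * ?f = H"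
    using e by (simp add: algebra_simps)
  have "H - (u + v) * mps_subst (\<lambda>i. \<phi> i + \<xi> i) (?F + ?\<gamma>) \<in> ?Q"
    by (rule ideal_cong_sym[OF Q N[unfolded E]])
  then show ?thesis using \<xi> c v unfolding linear_family_add[symmetric]
    by (intro exI[of _ \<xi>] exI[of _ c] exI[of _ v]) auto
qed

end

text \<open>In a local ring an element congruent to 1 is a unit, so the one-sided inverses up to a
  factor provided by the elimination become true one-sided inverses of the linear part.\<close>

lemma (in complete_local) near_identity_subst_bij:
  fixes \<phi> :: "'v :: finite \<Rightarrow> ('b, 'v) mps"
  assumes \<phi>: "\<forall>i. \<phi> i \<in> mps_max" "\<forall>i. \<phi> i - mps_var i \<in> coeffs_in max_ideal"
  shows "bij (mps_subst \<phi>)"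
proof -
  let ?A = "linear_coeff \<phi>"
  have A: "?A i j \<in> UNIV \<and> ?A i j - (if i = j then 1 else 0) \<in> max_ideal" for i j
  proof -
    have "mps_coeff (\<phi> i - mps_var i) (Poly_Mapping.single j (Suc 0)) = ?A i j - (if i = j then 1 else 0)"
      by (auto simp: linear_coeff_def mps_coeff_monom)
    then show ?thesis using \<phi>(2) unfolding coeffs_in_def by (metis (mono_tags, lifting) UNIV_I mem_Collect_eq)
  qed
  have UNIV: "is_subring (UNIV :: 'b set)" by (simp add: is_subring_def)
  obtain L h where L: "h - 1 \<in> max_ideal" "\<And>i k. (\<Sum>j\<in>UNIV. L i j * ?A j k) = (if i = k then h else 0)"
    using near_identity_left_inverse[OF finite_UNIV UNIV ideal_max A] by auto
  obtain R h' where R: "h' - 1 \<in> max_ideal" "\<And>i k. (\<Sum>j\<in>UNIV. ?A i j * R j k) = (if i = k then h' else 0)"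
    using near_identity_right_inverse[OF finite_UNIV UNIV ideal_max A] by auto
  obtain y where y: "y * h = 1" using unit_if_near_1[OF L(1)] by blast
  obtain y' where y': "y' * h' = 1" using unit_if_near_1[OF R(1)] by blast
  show ?thesis
  proof (rule subst_bij[OF \<phi>(1)])
    fix i k
    have "(\<Sum>j\<in>UNIV. y * L i j * ?A j k) = y * (if i = k then h else 0)"
      by (simp only: L(2)[symmetric] sum_distrib_left mult.assoc)
    then show "(\<Sum>j\<in>UNIV. y * L i j * ?A j k) = (if i = k then 1 else 0)" by (simp add: y)
    have "(\<Sum>j\<in>UNIV. ?A i j * (y' * R j k)) = y' * (if i = k then h' else 0)"
      by (simp only: R(2)[symmetric] sum_distrib_left mult.left_commute)
    then show "(\<Sum>j\<in>UNIV. ?A i j * (y' * R j k)) = (if i = k then 1 else 0)" by (simp add: y')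
  qed
qed

text \<open>Over a base with nilpotents an automorphism may send a variable to a series with nonzero
  nilpotent constant term. Invariance of \<open>mps_max\<close> excludes this and makes the
  automorphism a substitution in the sense of \<open>mps_subst\<close>.\<close>

lemma auts_eq_subst:
  fixes \<Phi> :: "('a :: comm_ring_1, 'v :: finite) mps \<Rightarrow> ('a, 'v) mps"
  assumes "\<Phi> \<in> mps_auts" "\<Phi> ` mps_max = mps_max"
  shows "\<Phi> = mps_subst (\<lambda>i. \<Phi> (mps_var i))" "\<forall>i. \<Phi> (mps_var i) \<in> mps_max"
proof -
  have "\<Phi> (mps_var i) \<in> \<Phi> ` mps_max" for i by (intro imageI mps_var_max)
  then show *: "\<forall>i. \<Phi> (mps_var i) \<in> mps_max" by (simp add: assms(2))
  show "\<Phi> = mps_subst (\<lambda>i. \<Phi> (mps_var i))"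
    using assms(1) by (intro subst_unique *) (simp_all add: mps_auts_def)
qed

lemma local_alg_hom_lift_max:
  assumes "local_alg_hom \<iota> UNIV \<iota>' \<pi>" "\<pi> x \<in> max_ideal"
  shows "x \<in> max_ideal"
proof (rule ccontr)
  interpret \<pi>: ring_morphism \<pi> using assms(1) by (rule local_alg_hom_ring_morphism)
  assume "x \<notin> max_ideal"
  then obtain y where "x * y = 1" by (auto simp: nonunits_def)
  then have "\<pi> x * \<pi> y = 1" using \<pi>.mult[of x y] \<pi>.one by simp
  with assms(2) show False by (auto simp: nonunits_def)
qed

lemma (in tangent_solution) lift_equivalence:
  fixes \<iota>B :: "'k \<Rightarrow> 'b :: comm_ring_1" and \<iota>C :: "'k \<Rightarrow> 'c :: comm_ring_1" and c :: "nat \<Rightarrow> 'c"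
  assumes B: "complete_local \<iota>B" and C: "complete_local \<iota>C"
    and \<pi>: "local_alg_hom \<iota>B UNIV \<iota>C \<pi>" "surj \<pi>" and H: "deformation f \<iota>B UNIV H"
    and \<phi>C: "\<forall>i. \<phi>C i \<in> mps_max" "\<forall>i. \<phi>C i - mps_var i \<in> coeffs_in max_ideal"
    and uC: "uC - 1 \<in> coeffs_in max_ideal" "G = Right_Equiv \<longrightarrow> uC = 1"
    and c: "\<forall>j<l. c j \<in> max_ideal"
    and eq: "mps_map \<pi> H = uC * mps_subst \<phi>C (linear_family \<iota>C f l g c)"
  shows "\<exists>\<phi> b u. (\<forall>i. \<phi> i \<in> mps_max) \<and> (\<forall>i. \<phi> i - mps_var i \<in> coeffs_in max_ideal) \<and>
    (\<forall>j. b j \<in> max_ideal) \<and> u - 1 \<in> coeffs_in max_ideal \<and> (G = Right_Equiv \<longrightarrow> u = 1) \<and>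
    (\<forall>i. mps_map \<pi> (\<phi> i) = \<phi>C i) \<and> (\<forall>j<l. \<pi> (b j) = c j) \<and> mps_map \<pi> u = uC \<and>
    H = u * mps_subst \<phi> (linear_family \<iota>B f l g b)"
proof -
  interpret B: complete_local \<iota>B by fact
  interpret C: complete_local \<iota>C by fact
  interpret \<pi>: ring_morphism \<pi> using \<pi>(1) by (rule local_alg_hom_ring_morphism)
  interpret m\<pi>: ring_morphism "mps_map \<pi> :: ('b, 'v) mps \<Rightarrow> _"
    by (rule ring_morphism_mps_map) (rule \<pi>.ring_morphism_axioms)
  let ?m = "max_ideal :: 'b set"
  \<comment> \<open>\<open>J n\<close> is the \<open>n\<close>-th power of \<open>?m\<close> times
    the kernel of \<open>\<pi>\<close>. The kernel factor leaves the image in C untouched, the power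
    forces convergence in B.\<close>
  define I where "I = {x. \<pi> x = 0}"
  define J where "J = rec_nat I (\<lambda>_. ideal_prod ?m)"
  have J: "J 0 = I" "J (Suc n) = ideal_prod ?m (J n)" for n by (simp_all add: J_def)
  have idI: "is_ideal I" by (rule is_idealI) (simp_all add: I_def \<pi>.hom_simps)
  have idJ: "is_ideal (J n)" for n by (cases n) (simp_all add: J idI is_ideal_ideal_prod)
  have JI: "J n \<subseteq> I" for n
  proof (induction n)
    case (Suc n)
    then show ?case using ideal_prod_subset[OF idJ, of ?m n] by (simp add: J)
  qed (simp add: J)
  have Im: "I \<subseteq> ?m"
    using local_alg_hom_lift_max[OF \<pi>(1)] is_idealD(1)[OF C.ideal_max] by (auto simp: I_def)
  have Jm: "J n \<subseteq> ?m" for n using JI Im by blast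
  have Jp: "J n \<subseteq> ideal_power ?m n" for n
  proof (induction n)
    case (Suc n)
    then show ?case using ideal_prod_mono[of ?m ?m "J n"] by (simp add: J)
  qed simp
  have coeffs_J: "coeffs_in (J n) \<subseteq> (coeffs_in ?m :: ('b, 'v) mps set)"
    "coeffs_in (J n) \<subseteq> (coeffs_in (ideal_power ?m n) :: ('b, 'v) mps set)" for n
    using Jm[of n] Jp[of n] by (auto simp: coeffs_in_def)
  have \<pi>_eq: "mps_map \<pi> X = mps_map \<pi> Y" if "X - Y \<in> coeffs_in (J n)" for X Y :: "('b, 'v) mps" and n
  proof (rule mps_eqI)
    fix m
    have "mps_coeff (X - Y) m \<in> I" using that JI[of n] unfolding coeffs_in_def by blast
    then show "mps_coeff (mps_map \<pi> X) m = mps_coeff (mps_map \<pi> Y) m"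
      by (simp add: I_def \<pi>.minus)
  qed
  note mx = B.ideal_max
  note cmx = is_ideal_coeffs_in[OF B.ideal_max]
  have Hmax: "H \<in> mps_max" using H by (simp add: deformation_def)

  \<comment> \<open>Only a set-theoretic section of \<open>\<pi>\<close>. Its value 0 at 0 lets
    lifted series keep a vanishing constant term.\<close>
  obtain lft :: "'c \<Rightarrow> 'b" where lft: "\<And>y. \<pi> (lft y) = y" "lft 0 = 0"
  proof
    show "\<pi> (if y = 0 then 0 else inv \<pi> y) = y" for y
      using surj_f_inv_f[OF \<pi>(2)] by (simp add: \<pi>.zero)
  qed simp
  have map_lft: "mps_map \<pi> (mps_map lft X) = X" for X :: "('c, 'v) mps"
    by (rule mps_eqI) (simp add: lft)
  have lift_max: "X \<in> coeffs_in ?m" if "mps_map \<pi> X \<in> coeffs_in max_ideal" for X :: "('b, 'v) mps"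
    using that local_alg_hom_lift_max[OF \<pi>(1)] by (auto simp: coeffs_in_def)

  define P where "P = (\<lambda>n (\<phi>, b, u). (\<forall>i. \<phi> i \<in> mps_max) \<and> (\<forall>i. \<phi> i - mps_var i \<in> coeffs_in ?m) \<and>
    (\<forall>j. b j \<in> ?m) \<and> u - 1 \<in> coeffs_in ?m \<and> (G = Right_Equiv \<longrightarrow> u = 1) \<and>
    (\<forall>i. mps_map \<pi> (\<phi> i) = \<phi>C i) \<and> (\<forall>j<l. \<pi> (b j) = c j) \<and> mps_map \<pi> u = uC \<and>
    H - u * mps_subst \<phi> (linear_family \<iota>B f l g b) \<in> coeffs_in (J n))"
  define R where "R = (\<lambda>n (\<phi>, b, u) (\<phi>', b', u').
    (\<forall>i :: 'v. \<phi>' i - \<phi> i \<in> (coeffs_in (J n) :: ('b, 'v) mps set)) \<and>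
    (\<forall>j :: nat. b' j - b j \<in> J n) \<and> u' - u \<in> (coeffs_in (J n) :: ('b, 'v) mps set) \<and> (G = Right_Equiv \<longrightarrow> u' = u))"
  have start: "\<exists>s. P 0 s"
  proof -
    define \<phi> where "\<phi> i = mps_map lft (\<phi>C i)" for i
    define b where "b j = (if j < l then lft (c j) else 0)" for j
    \<comment> \<open>The coefficientwise lift of the series 1 need not be 1, so right equivalence
      is treated apart.\<close>
    define u where "u = (if G = Right_Equiv then 1 else mps_map lft uC)"
    have \<pi>\<phi>: "mps_map \<pi> (\<phi> i) = \<phi>C i" for i by (simp add: \<phi>_def map_lft)
    have \<pi>u: "mps_map \<pi> u = uC" using uC(2) by (simp add: u_def map_lft m\<pi>.one)
    have \<pi>b: "\<forall>j<l. \<pi> (b j) = c j" by (simp add: b_def lft)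
    have \<phi>_max: "\<forall>i. \<phi> i \<in> mps_max" using \<phi>C(1) by (simp add: \<phi>_def mps_max_def lft)
    have "\<phi> i - mps_var i \<in> coeffs_in ?m" for i
      using \<phi>C(2) by (intro lift_max) (simp add: m\<pi>.minus \<pi>\<phi> mps_map_monom[OF \<pi>.ring_morphism_axioms])
    moreover have "u - 1 \<in> coeffs_in ?m"
      using uC(1) by (intro lift_max) (simp add: m\<pi>.hom_simps \<pi>u)
    moreover have "b j \<in> ?m" for j
    proof (cases "j < l")
      case True
      then show ?thesis using \<pi>b c local_alg_hom_lift_max[OF \<pi>(1), of "b j"] by simp
    qed (simp add: b_def is_idealD[OF mx])
    moreover have "H - u * mps_subst \<phi> (linear_family \<iota>B f l g b) \<in> coeffs_in (J 0)"
    proof -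
      have \<iota>: "\<pi> (\<iota>B x) = \<iota>C x" for x using \<pi>(1) by (simp add: local_alg_hom_def)
      have "mps_map \<pi> (linear_family \<iota>B f l g b) = linear_family \<iota>C f l g c"
        by (rule mps_eqI) (use \<pi>b in \<open>simp add: linear_family_def \<pi>.add \<pi>.sum \<pi>.mult \<iota>\<close>)
      then have "mps_map \<pi> (H - u * mps_subst \<phi> (linear_family \<iota>B f l g b)) = 0"
        using eq by (simp add: m\<pi>.hom_simps mps_map_subst[OF \<pi>.ring_morphism_axioms \<phi>_max] \<pi>\<phi> \<pi>u)
      then have "\<pi> (mps_coeff (H - u * mps_subst \<phi> (linear_family \<iota>B f l g b)) m) = 0" for m
        by (metis mps_map.rep_eq zero_mps.rep_eq)
      then show ?thesis by (simp only: coeffs_in_def J I_def mem_Collect_eq) simp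
    qed
    moreover have "G = Right_Equiv \<longrightarrow> u = 1" by (simp add: u_def)
    ultimately have "P 0 (\<phi>, b, u)" using \<phi>_max \<pi>\<phi> \<pi>b \<pi>u unfolding P_def by simp
    then show ?thesis by blast
  qed
  have step: "\<exists>s'. P (Suc n) s' \<and> R n s s'" if "P n s" for n s
  proof -
    obtain \<phi> b u where s: "s = (\<phi>, b, u)" by (metis prod.exhaust)
    from that have \<phi>: "\<forall>i. \<phi> i \<in> mps_max" "\<forall>i. \<phi> i - mps_var i \<in> coeffs_in ?m" and b: "\<forall>j. b j \<in> ?m"
      and u: "u - 1 \<in> coeffs_in ?m" "G = Right_Equiv \<longrightarrow> u = 1" and \<pi>\<phi>: "\<forall>i. mps_map \<pi> (\<phi> i) = \<phi>C i"
      and \<pi>b: "\<forall>j<l. \<pi> (b j) = c j" and \<pi>u: "mps_map \<pi> u = uC"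
      and err: "H - u * mps_subst \<phi> (linear_family \<iota>B f l g b) \<in> coeffs_in (J n)"
      unfolding s P_def by simp_all
    obtain \<xi> e v where \<xi>: "\<forall>i. \<xi> i \<in> mps_max" "\<forall>i. \<xi> i \<in> coeffs_in (J n)" and e: "\<forall>j. e j \<in> J n"
      and v: "v \<in> coeffs_in (J n)" "G = Right_Equiv \<longrightarrow> v = 0"
      and err': "H - (u + v) * mps_subst (\<lambda>i. \<phi> i + \<xi> i) (linear_family \<iota>B f l g (\<lambda>j. b j + e j))
        \<in> coeffs_in (J (Suc n))"
      using formal_newton_step[OF B.base.ring_morphism_axioms mx idJ Jm \<phi>(1) \<phi>(2)[rule_format] u(1)
          b[rule_format] Hmax err] unfolding J by blast
    let ?s = "(\<lambda>i. \<phi> i + \<xi> i, \<lambda>j. b j + e j, u + v)"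
    have "R n s ?s" unfolding R_def s using \<xi> e v by simp
    moreover have "P (Suc n) ?s"
      unfolding P_def case_prod_conv
    proof (intro conjI allI impI)
      fix i
      show "\<phi> i + \<xi> i \<in> mps_max" using \<phi> \<xi> is_idealD(2)[OF is_ideal_mps_max] by blast
      have "\<phi> i - mps_var i + \<xi> i \<in> coeffs_in ?m"
        using \<phi>(2) \<xi>(2) coeffs_J(1)[of n] by (intro is_idealD(2)[OF cmx]) auto
      then show "\<phi> i + \<xi> i - mps_var i \<in> coeffs_in ?m" by (simp add: algebra_simps)
      show "mps_map \<pi> (\<phi> i + \<xi> i) = \<phi>C i"
        using \<pi>_eq[of "\<phi> i + \<xi> i" "\<phi> i" n] \<xi>(2) \<pi>\<phi> by simp
    next
      fix j show "b j + e j \<in> ?m" using b e Jm[of n] by (intro is_idealD(2)[OF mx]) auto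
    next
      fix j assume "j < l"
      moreover have "\<pi> (e j) = 0" using e JI[of n] unfolding I_def by blast
      ultimately show "\<pi> (b j + e j) = c j" using \<pi>b by (simp add: \<pi>.add)
    next
      have "u - 1 + v \<in> coeffs_in ?m"
        using u(1) v(1) coeffs_J(1)[of n] by (intro is_idealD(2)[OF cmx]) auto
      then show "u + v - 1 \<in> coeffs_in ?m" by (simp add: algebra_simps)
      show "mps_map \<pi> (u + v) = uC" using \<pi>_eq[of "u + v" u n] v(1) \<pi>u by simp
    next
      assume "G = Right_Equiv"
      then show "u + v = 1" using u(2) v(2) by simp
    qed (rule err')
    ultimately show ?thesis by blast
  qed
  obtain s where s: "\<And>n. P n (s n)" "\<And>n. R n (s n) (s (Suc n))"
    using dependent_nat_choice[of P R, OF start step] by blast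
  define \<phi> where "\<phi> n = fst (s n)" for n
  define b where "b n = fst (snd (s n))" for n
  define u where "u n = snd (snd (s n))" for n
  have s_eq: "s n = (\<phi> n, b n, u n)" for n by (simp add: \<phi>_def b_def u_def)
  note Ps = s(1)[unfolded s_eq P_def case_prod_conv] and Rs = s(2)[unfolded s_eq R_def case_prod_conv]
  have "\<exists>x. \<forall>n. x - \<phi> n i \<in> coeffs_in (ideal_power ?m n)" for i
    using Rs coeffs_J(2) by (intro B.coeffs_in_limit) blast
  then obtain \<phi>' where \<phi>': "\<And>i n. \<phi>' i - \<phi> n i \<in> coeffs_in (ideal_power ?m n)" by metis
  have "\<exists>x. \<forall>n. x - b n j \<in> ideal_power ?m n" for j
    using Rs Jp by (intro B.complete) blast
  then obtain b' where b': "\<And>j n. b' j - b n j \<in> ideal_power ?m n" by metis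
  have "\<exists>x. \<forall>n. x - u n \<in> coeffs_in (ideal_power ?m n)"
    using Rs coeffs_J(2) by (intro B.coeffs_in_limit) blast
  then obtain u' where u': "\<And>n. u' - u n \<in> coeffs_in (ideal_power ?m n)" by metis
  have eqB: "X = Y" if "\<And>n. X - Y \<in> coeffs_in (ideal_power ?m n)" for X Y :: "('b, 'v) mps"
    using that by (intro mps_eqI B.eq_if_cong) (simp add: coeffs_in_def)
  have eqC: "X = Y" if "\<And>n. X - Y \<in> coeffs_in (ideal_power max_ideal n)" for X Y :: "('c, 'v) mps"
    using that by (intro mps_eqI C.eq_if_cong) (simp add: coeffs_in_def)
  \<comment> \<open>The limit still projects to the prescribed data: \<open>\<pi>\<close> respects
    the powers of the maximal ideals, and the filtration of C is separated.\<close>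
  have \<pi>_mem: "mps_map \<pi> X - mps_map \<pi> Y \<in> coeffs_in (ideal_power max_ideal n)"
    if "X - Y \<in> coeffs_in (ideal_power ?m n)" for X Y :: "('b, 'v) mps" and n
    using that local_alg_hom_ideal_power[OF \<pi>(1)] unfolding coeffs_in_def
    by (auto simp flip: \<pi>.minus)
  have Im1: "ideal_power ?m (Suc 0) = ?m" using B.power_1 by simp
  have \<phi>'_max: "\<forall>i. \<phi>' i \<in> mps_max"
  proof
    fix i
    have "mps_coeff (\<phi>' i) 0 - 0 \<in> ideal_power ?m n" for n
      using \<phi>'[of i n] Ps[of n] by (simp add: coeffs_in_def mps_max_def) (metis diff_zero)
    then have "mps_coeff (\<phi>' i) 0 = 0" by (rule B.eq_if_cong)
    then show "\<phi>' i \<in> mps_max" by (simp add: mps_max_def)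
  qed
  show ?thesis
  proof (intro exI[of _ \<phi>'] exI[of _ b'] exI[of _ u'] conjI allI impI)
    fix i
    show "\<phi>' i \<in> mps_max" using \<phi>'_max by blast
    have "\<phi> 1 i - mps_var i \<in> coeffs_in ?m" using Ps[of 1] by simp
    then show "\<phi>' i - mps_var i \<in> coeffs_in ?m"
      using \<phi>'[of i 1] unfolding B.power_1 by (rule ideal_cong_trans[OF cmx, rotated])
    have "mps_map \<pi> (\<phi>' i) - \<phi>C i \<in> coeffs_in (ideal_power max_ideal n)" for n
      using \<pi>_mem[OF \<phi>'[of i n]] Ps[of n] by simp
    then show "mps_map \<pi> (\<phi>' i) = \<phi>C i" by (rule eqC)
  next
    fix j
    have "b 1 j \<in> ?m" using Ps[of 1] by simp
    then show "b' j \<in> ?m" using ideal_cong_mem[OF mx] b'[of j 1] unfolding B.power_1 by blast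
  next
    fix j assume "j < l"
    then have "\<pi> (b' j) - c j \<in> ideal_power max_ideal n" for n
      using local_alg_hom_ideal_power[OF \<pi>(1) b'[of j n]] Ps[of n] by (simp add: \<pi>.minus)
    then show "\<pi> (b' j) = c j" by (rule C.eq_if_cong)
  next
    have "u 1 - 1 \<in> coeffs_in ?m" using Ps[of 1] by simp
    then show "u' - 1 \<in> coeffs_in ?m"
      using u'[of 1] unfolding B.power_1 by (rule ideal_cong_trans[OF cmx, rotated])
    have "mps_map \<pi> u' - uC \<in> coeffs_in (ideal_power max_ideal n)" for n
      using \<pi>_mem[OF u'[of n]] Ps[of n] by simp
    then show "mps_map \<pi> u' = uC" by (rule eqC)
  next
    assume "G = Right_Equiv"
    then have "u' - 1 \<in> coeffs_in (ideal_power ?m n)" for n using u'[of n] Ps[of n] by simp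
    then show "u' = 1" by (rule eqB)
  next
    have "H - u' * mps_subst \<phi>' (linear_family \<iota>B f l g b') \<in> coeffs_in (ideal_power ?m n)" for n
    proof -
      have id: "is_ideal (coeffs_in (ideal_power ?m n) :: ('b, 'v) mps set)"
        by (intro is_ideal_coeffs_in is_ideal_ideal_power)
      have 1: "H - u n * mps_subst (\<phi> n) (linear_family \<iota>B f l g (b n)) \<in> coeffs_in (ideal_power ?m n)"
        using Ps[of n] coeffs_J(2)[of n] by blast
      have "u n * mps_subst (\<phi> n) (linear_family \<iota>B f l g (b n)) -
          u' * mps_subst \<phi>' (linear_family \<iota>B f l g b') \<in> coeffs_in (ideal_power ?m n)"
        using Ps[of n] \<phi>'_max
        by (intro family_action_cong is_ideal_ideal_power ideal_cong_sym[OF id \<phi>'] ideal_cong_sym[OF id u']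
            ideal_cong_sym[OF is_ideal_ideal_power b']) auto
      with 1 show ?thesis by (rule ideal_cong_trans[OF id])
    qed
    then show "H = u' * mps_subst \<phi>' (linear_family \<iota>B f l g b')" by (rule eqB)
  qed
qed

lemma formal_family_versal:
  fixes f :: "('k :: field, 'v :: finite) mps"
  assumes "tangent_solution G f l (\<lambda>i. mps_of_mpoly (g i)) d \<Xi> C U"
  shows "formally_versal TYPE('b :: comm_ring_1) TYPE('c :: comm_ring_1) G f
    mps_const (power_series_ring l) (formal_family (linear_unfolding f l g))"
proof -
  interpret tangent_solution G f l "\<lambda>i. mps_of_mpoly (g i)" d \<Xi> C U by fact
  let ?F = "formal_family (linear_unfolding f l g)" and ?A = "power_series_ring l :: ('k, nat) mps set"
  have A: "?A = supp_on {..<l}" by (rule power_series_ring_supp_on)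
  have "\<exists>hB \<Phi>B uB. local_alg_hom mps_const ?A \<iota>B hB \<and> (\<forall>a\<in>?A. \<pi> (hB a) = hC a) \<and>
      formal_equivalence G \<Phi>B uB (mps_map hB ?F) H \<and>
      (\<forall>X. mps_map \<pi> (\<Phi>B X) = \<Phi>C (mps_map \<pi> X)) \<and> mps_map \<pi> uB = uC"
    if hyps: "complete_local_algebra \<iota>B" "complete_local_algebra \<iota>C"
      "local_alg_hom \<iota>B UNIV \<iota>C \<pi>" "surj \<pi>" "deformation f \<iota>B UNIV H" "local_alg_hom mps_const ?A \<iota>C hC"
      "formal_equivalence G \<Phi>C uC (mps_map hC ?F) (mps_map \<pi> H)"
    for \<iota>B :: "'k \<Rightarrow> 'b" and \<iota>C :: "'k \<Rightarrow> 'c" and \<pi> H hC \<Phi>C uC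
  proof -
    interpret B: complete_local \<iota>B by (rule complete_local.intro) fact
    interpret C: complete_local \<iota>C by (rule complete_local.intro) fact
    interpret \<pi>: ring_morphism \<pi> using hyps(3) by (rule local_alg_hom_ring_morphism)
    let ?c = "\<lambda>j. hC (mps_var j)" and ?\<phi>C = "\<lambda>i. \<Phi>C (mps_var i)"
    have c: "\<forall>j<l. ?c j \<in> max_ideal" using hyps(6) mps_var_nonunit[where 'k = 'k] by (auto simp: local_alg_hom_def)
    have eqv: "\<Phi>C \<in> mps_auts" "\<Phi>C ` mps_max = mps_max" "mps_map \<pi> H = uC * \<Phi>C (mps_map hC ?F)"
      "\<forall>X m. mps_coeff (\<Phi>C X - X) m \<in> max_ideal" "\<forall>m. mps_coeff (uC - 1) m \<in> max_ideal"
      "G = Right_Equiv \<longrightarrow> uC = 1"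
      using hyps(7) unfolding formal_equivalence_def by - (elim conjE, assumption)+
    note \<Phi>C = auts_eq_subst[OF eqv(1,2)]
    have eq: "mps_map \<pi> H = uC * mps_subst ?\<phi>C (linear_family \<iota>C f l (\<lambda>i. mps_of_mpoly (g i)) ?c)"
      unfolding \<Phi>C(1)[symmetric] hom_formal_family[OF hyps(6) C.base.ring_morphism_axioms, symmetric]
      by (fact eqv(3))
    have "\<forall>i. ?\<phi>C i - mps_var i \<in> coeffs_in max_ideal" "uC - 1 \<in> coeffs_in max_ideal"
      "G = Right_Equiv \<longrightarrow> uC = 1"
      using eqv(4-6) by (simp_all add: coeffs_in_def del: mps_coeff_simps)
    from lift_equivalence[OF B.complete_local_axioms C.complete_local_axioms hyps(3-5) \<Phi>C(2) this c eq]
    obtain \<phi> b u where \<phi>: "\<forall>i. \<phi> i \<in> mps_max" "\<forall>i. \<phi> i - mps_var i \<in> coeffs_in max_ideal"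
      and b: "\<forall>j. b j \<in> max_ideal" and u: "u - 1 \<in> coeffs_in max_ideal" "G = Right_Equiv \<longrightarrow> u = 1"
      and \<pi>\<phi>: "\<forall>i. mps_map \<pi> (\<phi> i) = ?\<phi>C i" and \<pi>b: "\<forall>j<l. \<pi> (b j) = ?c j" and \<pi>u: "mps_map \<pi> u = uC"
      and H: "H = u * mps_subst \<phi> (linear_family \<iota>B f l (\<lambda>i. mps_of_mpoly (g i)) b)"
      by blast
    \<comment> \<open>The lifted homomorphism is evaluation at the parameters \<open>b\<close> found
      by the iteration.\<close>
    interpret EB: mps_evaluation "ideal_power max_ideal" \<iota>B "{..<l}" b
      by unfold_locales (use b B.power_1 in auto)
    interpret EC: mps_evaluation "ideal_power max_ideal" \<iota>C "{..<l}" ?c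
      by unfold_locales (use c C.power_1 in auto)
    interpret hB: ring_morphism EB.ev by (rule EB.eval_ring_morphism)
    have hB: "local_alg_hom mps_const ?A \<iota>B EB.ev"
      unfolding local_alg_hom_def
    proof (intro conjI ballI allI)
      fix a assume "a \<in> nonunits ?A"
      then have "mps_coeff a 0 = 0"
        unfolding A using nonunits_supp_on_iff[of a "{..<l}"] by (auto simp: nonunits_def)
      then show "EB.ev a \<in> max_ideal"
        using EB.eval_0_cong[of a] B.power_1 by (simp add: B.base.zero)
    qed (simp_all add: hB.hom_simps)
    \<comment> \<open>Both \<open>hC\<close> and \<open>\<pi>\<close> after the evaluation at
      \<open>b\<close> send each parameter to its value \<open>?c j\<close>; by
      \<open>hom_eq_eval\<close> both are the evaluation at \<open>?c\<close>.\<close>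
    have lift: "\<pi> (EB.ev a) = hC a" if "a \<in> ?A" for a
    proof -
      have "\<pi> (EB.ev a) = EC.ev a"
        using hyps(3) that A \<pi>b
        by (intro EC.hom_eq_eval) (auto simp: hB.hom_simps \<pi>.hom_simps local_alg_hom_def)
      moreover have "hC a = EC.ev a"
        using hyps(6) that A by (intro EC.hom_eq_eval) (auto simp: local_alg_hom_def)
      ultimately show ?thesis by simp
    qed
    have "linear_family \<iota>B f l (\<lambda>i. mps_of_mpoly (g i)) b =
        linear_family \<iota>B f l (\<lambda>i. mps_of_mpoly (g i)) (\<lambda>j. EB.ev (mps_var j))"
      by (simp add: linear_family_def)
    then have H': "H = u * mps_subst \<phi> (mps_map EB.ev ?F)"
      using H hom_formal_family[OF hB B.base.ring_morphism_axioms, of f g] by simp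
    have "formal_equivalence G (mps_subst \<phi>) u (mps_map EB.ev ?F) H"
      unfolding formal_equivalence_def
    proof (intro conjI allI)
      show "mps_subst \<phi> \<in> mps_auts" "mps_subst \<phi> ` mps_max = mps_max"
        by (rule subst_auts[OF \<phi>(1) B.near_identity_subst_bij[OF \<phi>]])+
      have "mps_subst \<phi> X - mps_subst mps_var X \<in> coeffs_in max_ideal" for X
        using \<phi> by (intro subst_cong is_ideal_coeffs_in ord_closed_coeffs_in B.ideal_max) auto
      then show "mps_coeff (mps_subst \<phi> X - X) m \<in> max_ideal" for X m
        by (simp add: subst_ident coeffs_in_def)
      show u1: "mps_coeff (u - 1) m \<in> max_ideal" for m using u(1) unfolding coeffs_in_def by blast
      have "mps_coeff u 0 - 1 \<in> max_ideal" using u1[of 0] by (simp add: mps_coeff_one)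
      then obtain y where "y * mps_coeff u 0 = 1" using B.unit_if_near_1 by blast
      then show "u dvd 1" by (rule mps_unit)
    qed (use u(2) H' in auto)
    moreover have "mps_map \<pi> (mps_subst \<phi> X) = \<Phi>C (mps_map \<pi> X)" for X
      by (subst \<Phi>C(1)) (simp add: mps_map_subst[OF \<pi>.ring_morphism_axioms \<phi>(1)] \<pi>\<phi>)
    ultimately show ?thesis using hB lift \<pi>u by blast
  qed
  moreover have "deformation f mps_const ?A ?F"
    using f_max g_max by (rule formal_family_deformation)
  ultimately show ?thesis unfolding formally_versal_def by blast
qed

section \<open>Dual numbers and semi-universality\<close>

abbreviation dual_const :: "'k :: comm_ring_1 \<Rightarrow> 'k dual_number" where
  "dual_const c \<equiv> Dual_Number c 0"

lemmas dual_defs = zero_dual_number_def one_dual_number_def plus_dual_number_def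
  minus_dual_number_def uminus_dual_number_def times_dual_number_def

lemma dual_eps_simps [simp]:
  "dual_eps (x + y) = dual_eps x + dual_eps y" "dual_eps (x - y) = dual_eps x - dual_eps y"
  "dual_eps 0 = (0 :: 'k :: comm_ring_1)" "dual_eps 1 = (0 :: 'k)"
  by (simp_all add: dual_defs)

lemma dual_re_simps [simp]:
  "dual_re (x + y) = dual_re x + dual_re y" "dual_re (x - y) = dual_re x - dual_re y"
  "dual_re (x * y) = dual_re x * dual_re y"
  "dual_re 0 = (0 :: 'k :: comm_ring_1)" "dual_re 1 = (1 :: 'k)"
  by (simp_all add: dual_defs)

lemma dual_eps_sum: "dual_eps (sum F A) = (\<Sum>x\<in>A. dual_eps (F x))"
  by (induction A rule: infinite_finite_induct) simp_all

lemma ring_morphism_dual_const: "ring_morphism dual_const"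
  by (simp add: ring_morphism_def dual_defs)

definition dual_max :: "'k :: comm_ring_1 dual_number set" where
  "dual_max = {x. dual_re x = 0}"

lemma is_ideal_dual_max: "is_ideal dual_max"
  by (rule is_idealI) (simp_all add: dual_max_def)

lemma dual_max_square: "a \<in> dual_max \<Longrightarrow> b \<in> dual_max \<Longrightarrow> a * b = 0"
  by (simp add: dual_max_def dual_defs)

lemma dual_max_eq: "(max_ideal :: 'k :: field dual_number set) = dual_max"
proof (intro set_eqI iffI)
  fix x :: "'k dual_number"
  show "x \<in> dual_max" if "x \<in> max_ideal"
  proof (rule ccontr)
    assume "x \<notin> dual_max"
    then have "x * Dual_Number (1 / dual_re x) (- dual_eps x / (dual_re x)^2) = 1"
      by (simp add: dual_max_def dual_defs power2_eq_square)
    with that show False by (auto simp: nonunits_def)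
  qed
  show "x \<in> max_ideal" if "x \<in> dual_max"
    using that by (auto simp: nonunits_def dual_max_def dual_defs)
qed

text \<open>The powers of the ideal generated by the element of square zero, complete for the
  trivial reason that they end in 0. This makes \<open>hom_eq_eval\<close> available, so that
  homomorphisms from the formal base ring to the dual numbers are determined by the
  parameters.\<close>

lemma complete_filtration_dual:
  "complete_filtration (\<lambda>n. if n = 0 then UNIV else if n = 1 then dual_max else {0 :: 'k :: comm_ring_1 dual_number})"
    (is "complete_filtration ?I")
proof
  show "\<exists>x'. \<forall>n. x' - x n \<in> ?I n" if x: "\<And>n. x (Suc n) - x n \<in> ?I n" for x :: "nat \<Rightarrow> 'k dual_number"
  proof -
    have "x (Suc (Suc n)) = x 2" for n
    proof (induction n)
      case (Suc n)
      then show ?case using x[of "Suc (Suc n)"] by simp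
    qed (simp add: numeral_2_eq_2)
    then have const: "x n = x 2" if "n \<ge> 2" for n
      using that by (metis add_2_eq_Suc le_add_diff_inverse)
    have "x 2 - x n \<in> ?I n" for n
    proof -
      consider "n = 0" | "n = 1" | "n \<ge> 2" by linarith
      then show ?thesis
      proof cases
        case 2
        then show ?thesis using x[of 1] by (simp add: numeral_2_eq_2)
      next
        case 3
        then show ?thesis using const[OF 3] by simp
      qed simp
    qed
    then show ?thesis by blast
  qed
  show "r = 0" if "\<And>n. r \<in> ?I n" for r using that[of 2] by simp
  show "a * b \<in> ?I (m + n)" if "a \<in> ?I m" "b \<in> ?I n" for a b :: "'k dual_number" and m n
    using that dual_max_square[of a b] is_idealD(3,4)[OF is_ideal_dual_max]
    by (auto split: if_splits)
qed (auto simp: is_ideal_UNIV is_ideal_dual_max is_ideal_zero is_idealD[OF is_ideal_dual_max])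

lemma mps_map_dual_eps_mult:
  "mps_map dual_eps (X * mps_map dual_const Y) = mps_map dual_eps X * (Y :: ('k :: comm_ring_1, 'v) mps)"
proof (rule mps_eqI)
  fix m
  have "dual_eps (x * dual_const y) = dual_eps x * y" for y :: 'k and x :: "'k dual_number"
    by (simp add: dual_defs)
  then show "mps_coeff (mps_map dual_eps (X * mps_map dual_const Y)) m = mps_coeff (mps_map dual_eps X * Y) m"
    by (simp add: mps_coeff_mult dual_eps_sum case_prod_unfold)
qed

lemma mps_map_dual_eps_const: "mps_map dual_eps (mps_map dual_const X) = (0 :: ('k :: comm_ring_1, 'v) mps)"
  by (rule mps_eqI) simp

lemma mps_map_dual_eps_add: "mps_map dual_eps (X + Y) = mps_map dual_eps X + (mps_map dual_eps Y :: ('k :: comm_ring_1, 'v) mps)"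
  by (rule mps_eqI) simp

lemma mps_map_dual_eps_sum: "mps_map dual_eps (sum F A) = (\<Sum>x\<in>A. mps_map dual_eps (F x) :: ('k :: comm_ring_1, 'v) mps)"
  by (rule mps_eqI) (simp add: dual_eps_sum)

text \<open>Products of two elements of \<open>dual_max\<close> vanish, so
  \<open>newton_step\<close> holds with error ideal 0 and turns into an equation: the derivative of
  the action at the identity, plus the variation of the family. It serves both semi-universality and
  the jacobian matrix in the proof of completeness.\<close>

lemma dual_action:
  fixes f :: "('k :: comm_ring_1, 'v :: finite) mps"
  assumes \<phi>: "\<forall>i. \<phi> i \<in> mps_max" "\<And>i. \<phi> i - mps_var i \<in> coeffs_in dual_max"
    and u: "u - 1 \<in> coeffs_in dual_max" and \<gamma>: "\<gamma> \<in> coeffs_in dual_max"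
  shows "mps_map dual_eps (u * mps_subst \<phi> (mps_map dual_const f + \<gamma>)) =
    (\<Sum>i\<in>UNIV. mps_map dual_eps (\<phi> i) * mps_pderiv i f) + mps_map dual_eps \<gamma> + mps_map dual_eps u * f"
proof -
  let ?f = "mps_map dual_const f"
  have "(1 + (u - 1)) * mps_subst (\<lambda>i. mps_var i + (\<phi> i - mps_var i)) (?f + \<gamma>) -
    (1 * mps_subst mps_var ?f + (\<Sum>i\<in>UNIV. (\<phi> i - mps_var i) * mps_pderiv i ?f) + \<gamma> + (u - 1) * ?f) \<in> coeffs_in {0}"
  proof (rule newton_step[where E = "coeffs_in dual_max" and M = "coeffs_in dual_max"])
    show "a * b \<in> coeffs_in {0}" if "a \<in> coeffs_in dual_max" "b \<in> coeffs_in dual_max"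
      for a b :: "('k dual_number, 'v) mps"
      using that dual_max_square by (auto simp: coeffs_in_def mps_coeff_mult intro!: sum.neutral)
    then show "a * b \<in> coeffs_in {0}" if "a \<in> coeffs_in dual_max" "b \<in> coeffs_in dual_max"
      for a b :: "('k dual_number, 'v) mps" using that by blast
    show "\<forall>i. \<phi> i - mps_var i \<in> mps_max"
      by (intro allI is_idealD(6)[OF is_ideal_mps_max] mps_var_max \<phi>(1)[rule_format])
    show "mps_const (mps_coeff \<gamma> k) \<in> coeffs_in dual_max" for k
      using \<gamma> by (intro coeffs_in_const is_ideal_dual_max) (auto simp: coeffs_in_def)
    have "mps_pderiv i \<gamma> \<in> coeffs_in dual_max" for i
      using \<gamma> unfolding coeffs_in_def by (auto simp: mps_coeff_pderiv intro: is_idealD(3)[OF is_ideal_dual_max])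
    then show "mps_pderiv i (?f + \<gamma>) - mps_pderiv i ?f \<in> coeffs_in dual_max" for i
      by (simp add: mps_pderiv_add)
  qed (use \<phi> u \<gamma> in \<open>auto simp: is_ideal_coeffs_in ord_closed_coeffs_in is_ideal_dual_max is_ideal_zero
      is_idealD(1)[OF is_ideal_coeffs_in[OF is_ideal_dual_max]]\<close>)
  then have "u * mps_subst \<phi> (?f + \<gamma>) =
      ?f + (\<Sum>i\<in>UNIV. (\<phi> i - mps_var i) * mps_pderiv i ?f) + \<gamma> + (u - 1) * ?f"
    by (intro mps_eqI) (simp add: coeffs_in_def subst_ident)
  moreover have "mps_map dual_eps (X - mps_var i) = mps_map dual_eps X"
    for X :: "('k dual_number, 'v) mps" and i
    by (rule mps_eqI) (simp add: mps_coeff_monom)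
  moreover have "mps_map dual_eps (u - 1) = mps_map dual_eps u"
    by (rule mps_eqI) (simp add: mps_coeff_one)
  ultimately show ?thesis
    by (simp add: mps_map_dual_eps_add mps_map_dual_eps_sum mps_map_dual_eps_mult mps_map_dual_eps_const
        flip: mps_map_pderiv[OF ring_morphism_dual_const])
qed

text \<open>Comparing the infinitesimal parts of two equivalent pullbacks puts the combination of
  the generators with the differences of the parameters into the tangent image. For a basis these
  differences vanish, and the parameters determine the homomorphism.\<close>

lemma formal_family_semi_universal:
  fixes f :: "('k :: field, 'v :: finite) mps"
  assumes sol: "tangent_solution G f l (\<lambda>i. mps_of_mpoly (g i)) d \<Xi> C U"
    and basis: "quot_basis mps_max (tangent_image G f) l (\<lambda>i. mps_of_mpoly (g i))"
  shows "semi_universal TYPE('b :: comm_ring_1) TYPE('c :: comm_ring_1) G f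
    mps_const (power_series_ring l) (formal_family (linear_unfolding f l g))"
proof -
  let ?F = "formal_family (linear_unfolding f l g)" and ?A = "power_series_ring l :: ('k, nat) mps set"
  let ?g = "\<lambda>i. mps_of_mpoly (g i) :: ('k, 'v) mps"
  have A: "?A = supp_on {..<l}" by (rule power_series_ring_supp_on)
  interpret dc: ring_morphism "dual_const :: 'k \<Rightarrow> _" by (rule ring_morphism_dual_const)
  have "h a = h' a" if h: "local_alg_hom mps_const ?A dual_const h" and h': "local_alg_hom mps_const ?A dual_const h'"
    and equiv: "formal_equivalence G \<Phi> u (mps_map h ?F) (mps_map h' ?F)" and a: "a \<in> ?A" for h h' \<Phi> u a
  proof -
    have var_max: "k (mps_var j) \<in> dual_max" if "j < l" "local_alg_hom mps_const ?A dual_const k" for j k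
      using that mps_var_nonunit[where 'k = 'k] by (auto simp: local_alg_hom_def dual_max_eq)
    have eqv: "\<Phi> \<in> mps_auts" "\<Phi> ` mps_max = mps_max" "mps_map h' ?F = u * \<Phi> (mps_map h ?F)"
      "\<forall>X m. mps_coeff (\<Phi> X - X) m \<in> max_ideal" "\<forall>m. mps_coeff (u - 1) m \<in> max_ideal"
      "G = Right_Equiv \<longrightarrow> u = 1"
      using equiv unfolding formal_equivalence_def by - (elim conjE, assumption)+
    note \<Phi> = auts_eq_subst[OF eqv(1,2)]
    let ?\<phi> = "\<lambda>i. \<Phi> (mps_var i)"
    let ?\<gamma> = "\<lambda>h. \<Sum>j<l. mps_const (h (mps_var j)) * mps_map dual_const (?g j)"
    have \<gamma>: "?\<gamma> h \<in> coeffs_in dual_max"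
      using var_max h by (auto simp: coeffs_in_def intro!: is_idealD(4,7)[OF is_ideal_dual_max])
    have \<gamma>_eps: "mps_map dual_eps (?\<gamma> h) = (\<Sum>j<l. mps_const (dual_eps (h (mps_var j))) * ?g j)" for h
      unfolding mps_map_dual_eps_sum mps_map_dual_eps_mult
      by (intro sum.cong arg_cong2[of _ _ _ _ "(*)"] mps_eqI) (auto simp: mps_coeff_const)
    have "mps_map h' ?F = u * mps_subst ?\<phi> (mps_map h ?F)"
      unfolding \<Phi>(1)[symmetric] by (fact eqv(3))
    then have "mps_map dual_const f + ?\<gamma> h' = u * mps_subst ?\<phi> (mps_map dual_const f + ?\<gamma> h)"
      by (simp add: hom_formal_family[OF h dc.ring_morphism_axioms]
          hom_formal_family[OF h' dc.ring_morphism_axioms] linear_family_def)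
    moreover have "mps_map dual_eps (u * mps_subst ?\<phi> (mps_map dual_const f + ?\<gamma> h)) =
      (\<Sum>i\<in>UNIV. mps_map dual_eps (?\<phi> i) * mps_pderiv i f) + mps_map dual_eps (?\<gamma> h) + mps_map dual_eps u * f"
      using \<Phi>(2) \<gamma> eqv(4,5) by (intro dual_action) (simp_all add: coeffs_in_def dual_max_eq del: mps_coeff_simps)
    ultimately have "mps_map dual_eps (mps_map dual_const f + ?\<gamma> h') =
      (\<Sum>i\<in>UNIV. mps_map dual_eps (?\<phi> i) * mps_pderiv i f) + mps_map dual_eps (?\<gamma> h) + mps_map dual_eps u * f"
      by simp
    then have "(\<Sum>j<l. mps_const (dual_eps (h' (mps_var j)) - dual_eps (h (mps_var j))) * ?g j) =
      (\<Sum>i\<in>UNIV. mps_map dual_eps (?\<phi> i) * mps_pderiv i f) + mps_map dual_eps u * f"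
      by (simp add: mps_map_dual_eps_add mps_map_dual_eps_const \<gamma>_eps algebra_simps sum_subtractf
          ring_morphism.minus[OF ring_morphism_const])
    moreover have "\<forall>i. mps_map dual_eps (?\<phi> i) \<in> mps_max"
      using \<Phi>(2) by (simp add: mps_max_def)
    moreover have "mps_map dual_eps u = 0" if "G = Right_Equiv"
      using eqv(6) that by (intro mps_eqI) (simp add: mps_coeff_one)
    ultimately have "(\<Sum>j<l. mps_const (dual_eps (h' (mps_var j)) - dual_eps (h (mps_var j))) * ?g j)
        \<in> tangent_image G f"
      unfolding mem_tangent_image_iff
      by (intro exI[of _ "\<lambda>i. mps_map dual_eps (?\<phi> i)"] exI[of _ "mps_map dual_eps u"] conjI impI)
    then have "\<forall>j<l. dual_eps (h' (mps_var j)) - dual_eps (h (mps_var j)) = 0"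
      using basis unfolding quot_basis_def
      by (elim conjE allE[of _ "\<lambda>j. dual_eps (h' (mps_var j)) - dual_eps (h (mps_var j))"]) blast
    then have same: "h' (mps_var j) = h (mps_var j)" if "j < l" for j
      using that var_max[OF that h] var_max[OF that h'] by (auto simp: dual_max_def dual_number.expand)
    interpret E: mps_evaluation "\<lambda>n. if n = 0 then UNIV else if n = 1 then dual_max else {0 :: 'k dual_number}"
      dual_const "{..<l}" "\<lambda>j. h (mps_var j)"
      by (intro mps_evaluation.intro complete_filtration_dual ring_morphism_dual_const mps_evaluation_axioms.intro)
        (use var_max h in auto)
    have "h a = E.ev a"
      using h a A by (intro E.hom_eq_eval) (auto simp: local_alg_hom_def)
    moreover have "h' a = E.ev a"
      using h' a A same by (intro E.hom_eq_eval) (auto simp: local_alg_hom_def)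
    ultimately show ?thesis by simp
  qed
  then show ?thesis
    unfolding semi_universal_def using formal_family_versal[OF sol] by blast
qed

section \<open>Finite determinacy\<close>

lemma leading_form_cong:
  fixes e :: "('a :: comm_ring_1, 'v :: finite) mps"
  assumes "e \<in> ord_ge N"
  shows "e - (\<Sum>\<alpha> | mdeg \<alpha> = N. mps_const (mps_coeff e \<alpha>) * mps_monom \<alpha>) \<in> ord_ge (Suc N)"
proof -
  have "mps_coeff e m = (\<Sum>\<alpha> | mdeg \<alpha> = N. mps_coeff e \<alpha> * mps_coeff (mps_monom \<alpha>) m)" if "mdeg m < Suc N" for m
  proof -
    have "(\<Sum>\<alpha> | mdeg \<alpha> = N. mps_coeff e \<alpha> * mps_coeff (mps_monom \<alpha>) m) =
        (\<Sum>\<alpha> | mdeg \<alpha> = N. if \<alpha> = m then mps_coeff e m else 0)"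
      by (rule sum.cong) (auto simp: mps_coeff_monom)
    also have "\<dots> = mps_coeff e m"
      using assms that by (auto simp: finite_monoms_UNIV ord_ge_def)
    finally show ?thesis by simp
  qed
  then show ?thesis by (simp add: ord_ge_def)
qed

text \<open>Monomials of degree \<open>d\<close> are tangent only up to higher order. This is a
  condition on a jet of \<open>f\<close>, and it is all an iteration needs that removes one leading
  form at a time.\<close>

definition tangent_deg :: "equiv_kind \<Rightarrow> ('k :: field, 'v :: finite) mps \<Rightarrow> nat \<Rightarrow> bool" where
  "tangent_deg G f d \<longleftrightarrow> (\<forall>\<alpha>. mdeg \<alpha> = d \<longrightarrow> (\<exists>\<xi> v. (\<forall>i. \<xi> i \<in> mps_max) \<and> (G = Right_Equiv \<longrightarrow> v = 0) \<and>
    mps_monom \<alpha> - ((\<Sum>i\<in>UNIV. \<xi> i * mps_pderiv i f) + v * f) \<in> ord_ge (Suc d)))"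

text \<open>Each monomial of the leading form of \<open>e\<close> is a multiple of one of degree
  \<open>d\<close>. Multiplying by the cofactor, of degree \<open>N - d\<close>, raises the order of
  the solution and of its error alike.\<close>

lemma tangent_deg_solve:
  fixes f :: "('k :: field, 'v :: finite) mps"
  assumes T: "tangent_deg G f d" and e: "e \<in> ord_ge N" and N: "d \<le> N"
  shows "\<exists>\<xi> v. (\<forall>i. \<xi> i \<in> mps_max) \<and> (\<forall>i. \<xi> i \<in> ord_ge (N - d)) \<and> v \<in> ord_ge (N - d) \<and>
    (G = Right_Equiv \<longrightarrow> v = 0) \<and> e - ((\<Sum>i\<in>UNIV. \<xi> i * mps_pderiv i f) + v * f) \<in> ord_ge (Suc N)"
proof -
  note mx = is_idealD[OF is_ideal_mps_max] and og = is_idealD[OF is_ideal_ord_ge]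
  let ?Q = "\<lambda>\<alpha> \<xi> v. (\<forall>i. \<xi> i \<in> mps_max) \<and> (\<forall>i. \<xi> i \<in> ord_ge (N - d)) \<and> v \<in> ord_ge (N - d) \<and>
    (G = Right_Equiv \<longrightarrow> v = 0) \<and> mps_monom \<alpha> - ((\<Sum>i\<in>UNIV. \<xi> i * mps_pderiv i f) + v * f) \<in> ord_ge (Suc N)"
  have ex: "\<exists>\<xi> v. ?Q \<alpha> \<xi> v" if "mdeg \<alpha> = N" for \<alpha>
  proof -
    have "d \<le> mdeg \<alpha>" using N that by simp
    then obtain a b where ab: "\<alpha> = a + b" "mdeg b = d" using monom_split_deg by blast
    then have a: "mdeg a = N - d" using that by (simp add: mdeg_add)
    obtain \<xi> v where \<xi>: "\<forall>i. \<xi> i \<in> mps_max" "G = Right_Equiv \<longrightarrow> v = 0"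
      "mps_monom b - ((\<Sum>i\<in>UNIV. \<xi> i * mps_pderiv i f) + v * f) \<in> ord_ge (Suc d)"
      using T ab(2) unfolding tangent_deg_def by blast
    have "mps_monom a * (mps_monom b - ((\<Sum>i\<in>UNIV. \<xi> i * mps_pderiv i f) + v * f)) \<in> ord_ge (N - d + Suc d)"
      by (intro ord_ge_mult mps_monom_ord_ge \<xi>) (simp add: a)
    then have "mps_monom \<alpha> - ((\<Sum>i\<in>UNIV. (mps_monom a * \<xi> i) * mps_pderiv i f) + (mps_monom a * v) * f) \<in> ord_ge (Suc N)"
      using N by (simp add: ab(1) mps_monom_add algebra_simps sum_distrib_left)
    then show ?thesis using \<xi> mx(3) og(4)[OF mps_monom_ord_ge[of "N - d" a]] a
      by (intro exI[of _ "\<lambda>i. mps_monom a * \<xi> i"] exI[of _ "mps_monom a * v"]) auto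
  qed
  have "\<forall>\<alpha>. \<exists>\<xi> v. mdeg \<alpha> = N \<longrightarrow> ?Q \<alpha> \<xi> v" using ex by blast
  then have "\<exists>\<xi> v. \<forall>\<alpha>. mdeg \<alpha> = N \<longrightarrow> ?Q \<alpha> (\<xi> \<alpha>) (v \<alpha>)" by (simp only: choice_iff)
  then obtain \<xi> v where Q: "\<forall>\<alpha>. mdeg \<alpha> = N \<longrightarrow> ?Q \<alpha> (\<xi> \<alpha>) (v \<alpha>)" by blast
  have \<xi>: "\<xi> \<alpha> i \<in> mps_max" "\<xi> \<alpha> i \<in> ord_ge (N - d)" if "mdeg \<alpha> = N" for \<alpha> i
    using Q that by blast+
  have v: "v \<alpha> \<in> ord_ge (N - d)" "G = Right_Equiv \<longrightarrow> v \<alpha> = 0" if "mdeg \<alpha> = N" for \<alpha>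
    using Q that by blast+
  have err: "mps_monom \<alpha> - ((\<Sum>i\<in>UNIV. \<xi> \<alpha> i * mps_pderiv i f) + v \<alpha> * f) \<in> ord_ge (Suc N)"
    if "mdeg \<alpha> = N" for \<alpha>
    using Q that by blast
  let ?S = "{\<alpha> :: 'v \<Rightarrow>\<^sub>0 nat. mdeg \<alpha> = N}" and ?c = "\<lambda>\<alpha>. mps_const (mps_coeff e \<alpha>)"
  define \<xi>' where "\<xi>' i = (\<Sum>\<alpha>\<in>?S. ?c \<alpha> * \<xi> \<alpha> i)" for i
  define v' where "v' = (\<Sum>\<alpha>\<in>?S. ?c \<alpha> * v \<alpha>)"
  have "(\<Sum>\<alpha>\<in>?S. ?c \<alpha> * mps_monom \<alpha>) - (\<Sum>\<alpha>\<in>?S. ?c \<alpha> * ((\<Sum>i\<in>UNIV. \<xi> \<alpha> i * mps_pderiv i f) + v \<alpha> * f)) \<in> ord_ge (Suc N)"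
    by (intro ideal_cong_sum ideal_cong_mult is_ideal_ord_ge err) (simp_all add: og)
  moreover have "(\<Sum>\<alpha>\<in>?S. ?c \<alpha> * ((\<Sum>i\<in>UNIV. \<xi> \<alpha> i * mps_pderiv i f) + v \<alpha> * f)) =
      (\<Sum>i\<in>UNIV. \<xi>' i * mps_pderiv i f) + v' * f"
    unfolding \<xi>'_def v'_def distrib_left sum.distrib sum_distrib_left sum_distrib_right
    by (subst sum.swap) (simp add: mult.assoc)
  ultimately have "(\<Sum>\<alpha>\<in>?S. ?c \<alpha> * mps_monom \<alpha>) - ((\<Sum>i\<in>UNIV. \<xi>' i * mps_pderiv i f) + v' * f) \<in> ord_ge (Suc N)"
    by simp
  with leading_form_cong[OF e] have
    "e - ((\<Sum>i\<in>UNIV. \<xi>' i * mps_pderiv i f) + v' * f) \<in> ord_ge (Suc N)"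
    by (rule ideal_cong_trans[OF is_ideal_ord_ge])
  moreover have "\<xi>' i \<in> mps_max" "\<xi>' i \<in> ord_ge (N - d)" for i
    unfolding \<xi>'_def using \<xi> by (auto intro!: mx(3,7) og(3,7))
  moreover have "v' \<in> ord_ge (N - d)" "G = Right_Equiv \<longrightarrow> v' = 0"
    unfolding v'_def using v by (auto intro!: og(3,7))
  ultimately show ?thesis by blast
qed

text \<open>An error of order \<open>2 * d + 1 + n\<close> calls for corrections of order
  \<open>d + 1 + n\<close>. Against a deviation of order \<open>d + 1\<close> from the identity the
  next error has order \<open>2 * d + 2 + n\<close>; this is the origin of the bound
  \<open>2 * d + 1\<close>. Since \<open>d + 1\<close> is at least 2, the limit substitution is
  unipotent and hence bijective.\<close>

theorem finite_determinacy:
  fixes f h :: "('k :: field, 'v :: finite) mps"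
  assumes d: "1 \<le> d" and T: "tangent_deg G f d" and close: "h - f \<in> ord_ge (2 * d + 1)"
  shows "G_equivalent G f h"
proof -
  interpret complete_filtration "ord_ge :: nat \<Rightarrow> ('k, 'v) mps set" by (rule complete_filtration_ord_ge)
  define P where "P = (\<lambda>n (\<phi>, u). (\<forall>i. \<phi> i \<in> mps_max) \<and> (\<forall>i. \<phi> i - mps_var i \<in> ord_ge (d + 1)) \<and>
    u - 1 \<in> ord_ge (d + 1) \<and> (G = Right_Equiv \<longrightarrow> u = 1) \<and> h - u * mps_subst \<phi> f \<in> ord_ge (2 * d + 1 + n))"
  define R where "R = (\<lambda>n (\<phi>, u) (\<phi>', u'). (\<forall>i :: 'v. \<phi>' i - \<phi> i \<in> (ord_ge n :: ('k, 'v) mps set)) \<and>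
    u' - u \<in> (ord_ge n :: ('k, 'v) mps set) \<and> (G = Right_Equiv \<longrightarrow> u' = u))"
  have start: "\<exists>s. P 0 s"
    using close by (intro exI[of _ "(mps_var, 1)"]) (simp add: P_def subst_ident idealD)
  have step: "\<exists>s'. P (Suc n) s' \<and> R n s s'" if "P n s" for n s
  proof -
    obtain \<phi> u where s: "s = (\<phi>, u)" by (metis prod.exhaust)
    from that have \<phi>: "\<forall>i. \<phi> i \<in> mps_max" "\<forall>i. \<phi> i - mps_var i \<in> ord_ge (d + 1)"
      and u: "u - 1 \<in> ord_ge (d + 1)" "G = Right_Equiv \<longrightarrow> u = 1"
      and err: "h - u * mps_subst \<phi> f \<in> ord_ge (2 * d + 1 + n)"
      unfolding s P_def by simp_all
    have deg: "2 * d + 1 + n - d = d + 1 + n" "d \<le> 2 * d + 1 + n"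
      "d + 1 + n + (d + 1) = 2 * d + 1 + Suc n" by simp_all
    obtain \<xi> v where \<xi>: "\<forall>i. \<xi> i \<in> mps_max" "\<forall>i. \<xi> i \<in> ord_ge (d + 1 + n)" and v: "v \<in> ord_ge (d + 1 + n)"
      "G = Right_Equiv \<longrightarrow> v = 0" and e: "h - u * mps_subst \<phi> f -
        ((\<Sum>i\<in>UNIV. \<xi> i * mps_pderiv i f) + v * f) \<in> ord_ge (Suc (2 * d + 1 + n))"
      using tangent_deg_solve[OF T err deg(2)] unfolding deg(1) by blast
    let ?E = "ord_ge (d + 1 + n) :: ('k, 'v) mps set" and ?M = "ord_ge (d + 1) :: ('k, 'v) mps set"
    have EM: "?E \<subseteq> ?M" "?E \<subseteq> ord_ge n" by (rule antimono; simp)+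
    have "(u + v) * mps_subst (\<lambda>i. \<phi> i + \<xi> i) (f + 0) -
      (u * mps_subst \<phi> f + (\<Sum>i\<in>UNIV. \<xi> i * mps_pderiv i f) + 0 + v * f) \<in> ord_ge (2 * d + 1 + Suc n)"
    proof (rule newton_step[where E = ?E and M = ?M])
      show "a * b \<in> ord_ge (2 * d + 1 + Suc n)" if "a \<in> ?E" "b \<in> ?M" for a b
        using ord_ge_mult[OF that] unfolding deg(3) .
      then show "a * b \<in> ord_ge (2 * d + 1 + Suc n)" if "a \<in> ?E" "b \<in> ?E" for a b
        using that EM(1) by blast
    qed (use \<phi> \<xi> u v in \<open>auto simp: ideal ord_closed_ord_ge idealD\<close>)
    with e have err': "h - (u + v) * mps_subst (\<lambda>i. \<phi> i + \<xi> i) f \<in> ord_ge (2 * d + 1 + Suc n)"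
      using idealD(6)[of "h - u * mps_subst \<phi> f - ((\<Sum>i\<in>UNIV. \<xi> i * mps_pderiv i f) + v * f)"
        "2 * d + 1 + Suc n"] by (fastforce simp: algebra_simps)
    let ?s = "(\<lambda>i. \<phi> i + \<xi> i, u + v)"
    have "\<phi> i - mps_var i + \<xi> i \<in> ?M" for i using \<phi>(2) \<xi>(2) EM(1) by (intro idealD(2)) auto
    moreover have "u - 1 + v \<in> ?M" using u(1) v(1) EM(1) by (intro idealD(2)) auto
    ultimately have "P (Suc n) ?s"
      unfolding P_def case_prod_conv using \<phi>(1) \<xi>(1) u(2) v(2) err'
      by (auto simp: algebra_simps intro: is_idealD(2)[OF is_ideal_mps_max])
    moreover have "R n s ?s" unfolding R_def s using \<xi> v EM(2) by auto
    ultimately show ?thesis by blast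
  qed
  obtain s where s: "\<And>n. P n (s n)" "\<And>n. R n (s n) (s (Suc n))"
    using dependent_nat_choice[of P R, OF start step] by blast
  define \<phi> where "\<phi> n = fst (s n)" for n
  define u where "u n = snd (s n)" for n
  have s_eq: "s n = (\<phi> n, u n)" for n by (simp add: \<phi>_def u_def)
  note Ps = s(1)[unfolded s_eq P_def case_prod_conv] and Rs = s(2)[unfolded s_eq R_def case_prod_conv]
  have "\<exists>x. \<forall>n. x - \<phi> n i \<in> ord_ge n" for i
    using Rs by (intro complete) blast
  then obtain \<phi>' where \<phi>': "\<And>i n. \<phi>' i - \<phi> n i \<in> ord_ge n" by metis
  have "\<exists>x. \<forall>n. x - u n \<in> ord_ge n"
    using Rs by (intro complete) blast
  then obtain u' where u': "\<And>n. u' - u n \<in> ord_ge n" by metis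
  have \<phi>'_near: "\<forall>i. \<phi>' i - mps_var i \<in> ord_ge (d + 1)"
    using ideal_cong_trans[OF ideal \<phi>'] Ps by blast
  then have \<phi>'_2: "\<forall>i. \<phi>' i - mps_var i \<in> ord_ge 2" using d antimono[of 2 "d + 1"] by auto
  have \<phi>'_max: "\<forall>i. \<phi>' i \<in> mps_max"
    by (intro allI ideal_cong_mem[OF is_ideal_mps_max ord_ge_2_subset_max[OF \<phi>'_2[rule_format]] mps_var_max])
  have "u' - 1 \<in> ord_ge (d + 1)" using ideal_cong_trans[OF ideal u'] Ps by blast
  then have "mps_coeff u' 0 = 1" by (simp add: ord_ge_def mps_coeff_one)
  then have "u' dvd 1" by (intro mps_unit[of 1]) simp
  moreover have "u' = 1" if "G = Right_Equiv"
  proof (rule eq_if_cong)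
    show "u' - 1 \<in> ord_ge n" for n using u'[of n] Ps[of n] that by simp
  qed
  moreover have "h = u' * mps_subst \<phi>' f"
  proof (rule eq_if_cong)
    fix n
    have 1: "h - u n * mps_subst (\<phi> n) f \<in> ord_ge n"
      using Ps[of n] antimono[of n "2 * d + 1 + n"] by auto
    have "mps_subst (\<phi> n) f - mps_subst \<phi>' f \<in> ord_ge n"
      using Ps[of n] \<phi>'_max by (intro subst_cong ideal ord_closed_ord_ge ideal_cong_sym[OF ideal \<phi>']) auto
    then have "u n * mps_subst (\<phi> n) f - u' * mps_subst \<phi>' f \<in> ord_ge n"
      by (intro ideal_cong_mult ideal ideal_cong_sym[OF ideal u'])
    with 1 show "h - u' * mps_subst \<phi>' f \<in> ord_ge n" by (rule ideal_cong_trans[OF ideal])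
  qed
  ultimately show ?thesis
    unfolding G_equivalent_def
    using subst_auts(1)[OF \<phi>'_max unipotent_subst_bij[OF \<phi>'_2]] by blast
qed

section \<open>Polynomials and standard etale neighbourhoods\<close>

lemma mpoly_eval_mpow: "mpoly_eval \<iota> a p = (\<Sum>m\<in>Poly_Mapping.keys p. \<iota> (Poly_Mapping.lookup p m) * mpow a m)"
  by (simp add: mpoly_eval_def mpow_def)

lemma mpoly_eval_superset:
  assumes "\<iota> 0 = 0" "finite A" "Poly_Mapping.keys p \<subseteq> A"
  shows "mpoly_eval \<iota> a p = (\<Sum>m\<in>A. \<iota> (Poly_Mapping.lookup p m) * mpow a m)"
  unfolding mpoly_eval_mpow using assms by (intro sum.mono_neutral_left) (auto simp: in_keys_iff)

lemma mpoly_sum_single: "p = (\<Sum>m\<in>Poly_Mapping.keys p. Poly_Mapping.single m (Poly_Mapping.lookup p m))"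
proof (rule poly_mapping_eqI)
  fix k
  have "(\<Sum>m\<in>Poly_Mapping.keys p. Poly_Mapping.lookup (Poly_Mapping.single m (Poly_Mapping.lookup p m)) k) =
      (\<Sum>m\<in>Poly_Mapping.keys p. if m = k then Poly_Mapping.lookup p k else 0)"
    by (intro sum.cong) (auto simp: lookup_single)
  then show "Poly_Mapping.lookup p k =
      Poly_Mapping.lookup (\<Sum>m\<in>Poly_Mapping.keys p. Poly_Mapping.single m (Poly_Mapping.lookup p m)) k"
    by (simp add: lookup_sum in_keys_iff)
qed

context ring_morphism
begin

lemma mpoly_eval_single: "mpoly_eval h a (Poly_Mapping.single m c) = h c * mpow a m"
  by (subst mpoly_eval_superset[of h "{m}"]) (auto simp: zero)

lemma mpoly_eval_const: "mpoly_eval h a (mpoly_const c) = h c"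
  by (simp add: mpoly_const_def mpoly_eval_single)

lemma mpoly_eval_var: "mpoly_eval h a (mpoly_var i) = a i"
  by (simp add: mpoly_var_def mpoly_eval_single one)

lemma mpoly_eval_add: "mpoly_eval h a (p + q) = mpoly_eval h a p + mpoly_eval h a q"
proof -
  let ?A = "Poly_Mapping.keys p \<union> Poly_Mapping.keys q"
  have "mpoly_eval h a (p + q) = (\<Sum>m\<in>?A. h (Poly_Mapping.lookup (p + q) m) * mpow a m)"
    by (rule mpoly_eval_superset[of h, OF zero]) (auto dest: subsetD[OF keys_add])
  also have "\<dots> = (\<Sum>m\<in>?A. h (Poly_Mapping.lookup p m) * mpow a m) + (\<Sum>m\<in>?A. h (Poly_Mapping.lookup q m) * mpow a m)"
    by (simp add: lookup_add add distrib_right sum.distrib)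
  also have "\<dots> = mpoly_eval h a p + mpoly_eval h a q"
    by (simp add: mpoly_eval_superset[of h ?A, OF zero])
  finally show ?thesis .
qed

lemma mpoly_eval_0: "mpoly_eval h a 0 = 0"
  by (simp add: mpoly_eval_def)

lemma mpoly_eval_sum: "mpoly_eval h a (sum p A) = (\<Sum>x\<in>A. mpoly_eval h a (p x))"
  by (induction A rule: infinite_finite_induct) (simp_all add: mpoly_eval_0 mpoly_eval_add)

lemma mpoly_eval_mult: "mpoly_eval h a (p * q) = mpoly_eval h a p * mpoly_eval h a q"
proof -
  have "p * q = (\<Sum>m\<in>Poly_Mapping.keys p. \<Sum>n\<in>Poly_Mapping.keys q.
      Poly_Mapping.single (m + n) (Poly_Mapping.lookup p m * Poly_Mapping.lookup q n))"
    by (subst mpoly_sum_single[of p], subst mpoly_sum_single[of q]) (simp add: sum_product mult_single)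
  then show ?thesis
    by (simp add: mpoly_eval_sum mpoly_eval_single mpow_add mult)
      (simp add: mpoly_eval_mpow sum_product ac_simps)
qed

lemma mpoly_eval_morphism: "ring_morphism (mpoly_eval h a)"
  using mpoly_eval_const[of a 1]
  by unfold_locales (simp_all add: mpoly_eval_add mpoly_eval_mult one mpoly_const_def)

end

lemma ring_morphism_mpoly_const: "ring_morphism mpoly_const"
  by unfold_locales (simp_all add: mpoly_const_def mult_single single_add)

lemmas ring_morphism_mpoly_at = ring_morphism.mpoly_eval_morphism[OF ring_morphism_id]
lemmas ring_morphism_mpoly_subst = ring_morphism.mpoly_eval_morphism[OF ring_morphism_mpoly_const]
lemmas mpoly_subst_var = ring_morphism.mpoly_eval_var[OF ring_morphism_mpoly_const]
lemmas mpoly_at_var = ring_morphism.mpoly_eval_var[OF ring_morphism_id]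

lemma mpoly_eval_hom:
  "ring_morphism h \<Longrightarrow> h (mpoly_eval \<iota> a p) = mpoly_eval (\<lambda>c. h (\<iota> c)) (\<lambda>i. h (a i)) p"
  by (simp add: mpoly_eval_mpow ring_morphism.sum ring_morphism.mult ring_morphism.mpow)

lemma mpoly_subst_ident: "mpoly_subst mpoly_var p = p"
proof -
  have "mpow mpoly_var m = (Poly_Mapping.single m 1 :: 'a mpoly)" for m
    by (induction m rule: monom_induct) (simp_all add: mpow_add mpoly_var_def mult_single)
  then show ?thesis
    by (subst (3) mpoly_sum_single) (simp add: mpoly_eval_mpow mpoly_const_def mult_single)
qed

lemma mpolys_subring: "is_subring (mpolys N :: 'k :: comm_ring_1 mpoly set)"
  unfolding is_subring_def
proof (intro conjI ballI)
  fix p q :: "'k mpoly" assume p: "p \<in> mpolys N" and q: "q \<in> mpolys N"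
  show "p + q \<in> mpolys N" using p q keys_add[of p q] by (auto simp: mpolys_def)
  show "- p \<in> mpolys N" using p by (auto simp: mpolys_def in_keys_iff)
  have "Poly_Mapping.keys m \<subseteq> {..<N}" if "m \<in> Poly_Mapping.keys (p * q)" for m
  proof -
    obtain a b where "m = a + b" "a \<in> Poly_Mapping.keys p" "b \<in> Poly_Mapping.keys q"
      using keys_mult[of p q] \<open>m \<in> Poly_Mapping.keys (p * q)\<close> by blast
    then show ?thesis using p q by (auto simp: mpolys_def keys_add_nat)
  qed
  then show "p * q \<in> mpolys N" by (simp add: mpolys_def)
qed (simp add: mpolys_def)

lemmas mpolysD = is_subringD[OF mpolys_subring]

lemma mpoly_const_mem: "mpoly_const c \<in> mpolys N"
  by (simp add: mpolys_def mpoly_const_def)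

lemma mpoly_var_mem: "i < N \<Longrightarrow> mpoly_var i \<in> mpolys N"
  by (simp add: mpolys_def mpoly_var_def)

lemma mpolys_mono: "M \<le> N \<Longrightarrow> mpolys M \<subseteq> mpolys N"
  by (force simp: mpolys_def)

lemma mpoly_eval_cong_ideal:
  assumes "is_ideal Q" "p \<in> mpolys N" "\<And>i. i < N \<Longrightarrow> a i - b i \<in> Q"
  shows "mpoly_eval \<iota> a p - mpoly_eval \<iota> b p \<in> Q"
  unfolding mpoly_eval_mpow using assms(2,3)
  by (intro ideal_cong_sum ideal_cong_mult ideal_cong_mpow assms(1))
    (auto simp: mpolys_def is_idealD[OF assms(1)])

lemma mpoly_eval_cong:
  assumes "p \<in> mpolys N" "\<And>i. i < N \<Longrightarrow> a i = b i"
  shows "mpoly_eval \<iota> a p = mpoly_eval \<iota> b p"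
  using mpoly_eval_cong_ideal[OF is_ideal_zero assms(1), of a b \<iota>] assms(2) by simp

lemma mpoly_subst_mem:
  assumes "p \<in> mpolys N" "\<And>i. i < N \<Longrightarrow> a i \<in> mpolys M"
  shows "mpoly_subst a p \<in> mpolys M"
  unfolding mpoly_eval_mpow mpow_def
  by (intro mpolysD(4,7,8,9) mpoly_const_mem assms(2)) (use assms(1) in \<open>auto simp: mpolys_def\<close>)

text \<open>Where the subtraction of exponents truncates, the factor in front is 0.\<close>

definition mpoly_pderiv :: "nat \<Rightarrow> 'k :: comm_ring_1 mpoly \<Rightarrow> 'k mpoly" where
  "mpoly_pderiv i p = (\<Sum>m\<in>Poly_Mapping.keys p. Poly_Mapping.single (m - Poly_Mapping.single i (Suc 0))
     (of_nat (Poly_Mapping.lookup m i) * Poly_Mapping.lookup p m))"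

lemma mpoly_pderiv_mem:
  assumes "p \<in> mpolys N"
  shows "mpoly_pderiv i p \<in> mpolys N"
  unfolding mpoly_pderiv_def
proof (rule mpolysD(7))
  fix m assume "m \<in> Poly_Mapping.keys p"
  then have "Poly_Mapping.keys m \<subseteq> {..<N}" using assms by (simp add: mpolys_def)
  moreover have "Poly_Mapping.keys (m - Poly_Mapping.single i (Suc 0)) \<subseteq> Poly_Mapping.keys m"
    by (auto simp: in_keys_iff lookup_minus)
  ultimately show "Poly_Mapping.single (m - Poly_Mapping.single i (Suc 0))
      (of_nat (Poly_Mapping.lookup m i) * Poly_Mapping.lookup p m) \<in> mpolys N"
    by (auto simp: mpolys_def)
qed

lemma mpoly_taylor:
  assumes \<iota>: "ring_morphism \<iota>" and Q: "is_ideal Q" and \<eta>: "\<And>i j. \<eta> i * \<eta> j \<in> Q" and p: "p \<in> mpolys N"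
  shows "mpoly_eval \<iota> (\<lambda>i. y i + \<eta> i) p -
    (mpoly_eval \<iota> y p + (\<Sum>i<N. \<eta> i * mpoly_eval \<iota> y (mpoly_pderiv i p))) \<in> Q"
proof -
  interpret \<iota>: ring_morphism \<iota> by fact
  let ?K = "Poly_Mapping.keys p" and ?c = "\<lambda>m. \<iota> (Poly_Mapping.lookup p m)"
  let ?t = "\<lambda>m i. of_nat (Poly_Mapping.lookup m i) * \<eta> i * mpow y (m - Poly_Mapping.single i (Suc 0))"
  have "(\<Sum>m\<in>?K. ?c m * mpow (\<lambda>i. y i + \<eta> i) m) - (\<Sum>m\<in>?K. ?c m * (mpow y m + (\<Sum>i<N. ?t m i))) \<in> Q"
    using p by (intro ideal_cong_sum ideal_cong_mult mpow_taylor Q \<eta>) (auto simp: mpolys_def is_idealD[OF Q])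
  moreover have "(\<Sum>m\<in>?K. ?c m * (mpow y m + (\<Sum>i<N. ?t m i))) =
      mpoly_eval \<iota> y p + (\<Sum>i<N. \<eta> i * mpoly_eval \<iota> y (mpoly_pderiv i p))"
    unfolding distrib_left sum.distrib sum_distrib_left mpoly_pderiv_def \<iota>.mpoly_eval_sum \<iota>.mpoly_eval_single
    by (subst (2) sum.swap) (simp add: mpoly_eval_mpow \<iota>.mult \<iota>.of_nat ac_simps)
  ultimately show ?thesis by (simp add: mpoly_eval_mpow)
qed

text \<open>The infinitesimal part of a value over the dual numbers is a directional derivative. In
  this way derivatives of the jet map are computed without differentiating its polynomials.\<close>

lemma mpoly_eval_dual:
  assumes "p \<in> mpolys N"
  shows "dual_eps (mpoly_eval dual_const (\<lambda>i. Dual_Number (a i) (e i)) p) =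
    (\<Sum>i<N. e i * mpoly_at a (mpoly_pderiv i p))"
proof -
  let ?y = "\<lambda>i. dual_const (a i)" and ?\<eta> = "\<lambda>i. Dual_Number 0 (e i)"
  have ev: "mpoly_eval dual_const ?y q = dual_const (mpoly_at a q)" for q
    by (rule mpoly_eval_hom[OF ring_morphism_dual_const, symmetric])
  have "mpoly_eval dual_const (\<lambda>i. ?y i + ?\<eta> i) p -
    (mpoly_eval dual_const ?y p + (\<Sum>i<N. ?\<eta> i * mpoly_eval dual_const ?y (mpoly_pderiv i p))) \<in> {0}"
    by (intro mpoly_taylor ring_morphism_dual_const is_ideal_zero assms) (simp add: dual_defs)
  then have "dual_eps (mpoly_eval dual_const (\<lambda>i. ?y i + ?\<eta> i) p) =
      dual_eps (mpoly_eval dual_const ?y p + (\<Sum>i<N. ?\<eta> i * mpoly_eval dual_const ?y (mpoly_pderiv i p)))"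
    by simp
  moreover have "dual_eps (Dual_Number 0 x * dual_const y) = x * y" for x y :: 'a
    by (simp add: dual_defs)
  ultimately show ?thesis by (simp add: ev dual_eps_sum) (simp add: dual_defs)
qed

text \<open>The ideal of \<^term>\<open>Z\<close> is extended to polynomials in all variables, to get an ideal of a ring type.\<close>

definition ext_ideal :: "'k :: field affine \<Rightarrow> 'k mpoly set" where
  "ext_ideal Z = {p. mpoly_subst (\<lambda>i. if i < adim Z then mpoly_var i else 0) p \<in> aideal Z}"

lemma mem_ext_ideal_iff: "p \<in> mpolys (adim Z) \<Longrightarrow> p \<in> ext_ideal Z \<longleftrightarrow> p \<in> aideal Z"
  using mpoly_eval_cong[of p "adim Z" "\<lambda>i. if i < adim Z then mpoly_var i else 0" mpoly_var mpoly_const]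
  by (simp add: ext_ideal_def mpoly_subst_ident)

lemma restrict_mem: "mpoly_subst (\<lambda>i. if i < N then mpoly_var i else 0) p \<in> mpolys N"
  unfolding mpoly_eval_mpow mpow_def
  by (intro mpolysD(4,7,8,9) mpoly_const_mem) (auto simp: mpoly_var_mem mpolysD(2))

lemma is_ideal_ext_ideal:
  assumes "affine_variety Z"
  shows "is_ideal (ext_ideal Z)"
proof -
  interpret r: ring_morphism "mpoly_subst (\<lambda>i. if i < adim Z then mpoly_var i else 0 :: 'a mpoly)"
    by (rule ring_morphism_mpoly_subst)
  show ?thesis
    using assms
    by (intro is_idealI) (auto simp: ext_ideal_def r.hom_simps affine_variety_def restrict_mem)
qed

lemma ext_ideal_mono: "adim Z = adim Z' \<Longrightarrow> aideal Z \<subseteq> aideal Z' \<Longrightarrow> ext_ideal Z \<subseteq> ext_ideal Z'"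
  by (auto simp: ext_ideal_def)

lemma ext_ideal_mult:
  assumes "adim Z\<^sub>0 = adim Z" "\<forall>p\<in>aideal Z\<^sub>0. \<forall>q\<in>aideal Z\<^sub>0. p * q \<in> aideal Z" "p \<in> ext_ideal Z\<^sub>0" "q \<in> ext_ideal Z\<^sub>0"
  shows "p * q \<in> ext_ideal Z"
  using assms by (simp add: ext_ideal_def ring_morphism.mult[OF ring_morphism_mpoly_subst])

section \<open>Etale covers defined by equations\<close>

lemma sum_lessThan_add: "(\<Sum>i<M + N. F i) = (\<Sum>i<M. F i) + (\<Sum>j<N. F (M + j :: nat) :: 'a :: comm_monoid_add)"
  by (induction N) (simp_all add: ac_simps)

text \<open>Indices below \<open>M\<close> are coordinates of the base, the next \<open>N\<close>
  are fibre coordinates, and index \<open>M + N\<close> will be an inverse of \<open>h\<close>.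
  There are as many equations \<open>P\<close> as fibre coordinates, and where \<open>h\<close> is
  invertible so is their jacobian matrix in the fibre direction. \<open>R\<close> yields the
  existence and \<open>L\<close> the uniqueness of infinitesimal lifts; \<open>q\<close> collects
  further functions to be made invertible when shrinking.\<close>

locale standard_etale =
  fixes M N :: nat and P :: "nat \<Rightarrow> 'k :: field mpoly" and q :: "'k mpoly"
    and L R :: "nat \<Rightarrow> nat \<Rightarrow> 'k mpoly" and h1 h2 :: "'k mpoly"
  assumes P_mem: "i < N \<Longrightarrow> P i \<in> mpolys (M + N)" and q_mem: "q \<in> mpolys (M + N)"
    and LR_mem: "i < N \<Longrightarrow> j < N \<Longrightarrow> L i j \<in> mpolys (M + N)" "i < N \<Longrightarrow> j < N \<Longrightarrow> R i j \<in> mpolys (M + N)"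
    and h_mem: "h1 \<in> mpolys (M + N)" "h2 \<in> mpolys (M + N)"
    and left_inverse: "i < N \<Longrightarrow> k < N \<Longrightarrow> (\<Sum>j<N. L i j * mpoly_pderiv (M + k) (P j)) = (if i = k then h1 else 0)"
    and right_inverse: "i < N \<Longrightarrow> k < N \<Longrightarrow> (\<Sum>j<N. mpoly_pderiv (M + j) (P i) * R j k) = (if i = k then h2 else 0)"
begin

definition "h = q * h1 * h2"

lemma h_mem': "h \<in> mpolys (M + N)"
  unfolding h_def by (intro mpolysD(4) q_mem h_mem)

lemma taylor_fibre_direction:
  assumes "is_ideal Q" "\<And>i j. \<delta> i * \<delta> j \<in> Q" "k < N"
  shows "mpoly_subst (\<lambda>i. if i < M then e i else e i + \<delta> (i - M)) (P k) -
    (mpoly_subst e (P k) + (\<Sum>j<N. \<delta> j * mpoly_subst e (mpoly_pderiv (M + j) (P k)))) \<in> Q"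
proof -
  let ?\<eta> = "\<lambda>i. if i < M then 0 else \<delta> (i - M)"
  have "mpoly_subst (\<lambda>i. e i + ?\<eta> i) (P k) -
    (mpoly_subst e (P k) + (\<Sum>i<M + N. ?\<eta> i * mpoly_subst e (mpoly_pderiv i (P k)))) \<in> Q"
    using assms by (intro mpoly_taylor ring_morphism_mpoly_const P_mem) (auto simp: is_idealD)
  moreover have "(\<lambda>i. e i + ?\<eta> i) = (\<lambda>i. if i < M then e i else e i + \<delta> (i - M))" by auto
  ultimately show ?thesis unfolding sum_lessThan_add by simp
qed

text \<open>A single Newton step in the fibre coordinates: the errors lie in
  \<open>I\<^sub>0\<close>, whose products lie in \<open>I\<close>, so the quadratic remainder
  disappears. Base coordinates are not moved.\<close>

lemma lift_exists:
  assumes I: "is_ideal I" "is_ideal I\<^sub>0" "\<And>a b. a \<in> I\<^sub>0 \<Longrightarrow> b \<in> I\<^sub>0 \<Longrightarrow> a * b \<in> I"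
    and e: "\<And>i. i < M + N \<Longrightarrow> e i \<in> mpolys n" and z: "z \<in> mpolys n"
    and P: "\<And>j. j < N \<Longrightarrow> mpoly_subst e (P j) \<in> I\<^sub>0" and zh: "z * mpoly_subst e h - 1 \<in> I\<^sub>0"
  shows "\<exists>c z'. (\<forall>i<M + N. c i \<in> mpolys n \<and> c i - e i \<in> I\<^sub>0) \<and> (\<forall>i<M. c i = e i) \<and> z' \<in> mpolys n \<and>
    z' - z \<in> I\<^sub>0 \<and> (\<forall>j<N. mpoly_subst c (P j) \<in> I) \<and> z' * mpoly_subst c h - 1 \<in> I"
proof -
  let ?s = "mpoly_subst e"
  interpret s: ring_morphism ?s by (rule ring_morphism_mpoly_subst)
  have mem: "?s p \<in> mpolys n" if "p \<in> mpolys (M + N)" for p using mpoly_subst_mem[OF that e] .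
  \<comment> \<open>\<open>u\<close> times the image of \<open>h2\<close> is \<open>z\<close> times
    the image of \<open>h\<close>, which is 1 modulo \<open>I\<^sub>0\<close>. So \<open>u\<close>
    times \<open>R\<close> inverts the jacobian matrix there.\<close>
  define u where "u = z * ?s (q * h1)"
  define \<delta> where "\<delta> j = (if j < N then - (u * (\<Sum>i<N. ?s (R j i) * ?s (P i))) else 0)" for j
  have \<delta>I: "\<delta> j \<in> I\<^sub>0" for j
    unfolding \<delta>_def using P by (auto intro!: is_idealD(5,3,7)[OF I(2)] is_idealD(1)[OF I(2)])
  have \<delta>_mem: "\<delta> j \<in> mpolys n" for j
    unfolding \<delta>_def u_def by (auto intro!: mpolysD mem z q_mem h_mem LR_mem P_mem)
  define c where "c i = (if i < M then e i else e i + \<delta> (i - M))" for i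
  have Pc: "mpoly_subst c (P k) \<in> I" if k: "k < N" for k
  proof -
    have "(\<Sum>j<N. \<delta> j * ?s (mpoly_pderiv (M + j) (P k))) =
        - (u * (\<Sum>j<N. \<Sum>i<N. ?s (mpoly_pderiv (M + j) (P k) * R j i) * ?s (P i)))"
      unfolding sum_distrib_left sum_negf[symmetric]
      by (intro sum.cong) (auto simp: \<delta>_def s.mult sum_distrib_left sum_distrib_right sum_negf[symmetric] ac_simps intro!: sum.cong)
    also have "(\<Sum>j<N. \<Sum>i<N. ?s (mpoly_pderiv (M + j) (P k) * R j i) * ?s (P i)) =
        (\<Sum>i<N. ?s (\<Sum>j<N. mpoly_pderiv (M + j) (P k) * R j i) * ?s (P i))"
      by (subst sum.swap) (simp add: s.sum sum_distrib_right)
    also have "\<dots> = (\<Sum>i<N. if i = k then ?s h2 * ?s (P k) else 0)"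
      using right_inverse[OF k] by (intro sum.cong) (auto simp: s.zero)
    also have "\<dots> = ?s h2 * ?s (P k)" using k by simp
    finally have "?s (P k) + (\<Sum>j<N. \<delta> j * ?s (mpoly_pderiv (M + j) (P k))) = - ((z * ?s h - 1) * ?s (P k))"
      by (simp add: u_def h_def s.mult algebra_simps)
    moreover have "- ((z * ?s h - 1) * ?s (P k)) \<in> I" by (intro is_idealD(5)[OF I(1)] I(3) zh P k)
    moreover have "mpoly_subst c (P k) - (?s (P k) + (\<Sum>j<N. \<delta> j * ?s (mpoly_pderiv (M + j) (P k)))) \<in> I"
      unfolding c_def by (intro taylor_fibre_direction I(1,3) \<delta>I k)
    ultimately show ?thesis using ideal_cong_mem[OF I(1)] by metis
  qed
  have ce: "c i - e i \<in> I\<^sub>0" for i by (simp add: c_def \<delta>I is_idealD(1)[OF I(2)])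
  have "mpoly_subst c h - ?s h \<in> I\<^sub>0" by (intro mpoly_eval_cong_ideal[OF I(2) h_mem'] ce)
  then have "z * mpoly_subst c h - z * ?s h \<in> I\<^sub>0"
    by (intro ideal_cong_mult I(2)) (simp_all add: is_idealD[OF I(2)])
  then have zc: "z * mpoly_subst c h - 1 \<in> I\<^sub>0" using zh by (rule ideal_cong_trans[OF I(2)])
  \<comment> \<open>Newton's formula for the inverse: the new error is minus the square of the old
    one.\<close>
  define z' where "z' = z * (1 - (z * mpoly_subst c h - 1))"
  have c_mem: "c i \<in> mpolys n" if "i < M + N" for i
    using e[OF that] \<delta>_mem by (auto simp: c_def intro: mpolysD)
  have "z' * mpoly_subst c h - 1 = - ((z * mpoly_subst c h - 1) * (z * mpoly_subst c h - 1))"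
    by (simp add: z'_def algebra_simps)
  then have "z' * mpoly_subst c h - 1 \<in> I" using is_idealD(5)[OF I(1) I(3)[OF zc zc]] by simp
  moreover have "z' \<in> mpolys n"
    unfolding z'_def by (intro mpolysD(4,6) mpolysD(1) z mpoly_subst_mem[OF h_mem' c_mem])
  moreover have "z' - z \<in> I\<^sub>0"
  proof -
    have "z' - z = - (z * (z * mpoly_subst c h - 1))" by (simp add: z'_def algebra_simps)
    then show ?thesis using is_idealD(5)[OF I(2) is_idealD(3)[OF I(2) zc]] by simp
  qed
  ultimately show ?thesis using Pc ce c_mem
    by (intro exI[of _ c] exI[of _ z']) (auto simp: c_def)
qed

text \<open>The difference \<open>\<delta>\<close> of two lifts has products in \<open>I\<close>, so
  Taylor's formula makes it a solution of the linearised equations modulo \<open>I\<close>.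
  Multiplication by \<open>L\<close> leaves \<open>h1\<close> times \<open>\<delta>\<close>, and
  \<open>h1\<close> divides the invertible \<open>h\<close>. Uniqueness of the inverse of
  \<open>h\<close> then settles the last coordinate.\<close>

lemma lift_unique:
  assumes I: "is_ideal I" "is_ideal I\<^sub>0" "\<And>a b. a \<in> I\<^sub>0 \<Longrightarrow> b \<in> I\<^sub>0 \<Longrightarrow> a * b \<in> I"
    and base: "\<And>i. i < M \<Longrightarrow> c i - d i \<in> I" and near: "\<And>i. i < M + N \<Longrightarrow> c i - d i \<in> I\<^sub>0"
    and P: "\<And>j. j < N \<Longrightarrow> mpoly_subst c (P j) \<in> I" "\<And>j. j < N \<Longrightarrow> mpoly_subst d (P j) \<in> I"
    and z: "z * mpoly_subst c h - 1 \<in> I" "z' * mpoly_subst d h - 1 \<in> I"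
  shows "(\<forall>i<M + N. c i - d i \<in> I) \<and> z - z' \<in> I"
proof -
  let ?s = "mpoly_subst c"
  interpret s: ring_morphism ?s by (rule ring_morphism_mpoly_subst)
  define \<delta> where "\<delta> j = (if j < N then d (M + j) - c (M + j) else 0)" for j
  have \<delta>I: "\<delta> j \<in> I\<^sub>0" for j
    using near[of "M + j"] ideal_cong_sym[OF I(2)] by (auto simp: \<delta>_def is_idealD[OF I(2)])
  let ?d = "\<lambda>i. if i < M then c i else c i + \<delta> (i - M)"
  have dd: "?d i - d i \<in> I" if "i < M + N" for i
    using that base by (auto simp: \<delta>_def is_idealD[OF I(1)])
  have lin: "(\<Sum>j<N. \<delta> j * ?s (mpoly_pderiv (M + j) (P k))) \<in> I" if k: "k < N" for k
  proof -
    have "mpoly_subst ?d (P k) - mpoly_subst d (P k) \<in> I"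
      by (intro mpoly_eval_cong_ideal[OF I(1) P_mem[OF k]] dd)
    then have "mpoly_subst ?d (P k) \<in> I" using P(2)[OF k] by (rule ideal_cong_mem[OF I(1)])
    moreover have "mpoly_subst ?d (P k) - (?s (P k) + (\<Sum>j<N. \<delta> j * ?s (mpoly_pderiv (M + j) (P k)))) \<in> I"
      by (intro taylor_fibre_direction I(1,3) \<delta>I k)
    ultimately have "?s (P k) + (\<Sum>j<N. \<delta> j * ?s (mpoly_pderiv (M + j) (P k))) \<in> I"
      using ideal_cong_mem[OF I(1) ideal_cong_sym[OF I(1)]] by blast
    then have "?s (P k) + (\<Sum>j<N. \<delta> j * ?s (mpoly_pderiv (M + j) (P k))) - ?s (P k) \<in> I"
      using P(1)[OF k] by (rule is_idealD(6)[OF I(1)])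
    then show ?thesis by simp
  qed
  have \<delta>0: "\<delta> i \<in> I" if i: "i < N" for i
  proof -
    have "(\<Sum>k<N. ?s (L i k) * (\<Sum>j<N. \<delta> j * ?s (mpoly_pderiv (M + j) (P k)))) \<in> I"
      by (rule is_idealD(7)[OF I(1)], rule is_idealD(3)[OF I(1)], rule lin) simp
    also have "(\<Sum>k<N. ?s (L i k) * (\<Sum>j<N. \<delta> j * ?s (mpoly_pderiv (M + j) (P k)))) =
        (\<Sum>j<N. \<delta> j * ?s (\<Sum>k<N. L i k * mpoly_pderiv (M + j) (P k)))"
      unfolding sum_distrib_left s.sum by (subst sum.swap) (simp add: s.mult ac_simps)
    also have "\<dots> = (\<Sum>j<N. if j = i then \<delta> i * ?s h1 else 0)"
      using left_inverse[OF i] by (intro sum.cong) (auto simp: s.zero)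
    also have "\<dots> = \<delta> i * ?s h1" using i by simp
    finally have "z * ?s q * ?s h2 * (\<delta> i * ?s h1) \<in> I" by (rule is_idealD(3)[OF I(1)])
    moreover have "\<delta> i * (z * ?s h - 1) \<in> I" by (rule is_idealD(3)[OF I(1) z(1)])
    ultimately have "z * ?s q * ?s h2 * (\<delta> i * ?s h1) - \<delta> i * (z * ?s h - 1) \<in> I"
      by (rule is_idealD(6)[OF I(1)])
    then show ?thesis by (simp add: h_def s.mult algebra_simps)
  qed
  have cd: "c i - d i \<in> I" if "i < M + N" for i
  proof (cases "i < M")
    case False
    then have i: "M + (i - M) = i" "i - M < N" using that by auto
    then have "c i - d i = - \<delta> (i - M)" by (simp add: \<delta>_def)
    then show ?thesis using is_idealD(5)[OF I(1) \<delta>0[OF i(2)]] by simp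
  qed (rule base)
  have "?s h - mpoly_subst d h \<in> I" by (intro mpoly_eval_cong_ideal[OF I(1) h_mem'] cd)
  then have "z * z' * (?s h - mpoly_subst d h) \<in> I" by (rule is_idealD(3)[OF I(1)])
  moreover have "z' * (z * ?s h - 1) \<in> I" "z * (z' * mpoly_subst d h - 1) \<in> I"
    by (intro is_idealD(3)[OF I(1)] z)+
  ultimately have "z * (z' * mpoly_subst d h - 1) - z' * (z * ?s h - 1) + z * z' * (?s h - mpoly_subst d h) \<in> I"
    by (intro is_idealD(2,6)[OF I(1)])
  moreover have "z * (z' * mpoly_subst d h - 1) - z' * (z * ?s h - 1) + z * z' * (?s h - mpoly_subst d h) = - (z - z')"
    by (simp add: algebra_simps)
  ultimately have "z - z' \<in> I" using is_idealD(5)[OF I(1), of "- (z - z')"] by simp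
  with cd show ?thesis by blast
qed

definition equations :: "'k affine \<Rightarrow> 'k mpoly set" where
  "equations S = aideal S \<union> P ` {..<N} \<union> {mpoly_var (M + N) * h - 1}"

text \<open>The ideal is generated among the polynomials in all variables, where
  \<open>ideal_gen\<close> applies, and then cut down to the variables of the cover.\<close>

definition cover :: "'k affine \<Rightarrow> 'k affine" where
  "cover S = \<lparr>adim = Suc (M + N), aideal = ideal_gen (equations S) \<inter> mpolys (Suc (M + N))\<rparr>"

lemma adim_cover [simp]: "adim (cover S) = Suc (M + N)"
  by (simp add: cover_def)

lemma cover_variety: "affine_variety (cover S)"
  using is_idealD[OF is_ideal_ideal_gen[of "equations S"]]
  by (auto simp: affine_variety_def cover_def mpolysD)

lemma equations_mem:
  assumes "affine_variety S" "adim S = M"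
  shows "equations S \<subseteq> aideal (cover S)"
proof -
  have sub: "mpolys M \<subseteq> (mpolys (Suc (M + N)) :: 'k mpoly set)" "mpolys (M + N) \<subseteq> (mpolys (Suc (M + N)) :: 'k mpoly set)"
    by (rule mpolys_mono; simp)+
  have "aideal S \<subseteq> mpolys (Suc (M + N))" using assms sub(1) by (auto simp: affine_variety_def)
  moreover have "P i \<in> mpolys (Suc (M + N))" if "i < N" for i using P_mem[OF that] sub(2) by blast
  moreover have "mpoly_var (M + N) * h - 1 \<in> mpolys (Suc (M + N))"
    using h_mem' sub(2) by (intro mpolysD(4,6) mpolysD(1) mpoly_var_mem) auto
  ultimately have "equations S \<subseteq> mpolys (Suc (M + N))" by (auto simp: equations_def)
  moreover have "equations S \<subseteq> ideal_gen (equations S)" by (rule module.span_superset[OF module_times])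
  ultimately show ?thesis by (simp add: cover_def)
qed

lemma morphism_to_coverI:
  assumes Z: "affine_variety Z" and c: "\<And>i. i < Suc (M + N) \<Longrightarrow> c i \<in> mpolys (adim Z)"
    and eqs: "\<And>p. p \<in> equations S \<Longrightarrow> mpoly_subst c p \<in> ext_ideal Z"
  shows "morphism Z (cover S) c"
  unfolding morphism_def
proof (intro conjI allI impI ballI)
  fix p assume p: "p \<in> aideal (cover S)"
  interpret c: ring_morphism "mpoly_subst c" by (rule ring_morphism_mpoly_subst)
  note I = is_idealD[OF is_ideal_ext_ideal[OF Z]]
  have "is_ideal {p. mpoly_subst c p \<in> ext_ideal Z}"
    by (rule is_idealI) (simp_all add: c.hom_simps I)
  then have "ideal_gen (equations S) \<subseteq> {p. mpoly_subst c p \<in> ext_ideal Z}"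
    using eqs by (intro ideal_gen_minimal) auto
  then have "mpoly_subst c p \<in> ext_ideal Z" using p by (auto simp: cover_def)
  moreover have "mpoly_subst c p \<in> mpolys (adim Z)"
    using p by (intro mpoly_subst_mem[OF _ c]) (auto simp: cover_def)
  ultimately show "mpoly_subst c p \<in> aideal Z" by (simp add: mem_ext_ideal_iff)
qed (use c in simp)

lemma morphism_to_coverD:
  assumes S: "affine_variety S" "adim S = M" and Z: "affine_variety Z" and b: "morphism Z (cover S) b"
  shows "i < Suc (M + N) \<Longrightarrow> b i \<in> mpolys (adim Z)"
    "p \<in> equations S \<Longrightarrow> mpoly_subst b p \<in> ext_ideal Z"
proof -
  show "i < Suc (M + N) \<Longrightarrow> b i \<in> mpolys (adim Z)" using b by (simp add: morphism_def)
  assume "p \<in> equations S"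
  then have "mpoly_subst b p \<in> aideal Z" using b equations_mem[OF S] by (auto simp: morphism_def)
  then show "mpoly_subst b p \<in> ext_ideal Z"
    using Z mem_ext_ideal_iff by (auto simp: affine_variety_def)
qed

lemma cover_etale:
  assumes S: "affine_variety S" "adim S = M"
  shows "etale (cover S) S mpoly_var"
  unfolding etale_def
proof (intro conjI allI impI)
  have "i < M \<Longrightarrow> mpoly_var i \<in> mpolys (Suc (M + N))" for i by (rule mpoly_var_mem) simp
  then show "morphism (cover S) S mpoly_var"
    using S equations_mem[OF S] by (auto simp: morphism_def mpoly_subst_ident equations_def)
next
  fix Z Z\<^sub>0 :: "'k affine" and a b
  assume "affine_variety Z \<and> affine_variety Z\<^sub>0 \<and> adim Z\<^sub>0 = adim Z \<and> aideal Z \<subseteq> aideal Z\<^sub>0 \<and>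
    (\<forall>p\<in>aideal Z\<^sub>0. \<forall>q\<in>aideal Z\<^sub>0. p * q \<in> aideal Z) \<and>
    morphism Z S a \<and> morphism Z\<^sub>0 (cover S) b \<and> same_morphism Z\<^sub>0 S (morphism_comp mpoly_var b) a"
  then have Z: "affine_variety Z" "affine_variety Z\<^sub>0" and dim: "adim Z\<^sub>0 = adim Z" and "aideal Z \<subseteq> aideal Z\<^sub>0"
    and sq: "\<forall>p\<in>aideal Z\<^sub>0. \<forall>q\<in>aideal Z\<^sub>0. p * q \<in> aideal Z"
    and a: "morphism Z S a" and b: "morphism Z\<^sub>0 (cover S) b"
    and ba: "same_morphism Z\<^sub>0 S (morphism_comp mpoly_var b) a" by blast+
  let ?I = "ext_ideal Z" and ?K = "ext_ideal Z\<^sub>0" and ?n = "adim Z"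
  have II0: "?I \<subseteq> ?K" using ext_ideal_mono[of Z Z\<^sub>0] dim \<open>aideal Z \<subseteq> aideal Z\<^sub>0\<close> by simp
  note I = is_ideal_ext_ideal[OF Z(1)] and I0 = is_ideal_ext_ideal[OF Z(2)]
  note sq' = ext_ideal_mult[OF dim sq]
  note memI = mem_ext_ideal_iff[of _ Z] and memI0 = mem_ext_ideal_iff[of _ Z\<^sub>0]
  have Zsub: "aideal Z \<subseteq> mpolys ?n" "aideal Z\<^sub>0 \<subseteq> mpolys ?n"
    using Z dim unfolding affine_variety_def by (metis, metis)
  have aI: "x \<in> ?I" if "x \<in> aideal Z" for x
    using memI[OF subsetD[OF Zsub(1) that]] that by simp
  have aI0: "x \<in> ?K" if "x \<in> aideal Z\<^sub>0" for x
    using memI0[of x] subsetD[OF Zsub(2) that] that dim by simp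
  have a_mem: "a i \<in> mpolys ?n" if "i < M" for i using a that S by (simp add: morphism_def)
  have b_mem: "b i \<in> mpolys ?n" if "i < Suc (M + N)" for i using morphism_to_coverD(1)[OF S Z(2) b that] dim by simp
  have ab: "a i - b i \<in> ?K" if "i < M" for i
    by (rule ideal_cong_sym[OF I0 aI0])
      (use ba that S in \<open>simp add: same_morphism_def morphism_comp_def mpoly_subst_var\<close>)
  \<comment> \<open>Base coordinates from \<open>a\<close>, fibre coordinates from \<open>b\<close>:
    this agrees with \<open>b\<close> modulo \<open>?K\<close> and already lies exactly over
    \<open>a\<close>, so only the fibre coordinates have to be corrected.\<close>
  define e where "e i = (if i < M then a i else b i)" for i
  have e_mem: "e i \<in> mpolys ?n" if "i < M + N" for i using that a_mem b_mem by (simp add: e_def)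
  have eb: "e i - b i \<in> ?K" for i by (simp add: e_def ab is_idealD[OF I0])
  have e_P: "mpoly_subst e (P j) \<in> ?K" if "j < N" for j
  proof -
    have "mpoly_subst b (P j) \<in> ?K" using that by (intro morphism_to_coverD(2)[OF S Z(2) b]) (simp add: equations_def)
    with mpoly_eval_cong_ideal[OF I0 P_mem[OF that] eb] show ?thesis by (rule ideal_cong_mem[OF I0])
  qed
  have "mpoly_subst b (mpoly_var (M + N) * h - 1) \<in> ?K"
    by (intro morphism_to_coverD(2)[OF S Z(2) b]) (simp add: equations_def)
  then have "b (M + N) * mpoly_subst b h - 1 \<in> ?K"
    by (simp add: ring_morphism.hom_simps[OF ring_morphism_mpoly_subst] mpoly_subst_var)
  moreover have "b (M + N) * mpoly_subst e h - b (M + N) * mpoly_subst b h \<in> ?K"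
    using mpoly_eval_cong_ideal[OF I0 h_mem' eb] by (intro ideal_cong_mult I0) (simp_all add: is_idealD[OF I0])
  ultimately have e_h: "b (M + N) * mpoly_subst e h - 1 \<in> ?K"
    using ideal_cong_trans[OF I0] by blast
  have bz_mem: "b (M + N) \<in> mpolys ?n" by (rule b_mem) simp
  obtain c0 z where c0: "\<forall>i<M + N. c0 i \<in> mpolys ?n \<and> c0 i - e i \<in> ?K" "\<forall>i<M. c0 i = e i"
    and z: "z \<in> mpolys ?n" "z - b (M + N) \<in> ?K"
    and Pc: "\<forall>j<N. mpoly_subst c0 (P j) \<in> ?I" and hc: "z * mpoly_subst c0 h - 1 \<in> ?I"
    using lift_exists[OF I I0 sq' e_mem bz_mem e_P e_h] by blast
  define c where "c = c0(M + N := z)"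
  have c_mem: "c i \<in> mpolys ?n" if "i < Suc (M + N)" for i
    using that c0(1) z(1) by (auto simp: c_def less_Suc_eq)
  have c_c0: "mpoly_subst c p = mpoly_subst c0 p" if "p \<in> mpolys (M + N)" for p
    using that by (rule mpoly_eval_cong) (simp add: c_def)
  have ca: "c i = a i" if "i < M" for i using that c0(2) by (simp add: c_def e_def)
  have "morphism Z (cover S) c"
  proof (rule morphism_to_coverI[OF Z(1) c_mem])
    fix p assume "p \<in> equations S"
    then consider "p \<in> aideal S" | j where "j < N" "p = P j" | "p = mpoly_var (M + N) * h - 1"
      by (auto simp: equations_def)
    then show "mpoly_subst c p \<in> ?I"
    proof cases
      case 1
      then have "mpoly_subst c p = mpoly_subst a p"
        using S ca by (intro mpoly_eval_cong[of _ M]) (auto simp: affine_variety_def)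
      then show ?thesis using a 1 aI by (simp add: morphism_def)
    next
      case 2
      then show ?thesis using c_c0[OF P_mem] Pc by simp
    next
      case 3
      then show ?thesis using hc c_c0[OF h_mem']
        by (simp add: ring_morphism.hom_simps[OF ring_morphism_mpoly_subst] mpoly_subst_var c_def)
    qed
  qed
  moreover have "same_morphism Z S (morphism_comp mpoly_var c) a"
    using S Z(1) ca by (simp add: same_morphism_def morphism_comp_def mpoly_subst_var affine_variety_def)
  moreover have "same_morphism Z\<^sub>0 (cover S) c b"
    unfolding same_morphism_def
  proof (intro allI impI)
    fix i assume i: "i < adim (cover S)"
    have "c i - b i \<in> ?K"
    proof (cases "i = M + N")
      case False
      then have "c i - e i \<in> ?K" using c0(1) i by (simp add: c_def)
      with eb show ?thesis using ideal_cong_trans[OF I0] by blast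
    qed (simp add: c_def z)
    moreover have "c i - b i \<in> mpolys (adim Z\<^sub>0)" using c_mem b_mem i dim by (auto intro: mpolysD(6))
    ultimately show "c i - b i \<in> aideal Z\<^sub>0" using memI0 by blast
  qed
  moreover have "same_morphism Z (cover S) c d"
    if d: "morphism Z (cover S) d \<and> same_morphism Z S (morphism_comp mpoly_var d) a \<and> same_morphism Z\<^sub>0 (cover S) d b" for d
  proof -
    have dmor: "morphism Z (cover S) d" using d by blast
    have d_mem: "d i \<in> mpolys ?n" if "i < Suc (M + N)" for i using morphism_to_coverD(1)[OF S Z(1) dmor that] .
    have da: "c i - d i \<in> ?I" if "i < M" for i
      by (rule ideal_cong_sym[OF I aI])
        (use d that S ca[OF that] in \<open>simp add: same_morphism_def morphism_comp_def mpoly_subst_var\<close>)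
    have cb: "c i - b i \<in> ?K" "d i - b i \<in> ?K" if "i < Suc (M + N)" for i
      using d \<open>same_morphism Z\<^sub>0 (cover S) c b\<close> that aI0 by (auto simp: same_morphism_def)
    have cd: "c i - d i \<in> ?K" if "i < M + N" for i
    proof -
      have "i < Suc (M + N)" using that by simp
      then show ?thesis using cb[of i] by (metis I0 ideal_cong_sym ideal_cong_trans)
    qed
    have Pd: "mpoly_subst d (P j) \<in> ?I" if "j < N" for j
      using that by (intro morphism_to_coverD(2)[OF S Z(1) dmor]) (simp add: equations_def)
    have "mpoly_subst d (mpoly_var (M + N) * h - 1) \<in> ?I"
      by (intro morphism_to_coverD(2)[OF S Z(1) dmor]) (simp add: equations_def)
    then have hd: "d (M + N) * mpoly_subst d h - 1 \<in> ?I"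
      by (simp add: ring_morphism.hom_simps[OF ring_morphism_mpoly_subst] mpoly_subst_var)
    have Pc': "mpoly_subst c (P j) \<in> ?I" if "j < N" for j using Pc c_c0[OF P_mem[OF that]] that by simp
    have hc': "c (M + N) * mpoly_subst c h - 1 \<in> ?I" using hc c_c0[OF h_mem'] by (simp add: c_def)
    have "(\<forall>i<M + N. c i - d i \<in> ?I) \<and> c (M + N) - d (M + N) \<in> ?I"
      by (rule lift_unique[OF I I0 sq' da cd Pc' Pd hc' hd])
    then have "c i - d i \<in> ?I" if "i < Suc (M + N)" for i
      using that by (auto simp: less_Suc_eq)
    then show ?thesis
      using c_mem d_mem by (auto simp: same_morphism_def memI[symmetric] mpolysD(6))
  qed
  ultimately show "\<exists>c. morphism Z (cover S) c \<and> same_morphism Z S (morphism_comp mpoly_var c) a \<and>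
      same_morphism Z\<^sub>0 (cover S) c b \<and> (\<forall>d. morphism Z (cover S) d \<and>
        same_morphism Z S (morphism_comp mpoly_var d) a \<and> same_morphism Z\<^sub>0 (cover S) d b \<longrightarrow>
        same_morphism Z (cover S) c d)" by blast
qed

end

section \<open>Completeness\<close>

lemma coeffs_in_subring:
  fixes S :: "'a :: comm_ring_1 set"
  assumes "is_subring S"
  shows "is_subring (coeffs_in S :: ('a, 'v) mps set)"
proof -
  note S = is_subringD[OF assms]
  have "F * G \<in> coeffs_in S" if "F \<in> coeffs_in S" "G \<in> coeffs_in S"
    for F G :: "('a, 'v) mps"
    using that by (auto simp: coeffs_in_def mps_coeff_mult intro!: S(4,7))
  then show ?thesis
    unfolding is_subring_def by (simp add: coeffs_in_def mps_coeff_one S(1-5))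
qed

lemma coeffs_in_subring_const: "is_subring S \<Longrightarrow> c \<in> S \<Longrightarrow> mps_const c \<in> coeffs_in S"
  by (auto simp: coeffs_in_def mps_coeff_const is_subringD)

lemma coeffs_in_subring_monom: "is_subring S \<Longrightarrow> mps_monom m \<in> coeffs_in S"
  by (auto simp: coeffs_in_def mps_coeff_monom is_subringD)

lemma coeffs_in_subring_pderiv: "is_subring S \<Longrightarrow> F \<in> coeffs_in S \<Longrightarrow> mps_pderiv i F \<in> coeffs_in S"
  by (auto simp: coeffs_in_def mps_coeff_pderiv simp del: of_nat_Suc intro!: is_subringD(4,10))

lemma coeffs_in_subring_subst:
  assumes "is_subring S" "\<forall>i. \<phi> i \<in> mps_max" "\<And>i. \<phi> i \<in> coeffs_in S" "F \<in> coeffs_in S"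
  shows "mps_subst \<phi> F \<in> coeffs_in S"
proof -
  note C = is_subringD[OF coeffs_in_subring[OF assms(1)]]
  have "mpow \<phi> k \<in> coeffs_in S" for k
    unfolding mpow_def by (intro C(8,9) assms(3))
  then show ?thesis
    using assms(4)
    by (auto simp: coeffs_in_def mps_coeff_subst[OF assms(2) lessI] intro!: is_subringD(4,7)[OF assms(1)])
qed

lemma mps_map_const_coeffs: "mps_map mpoly_const X \<in> coeffs_in (mpolys n)"
  by (simp add: coeffs_in_def mpoly_const_mem)

lemma mps_map_eval_const:
  "ring_morphism \<kappa> \<Longrightarrow> mps_map (mpoly_eval \<kappa> a) (mps_map mpoly_const X) = mps_map \<kappa> X"
  by (rule mps_eqI) (simp add: ring_morphism.mpoly_eval_const)

lemma mps_map_ident: "mps_map (\<lambda>c. c) X = X"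
  by (rule mps_eqI) simp

lemma is_ideal_vanishing: "is_ideal {p. mpoly_at w p = 0}"
  by (rule is_idealI) (simp_all add: ring_morphism.hom_simps[OF ring_morphism_mpoly_at])

lemma fibre_cong:
  assumes "\<And>m. mps_coeff F m \<in> mpolys N" "\<And>i. i < N \<Longrightarrow> a i = b i"
  shows "fibre F a = fibre F b"
  unfolding fibre_def
  by (rule mps_eqI) (simp add: mpoly_eval_cong[OF assms])

lemma fibre_linear_unfolding:
  "fibre (linear_unfolding f l g) t = linear_family (\<lambda>c. c) f l (\<lambda>i. mps_of_mpoly (g i)) t"
  by (rule mps_eqI)
    (simp add: fibre_def linear_unfolding_coeff linear_family_def ring_morphism.hom_simps[OF ring_morphism_mpoly_at]
      ring_morphism.sum[OF ring_morphism_mpoly_at] mpoly_at_var ring_morphism.mpoly_eval_const[OF ring_morphism_id])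

lemma unfolding_of_linear_unfolding:
  fixes f :: "('k :: field, 'v) mps"
  assumes "f \<in> mps_max" "\<And>i. i < l \<Longrightarrow> mps_of_mpoly (g i) \<in> mps_max"
  shows "unfolding_of f (affine_space l) (\<lambda>_. 0) (linear_unfolding f l g)"
  unfolding unfolding_of_def
proof (intro conjI allI ballI)
  show "affine_variety (affine_space l :: 'k affine)"
    by (simp add: affine_variety_def affine_space_def mpolysD(2))
  show "(\<lambda>_. 0) \<in> points (affine_space l :: 'k affine)"
    by (simp add: points_def affine_space_def mpoly_eval_def)
  show "mps_coeff (linear_unfolding f l g) m \<in> mpolys (adim (affine_space l :: 'k affine))" for m
    unfolding linear_unfolding_coeff affine_space_def
    by (auto intro!: mpolysD(3,4,7) mpoly_const_mem mpoly_var_mem)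
  show "fibre (linear_unfolding f l g) (\<lambda>_. 0) = f"
    by (simp add: fibre_linear_unfolding linear_family_def mps_map_ident)
  show "fibre (linear_unfolding f l g) t \<in> mps_max" for t
    using assms by (simp add: fibre_linear_unfolding linear_family_def mps_max_def)
qed

text \<open>Near \<^term>\<open>w\<close>, the monomials of degree less than \<^term>\<open>d\<close> still span the quotient by the tangent
  image modulo high degree, so the codimension, and hence the degree needed, stays bounded.\<close>

lemma (in tangent_solution) tangent_deg_open:
  fixes H :: "('k mpoly, 'v) mps"
  assumes H: "\<And>m. mps_coeff H m \<in> mpolys M" and Hw: "fibre H w = f"
  shows "\<exists>D h. 1 \<le> D \<and> h \<in> mpolys M \<and> mpoly_at w h = 1 \<and>
    (\<forall>s. mpoly_at s h \<noteq> 0 \<longrightarrow> tangent_deg G (fibre H s) D)"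
proof -
  define Y where "Y = {\<gamma> :: 'v \<Rightarrow>\<^sub>0 nat. mdeg \<gamma> < d}"
  \<comment> \<open>\<open>card Y\<close> bounds the codimension of the tangent images of nearby
    fibres modulo high order, which is what \<open>monom_mem_of_finite_codim\<close> asks of the
    degree; the maximum with \<open>d\<close> keeps \<open>D\<close> positive.\<close>
  define D where "D = max d (card Y)"
  define X where "X = {\<beta> :: 'v \<Rightarrow>\<^sub>0 nat. d \<le> mdeg \<beta> \<and> mdeg \<beta> \<le> D}"
  have finX: "finite X" unfolding X_def by (rule finite_subset[OF _ finite_monoms_UNIV(1)[of D]]) auto
  have finY: "finite Y" unfolding Y_def by (rule finite_monoms_UNIV)
  let ?c = "mps_map mpoly_const :: ('k, 'v) mps \<Rightarrow> ('k mpoly, 'v) mps"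
  \<comment> \<open>The solution found at \<open>f\<close> is kept fixed while the fibre varies. At
    \<open>w\<close> this tangent vector is the monomial itself, no generators being involved from
    degree \<open>d\<close> on.\<close>
  define A where "A \<alpha> = (\<Sum>i\<in>UNIV. ?c (\<Xi> \<alpha> i) * mps_pderiv i H) + ?c (U \<alpha>) * H" for \<alpha>
  have A_fibre: "fibre (A \<alpha>) s = (\<Sum>i\<in>UNIV. \<Xi> \<alpha> i * mps_pderiv i (fibre H s)) + U \<alpha> * fibre H s" for \<alpha> s
  proof -
    interpret m: ring_morphism "mps_map (mpoly_at s) :: ('k mpoly, 'v) mps \<Rightarrow> _"
      by (rule ring_morphism_mps_map[OF ring_morphism_mpoly_at])
    show ?thesis
      by (simp add: A_def fibre_def m.add m.sum m.mult mps_map_pderiv[OF ring_morphism_mpoly_at]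
          mps_map_eval_const[OF ring_morphism_id] mps_map_ident)
  qed
  have A_w: "fibre (A \<alpha>) w = mps_monom \<alpha>" if "\<alpha> \<in> X" for \<alpha>
  proof -
    have "\<alpha> \<noteq> 0" using that d_pos by (auto simp: X_def)
    then have "mps_monom \<alpha> = (\<Sum>i\<in>UNIV. \<Xi> \<alpha> i * mps_pderiv i f) + (\<Sum>j<l. mps_const (C \<alpha> j) * g j) + U \<alpha> * f"
      by (rule solution)
    then show ?thesis using that C_high[of \<alpha>] by (simp add: A_fibre Hw X_def)
  qed
  have sub: "is_subring (coeffs_in (mpolys M) :: ('k mpoly, 'v) mps set)"
    by (rule coeffs_in_subring[OF mpolys_subring])
  have "H \<in> coeffs_in (mpolys M)" using H by (simp add: coeffs_in_def)
  then have "A \<alpha> \<in> coeffs_in (mpolys M)" for \<alpha>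
    unfolding A_def
    by (intro is_subringD(3,4,7)[OF sub] mps_map_const_coeffs coeffs_in_subring_pderiv mpolys_subring)
  then have A_mem: "mps_coeff (A \<alpha>) \<beta> \<in> mpolys M" for \<alpha> \<beta> by (simp add: coeffs_in_def)
  \<comment> \<open>On the monomials in \<open>X\<close> the coefficient matrix is the identity at
    \<open>w\<close>, hence invertible wherever a suitable \<open>h\<close> is nonzero.\<close>
  have "mps_coeff (A \<alpha>) \<beta> \<in> mpolys M \<and>
      mps_coeff (A \<alpha>) \<beta> - (if \<alpha> = \<beta> then 1 else 0) \<in> {p. mpoly_at w p = 0}" if "\<alpha> \<in> X" "\<beta> \<in> X" for \<alpha> \<beta>
    using A_mem arg_cong[OF A_w[OF that(1)], of "\<lambda>F. mps_coeff F \<beta>"]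
    by (auto simp: fibre_def mps_coeff_monom ring_morphism.hom_simps[OF ring_morphism_mpoly_at])
  from near_identity_left_inverse[OF finX mpolys_subring is_ideal_vanishing, of "\<lambda>\<alpha> \<beta>. mps_coeff (A \<alpha>) \<beta>", OF this]
  obtain B h where h: "h \<in> mpolys M" "h - 1 \<in> {p. mpoly_at w p = 0}"
    and BA: "\<And>\<beta> \<gamma>. \<beta> \<in> X \<Longrightarrow> \<gamma> \<in> X \<Longrightarrow> (\<Sum>\<alpha>\<in>X. B \<beta> \<alpha> * mps_coeff (A \<alpha>) \<gamma>) = (if \<beta> = \<gamma> then h else 0)"
    by blast
  from h(2) have hw: "mpoly_at w h = 1" by (simp add: ring_morphism.hom_simps[OF ring_morphism_mpoly_at])
  have "tangent_deg G (fibre H s) D" if s: "mpoly_at s h \<noteq> 0" for s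
  proof -
    let ?T = "tangent_image G (fibre H s)"
    \<comment> \<open>Working modulo order \<open>Suc D\<close> makes the problem finite: only the
      monomials in \<open>X\<close> and \<open>Y\<close> remain.\<close>
    define J where "J = {x. \<exists>t\<in>?T. x - t \<in> ord_ge (Suc D)}"
    note T = is_idealD[OF is_ideal_tangent_image[of G "fibre H s"]]
      and O = is_idealD[OF is_ideal_ord_ge[of "Suc D"]]
    have J: "is_ideal J"
    proof (rule is_idealI)
      show "0 \<in> J" unfolding J_def using T(1) O(1) by (intro CollectI bexI[of _ 0]) auto
      show "a + b \<in> J" if ab: "a \<in> J" "b \<in> J" for a b
      proof -
        obtain t t' where "t \<in> ?T" "a - t \<in> ord_ge (Suc D)" "t' \<in> ?T" "b - t' \<in> ord_ge (Suc D)"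
          using ab unfolding J_def by blast
        then have "t + t' \<in> ?T" "a + b - (t + t') \<in> ord_ge (Suc D)"
          by (simp_all add: T(2) ideal_cong_add[OF is_ideal_ord_ge])
        then show ?thesis unfolding J_def by blast
      qed
      show "r * a \<in> J" if ab: "a \<in> J" for r a
      proof -
        obtain t where "t \<in> ?T" "a - t \<in> ord_ge (Suc D)"
          using ab unfolding J_def by blast
        then have "r * t \<in> ?T" "r * a - r * t \<in> ord_ge (Suc D)"
          by (simp_all add: T(3) O(3) flip: right_diff_distrib)
        then show ?thesis unfolding J_def by blast
      qed
    qed
    have TJ: "t \<in> J" if "t \<in> ?T" for t using that O(1) unfolding J_def by (intro CollectI bexI[of _ t]) auto
    have OJ: "t \<in> J" if "t \<in> ord_ge (Suc D)" for t
      using that T(1) unfolding J_def by (intro CollectI bexI[of _ 0]) auto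
    obtain e where e: "bij_betw e {..<card Y} Y"
      using ex_bij_betw_nat_finite[OF finY] by (auto simp: atLeast0LessThan)
    have gen: "\<exists>c. mps_monom \<beta> - (\<Sum>i<card Y. mps_const (c i) * mps_monom (e i)) \<in> J" if \<beta>: "mdeg \<beta> \<le> D" for \<beta>
    proof -
      have "\<exists>c. mps_monom \<beta> - (\<Sum>\<gamma>\<in>Y. mps_const (c \<gamma>) * mps_monom \<gamma>) \<in> J"
      proof (cases "mdeg \<beta> < d")
        case True
        then have "(\<Sum>\<gamma>\<in>Y. mps_const (if \<gamma> = \<beta> then 1 else 0) * mps_monom \<gamma>) = (mps_monom \<beta> :: ('k, 'v) mps)"
          using finY by (subst sum.mono_neutral_right[of Y "{\<beta>}"]) (auto simp: Y_def)
        then show ?thesis using is_idealD(1)[OF J] by (intro exI[of _ "\<lambda>\<gamma>. if \<gamma> = \<beta> then 1 else 0"]) simp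
      next
        case False
        then have \<beta>X: "\<beta> \<in> X" using \<beta> by (simp add: X_def)
        \<comment> \<open>This tangent vector has the same coefficients on \<open>X\<close> as the
          monomial \<open>\<beta>\<close>; the two differ, up to high order, by monomials in
          \<open>Y\<close>.\<close>
        define t where "t = (\<Sum>\<alpha>\<in>X. mps_const (mpoly_at s (B \<beta> \<alpha>) / mpoly_at s h) * fibre (A \<alpha>) s)"
        have "fibre (A \<alpha>) s \<in> ?T" if "\<alpha> \<in> X" for \<alpha>
          unfolding mem_tangent_image_iff A_fibre using \<Xi>_max U_Right by blast
        then have "t \<in> ?T" unfolding t_def by (intro T(3,7))
        have t_coeff: "mps_coeff t \<gamma> = (if \<beta> = \<gamma> then 1 else 0)" if "\<gamma> \<in> X" for \<gamma>
        proof -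
          have "mps_coeff t \<gamma> = mpoly_at s (\<Sum>\<alpha>\<in>X. B \<beta> \<alpha> * mps_coeff (A \<alpha>) \<gamma>) / mpoly_at s h"
            by (simp add: t_def fibre_def ring_morphism.sum[OF ring_morphism_mpoly_at]
                ring_morphism.mult[OF ring_morphism_mpoly_at] sum_divide_distrib)
          then show ?thesis using BA[OF \<beta>X that] s
            by (simp add: ring_morphism.zero[OF ring_morphism_mpoly_at])
        qed
        let ?r = "\<Sum>\<gamma>\<in>Y. mps_const (- mps_coeff t \<gamma>) * mps_monom \<gamma>"
        have "mps_coeff (mps_monom \<beta> - ?r - t) m = 0" if m: "mdeg m < Suc D" for m
        proof -
          have "mps_coeff ?r m = (\<Sum>\<gamma>\<in>Y. if \<gamma> = m then - mps_coeff t m else 0)"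
            by (simp only: mps_coeff_sum mps_coeff_const_mult) (intro sum.cong; simp add: mps_coeff_monom)
          then have r: "mps_coeff ?r m = (if m \<in> Y then - mps_coeff t m else 0)" using finY by simp
          show ?thesis
          proof (cases "m \<in> Y")
            case True
            then have "m \<noteq> \<beta>" using False by (auto simp: Y_def)
            with True r show ?thesis by (simp add: mps_coeff_monom)
          next
            case mY: False
            then have "m \<in> X" using m by (simp add: X_def Y_def)
            then show ?thesis using t_coeff[of m] r mY by (simp add: mps_coeff_monom)
          qed
        qed
        then have "mps_monom \<beta> - ?r - t \<in> J" by (intro OJ) (simp only: ord_ge_def mem_Collect_eq, blast)
        then have "mps_monom \<beta> - ?r \<in> J" using TJ[OF \<open>t \<in> ?T\<close>] by (rule ideal_cong_mem[OF J])
        then show ?thesis by (rule exI[of _ "\<lambda>\<gamma>. - mps_coeff t \<gamma>"])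
      qed
      then obtain c where c: "mps_monom \<beta> - (\<Sum>\<gamma>\<in>Y. mps_const (c \<gamma>) * mps_monom \<gamma>) \<in> J" by blast
      have "(\<Sum>i<card Y. mps_const (c (e i)) * mps_monom (e i)) = (\<Sum>\<gamma>\<in>Y. mps_const (c \<gamma>) * mps_monom \<gamma>)"
        by (rule sum.reindex_bij_betw[OF e])
      with c show ?thesis by (intro exI[of _ "\<lambda>i. c (e i)"]) simp
    qed
    have "mps_monom \<alpha> \<in> J" if "mdeg \<alpha> = D" for \<alpha>
      by (rule monom_mem_of_finite_codim[OF J, of \<alpha> "\<lambda>i. mps_monom (e i)" "card Y"])
        (use that gen in \<open>auto simp: D_def\<close>)
    then show ?thesis
      unfolding tangent_deg_def J_def mem_Collect_eq Bex_def mem_tangent_image_iff by blast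
  qed
  then show ?thesis using h(1) hw d_pos by (intro exI[of _ D] exI[of _ h]) (auto simp: D_def)
qed

lemma linear_coeff_mem: "\<phi> j \<in> coeffs_in S \<Longrightarrow> linear_coeff \<phi> j k \<in> S"
  by (simp add: linear_coeff_def coeffs_in_def)

text \<open>The parameters \<^term>\<open>y\<close> of the group elements and of \<^term>\<open>t\<close> are chosen so that the map to
  jets has the identity as derivative at \<^term>\<open>y = 0\<close>. Hence its fibre product with \<^term>\<open>S\<close> is etale over
  \<^term>\<open>S\<close> after shrinking, and by finite determinacy it is enough to compare jets.\<close>

lemma linear_unfolding_complete:
  fixes f :: "('k :: field, 'v :: finite) mps"
  assumes "tangent_solution G f l (\<lambda>i. mps_of_mpoly (g i)) d \<Xi> C U"
    and unf: "unfolding_of f S s\<^sub>0 H"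
  shows "etale_pullback G S s\<^sub>0 H (affine_space l) (\<lambda>_. 0) (linear_unfolding f l g)"
proof -
  let ?g = "\<lambda>i. mps_of_mpoly (g i) :: ('k, 'v) mps"
  interpret tangent_solution G f l ?g d \<Xi> C U by fact
  define M where "M = adim S"
  have S: "affine_variety S" "adim S = M" and s\<^sub>0: "s\<^sub>0 \<in> points S" and H: "\<And>m. mps_coeff H m \<in> mpolys M"
    and H0: "fibre H s\<^sub>0 = f" and H_max: "\<And>t. t \<in> points S \<Longrightarrow> fibre H t \<in> mps_max"
    using unf by (auto simp: unfolding_of_def M_def)
  have s\<^sub>0_0: "s\<^sub>0 i = 0" if "M \<le> i" for i using s\<^sub>0 that by (simp add: points_def M_def)
  obtain D hD where D: "1 \<le> D" and hD: "hD \<in> mpolys M" "mpoly_at s\<^sub>0 hD = 1"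
    and detD: "\<And>s. mpoly_at s hD \<noteq> 0 \<Longrightarrow> tangent_deg G (fibre H s) D"
    using tangent_deg_open[OF H H0] by blast
  \<comment> \<open>Degrees up to \<open>2 * D\<close> are those in which
    \<open>finite_determinacy\<close> requires agreement. Constant terms vanish in both families,
    and no direction exists for the monomial 1.\<close>
  define Y where "Y = {\<beta> :: 'v \<Rightarrow>\<^sub>0 nat. \<beta> \<noteq> 0 \<and> mdeg \<beta> \<le> 2 * D}"
  define N where "N = card Y"
  have finY: "finite Y" unfolding Y_def by (rule finite_subset[OF _ finite_monoms_UNIV(1)[of "2 * D"]]) auto
  obtain e where e: "bij_betw e {..<N} Y"
    using ex_bij_betw_nat_finite[OF finY] by (auto simp: atLeast0LessThan N_def)
  have eY: "e j \<in> Y" if "j < N" for j using e that by (auto simp: bij_betw_def)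
  have e_inj: "e i = e j \<longleftrightarrow> i = j" if "i < N" "j < N" for i j
    using e that by (auto simp: bij_betw_def inj_on_def)

  let ?c = "mps_map mpoly_const :: ('k, 'v) mps \<Rightarrow> ('k mpoly, 'v) mps"
  \<comment> \<open>One new parameter for each monomial of \<open>Y\<close>. The substitution, the
    unit and the parameters of the unfolding depend on it linearly, in the direction that solves the
    tangent equation for this monomial.\<close>
  define y :: "nat \<Rightarrow> 'k mpoly" where "y j = mpoly_var (M + j)" for j
  define \<phi> where "\<phi> i = mps_var i + (\<Sum>j<N. mps_const (y j) * ?c (\<Xi> (e j) i))" for i
  define u where "u = 1 + (\<Sum>j<N. mps_const (y j) * ?c (U (e j)))"
  define \<tau> where "\<tau> k = (\<Sum>j<N. y j * mpoly_const (C (e j) k))" for k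
  define F where "F = linear_family mpoly_const f l ?g \<tau>"
  define \<Theta> where "\<Theta> = u * mps_subst \<phi> F"
  let ?R = "mpolys (M + N) :: 'k mpoly set"
  note sub = is_subringD[OF coeffs_in_subring[OF mpolys_subring, of "M + N", where 'v = 'v]]
  have y_mem: "y j \<in> ?R" if "j < N" for j using that by (simp add: y_def mpoly_var_mem)
  have yc: "mps_const (y j) \<in> coeffs_in ?R" if "j < N" for j
    by (intro coeffs_in_subring_const mpolys_subring y_mem that)
  have \<phi>_mem: "\<phi> i \<in> coeffs_in ?R" for i
    unfolding \<phi>_def
    by (intro sub(3,4,7) yc mps_map_const_coeffs coeffs_in_subring_monom mpolys_subring) auto
  have u_mem: "u \<in> coeffs_in ?R"
    unfolding u_def by (intro sub(3,4,7) sub(1) yc mps_map_const_coeffs) auto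
  have \<tau>_mem: "\<tau> k \<in> ?R" for k
    unfolding \<tau>_def by (intro mpolysD(4,7) y_mem mpoly_const_mem) auto
  have F_mem: "F \<in> coeffs_in ?R"
    unfolding F_def linear_family_def
    by (intro sub(3,4,7) mps_map_const_coeffs coeffs_in_subring_const mpolys_subring \<tau>_mem)
  have \<phi>_max: "\<forall>i. \<phi> i \<in> mps_max"
  proof
    fix i
    have "mps_coeff (\<Xi> \<beta> i) 0 = 0" for \<beta> using \<Xi>_max by (simp add: mps_max_def)
    moreover have "mps_coeff (mps_var i) 0 = (0 :: 'k mpoly)" using mps_var_max[of i] by (simp add: mps_max_def)
    ultimately show "\<phi> i \<in> mps_max" by (simp add: \<phi>_def mps_max_def mpoly_const_def)
  qed
  have \<Theta>_mem: "\<Theta> \<in> coeffs_in ?R"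
    unfolding \<Theta>_def by (intro sub(4) u_mem coeffs_in_subring_subst mpolys_subring \<phi>_max \<phi>_mem F_mem)
  have sub_MN: "mpolys M \<subseteq> ?R" by (rule mpolys_mono) simp

  \<comment> \<open>Stated for general \<open>\<kappa>\<close> because two cases are needed: the
    identity for points of the cover, and \<open>dual_const\<close> for tangent vectors.\<close>
  have ev_\<phi>: "mps_map (mpoly_eval \<kappa> a) (\<phi> i) = mps_var i + (\<Sum>j<N. mps_const (a (M + j)) * mps_map \<kappa> (\<Xi> (e j) i))"
    and ev_u: "mps_map (mpoly_eval \<kappa> a) u = 1 + (\<Sum>j<N. mps_const (a (M + j)) * mps_map \<kappa> (U (e j)))"
    and ev_\<tau>: "mpoly_eval \<kappa> a (\<tau> k) = (\<Sum>j<N. a (M + j) * \<kappa> (C (e j) k))"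
    and ev_F: "mps_map (mpoly_eval \<kappa> a) F = linear_family \<kappa> f l ?g (\<lambda>k. mpoly_eval \<kappa> a (\<tau> k))"
    and ev_\<Theta>: "mps_map (mpoly_eval \<kappa> a) \<Theta> = mps_map (mpoly_eval \<kappa> a) u *
      mps_subst (\<lambda>i. mps_map (mpoly_eval \<kappa> a) (\<phi> i)) (mps_map (mpoly_eval \<kappa> a) F)"
    if \<kappa>: "ring_morphism \<kappa>" for \<kappa> :: "'k \<Rightarrow> 'r :: comm_ring_1" and a i k
  proof -
    note ev = ring_morphism.mpoly_eval_morphism[OF \<kappa>, of a]
    interpret ev: ring_morphism "mpoly_eval \<kappa> a" by (rule ev)
    interpret m: ring_morphism "mps_map (mpoly_eval \<kappa> a) :: ('k mpoly, 'v) mps \<Rightarrow> _"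
      by (rule ring_morphism_mps_map[OF ev])
    note simps = m.hom_simps m.sum mps_map_const[OF ev] mps_map_monom[OF ev] mps_map_eval_const[OF \<kappa>]
      ring_morphism.mpoly_eval_var[OF \<kappa>] ring_morphism.mpoly_eval_const[OF \<kappa>]
    show "mps_map (mpoly_eval \<kappa> a) (\<phi> i) = mps_var i + (\<Sum>j<N. mps_const (a (M + j)) * mps_map \<kappa> (\<Xi> (e j) i))"
      by (simp add: \<phi>_def y_def simps)
    show "mps_map (mpoly_eval \<kappa> a) u = 1 + (\<Sum>j<N. mps_const (a (M + j)) * mps_map \<kappa> (U (e j)))"
      by (simp add: u_def y_def simps)
    show "mpoly_eval \<kappa> a (\<tau> k) = (\<Sum>j<N. a (M + j) * \<kappa> (C (e j) k))"
      by (simp add: \<tau>_def y_def ev.sum ev.mult simps)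
    show "mps_map (mpoly_eval \<kappa> a) F = linear_family \<kappa> f l ?g (\<lambda>k. mpoly_eval \<kappa> a (\<tau> k))"
      by (simp add: F_def linear_family_def simps)
    show "mps_map (mpoly_eval \<kappa> a) \<Theta> = mps_map (mpoly_eval \<kappa> a) u *
      mps_subst (\<lambda>i. mps_map (mpoly_eval \<kappa> a) (\<phi> i)) (mps_map (mpoly_eval \<kappa> a) F)"
      by (simp add: \<Theta>_def m.mult mps_map_subst[OF ev \<phi>_max])
  qed

  \<comment> \<open>The base point with all new parameters 0, where the substitution is the identity
    and both families have the fibre \<open>f\<close>.\<close>
  define w where "w i = (if i < M then s\<^sub>0 i else 0)" for i
  have w_y: "w (M + j) = 0" for j by (simp add: w_def)
  note at_simps = ring_morphism.hom_simps[OF ring_morphism_mpoly_at]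
  have w_\<phi>: "mps_map (mpoly_at w) (\<phi> i) = mps_var i" for i by (simp add: ev_\<phi>[OF ring_morphism_id] w_y)
  have w_u: "mps_map (mpoly_at w) u = 1" by (simp add: ev_u[OF ring_morphism_id] w_y)
  have w_\<tau>: "mpoly_at w (\<tau> k) = 0" for k by (simp add: ev_\<tau>[OF ring_morphism_id] w_y)
  have w_\<Theta>: "mps_map (mpoly_at w) \<Theta> = f"
    by (simp add: ev_\<Theta>[OF ring_morphism_id] w_\<phi> w_u ev_F[OF ring_morphism_id] w_\<tau> linear_family_def
        mps_map_ident subst_ident)
  have H_w: "fibre H w = f"
    using H0 fibre_cong[OF H, of w s\<^sub>0] by (simp add: w_def)

  \<comment> \<open>The equations of the fibre product: both families have the same coefficient at
    the monomial \<open>e j\<close>.\<close>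
  define P where "P j = mps_coeff \<Theta> (e j) - mps_coeff H (e j)" for j
  have P_mem: "P j \<in> ?R" for j
    using \<Theta>_mem H sub_MN unfolding P_def coeffs_in_def by (intro mpolysD(6)) auto
  \<comment> \<open>The derivative along the \<open>i\<close>-th new parameter is read off over the
    dual numbers. \<open>H\<close> does not involve this parameter, and by
    \<open>dual_action\<close> the other family moves by the tangent vector belonging to
    \<open>e i\<close>, which is the monomial \<open>e i\<close> itself.\<close>
  have jac: "mpoly_at w (mpoly_pderiv (M + i) (P j)) = (if i = j then 1 else 0)" if ij: "i < N" "j < N" for i j
  proof -
    let ?e = "\<lambda>k. if k = M + i then 1 else 0 :: 'k"
    let ?a = "\<lambda>k. Dual_Number (w k) (?e k)"
    let ?ev = "mpoly_eval dual_const ?a"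
    have "dual_eps (?ev (P j)) = (\<Sum>k<M + N. ?e k * mpoly_at w (mpoly_pderiv k (P j)))"
      by (rule mpoly_eval_dual[OF P_mem])
    also have "\<dots> = (\<Sum>k<M + N. if k = M + i then mpoly_at w (mpoly_pderiv (M + i) (P j)) else 0)"
      by (intro sum.cong) auto
    also have "\<dots> = mpoly_at w (mpoly_pderiv (M + i) (P j))" using ij by simp
    finally have 1: "mpoly_at w (mpoly_pderiv (M + i) (P j)) = dual_eps (?ev (P j))" by simp
    have "dual_eps (?ev (mps_coeff H (e j))) = (\<Sum>k<M. ?e k * mpoly_at w (mpoly_pderiv k (mps_coeff H (e j))))"
      by (rule mpoly_eval_dual[OF H])
    also have "\<dots> = 0" by (intro sum.neutral) auto
    finally have 2: "dual_eps (?ev (mps_coeff H (e j))) = 0" .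
    have a: "?a (M + j) = (if j = i then Dual_Number 0 1 else 0)" for j
      by (simp add: w_y zero_dual_number_def)
    note dc = ring_morphism_dual_const
    let ?\<epsilon> = "Dual_Number 0 1 :: 'k dual_number"
    have delta: "(\<Sum>j<N. mps_const (?a (M + j)) * X j) = mps_const ?\<epsilon> * X i" for X :: "nat \<Rightarrow> ('k dual_number, 'v) mps"
    proof -
      have "(\<Sum>j<N. mps_const (?a (M + j)) * X j) = (\<Sum>j<N. if j = i then mps_const ?\<epsilon> * X i else 0)"
        unfolding a by (intro sum.cong) auto
      then show ?thesis using ij by simp
    qed
    have \<phi>i: "mps_map ?ev (\<phi> k) = mps_var k + mps_const ?\<epsilon> * mps_map dual_const (\<Xi> (e i) k)" for k
      unfolding ev_\<phi>[OF dc] by (subst delta) (rule refl)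
    have ui: "mps_map ?ev u = 1 + mps_const ?\<epsilon> * mps_map dual_const (U (e i))"
      unfolding ev_u[OF dc] by (subst delta) (rule refl)
    have \<tau>i: "?ev (\<tau> k) = ?\<epsilon> * dual_const (C (e i) k)" for k
    proof -
      have "?ev (\<tau> k) = (\<Sum>j<N. if j = i then ?\<epsilon> * dual_const (C (e i) k) else 0)"
        unfolding ev_\<tau>[OF dc] a by (intro sum.cong) auto
      then show ?thesis using ij by simp
    qed
    define \<gamma> where "\<gamma> = (\<Sum>k<l. mps_const (?\<epsilon> * dual_const (C (e i) k)) * mps_map dual_const (?g k))"
    have \<epsilon>: "x * ?\<epsilon> \<in> dual_max" "?\<epsilon> * x \<in> dual_max" for x by (simp_all add: dual_max_def dual_defs)
    have \<epsilon>_eps: "dual_eps (?\<epsilon> * dual_const x) = x" "dual_eps (?\<epsilon> * dual_const x * dual_const z) = x * z" for x z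
      by (simp_all add: dual_defs)
    have Fi: "mps_map ?ev F = mps_map dual_const f + \<gamma>"
      unfolding ev_F[OF dc] \<tau>i by (simp add: linear_family_def \<gamma>_def)
    have "mps_map dual_eps (mps_map ?ev u * mps_subst (\<lambda>k. mps_map ?ev (\<phi> k)) (mps_map dual_const f + \<gamma>)) =
      (\<Sum>k\<in>UNIV. mps_map dual_eps (mps_map ?ev (\<phi> k)) * mps_pderiv k f) + mps_map dual_eps \<gamma> +
      mps_map dual_eps (mps_map ?ev u) * f"
    proof (rule dual_action)
      show "\<forall>k. mps_map ?ev (\<phi> k) \<in> mps_max"
        using \<phi>_max by (simp add: mps_max_def ring_morphism.mpoly_eval_0[OF dc])
      show "mps_map ?ev (\<phi> k) - mps_var k \<in> coeffs_in dual_max" for k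
        unfolding \<phi>i by (simp add: coeffs_in_def \<epsilon>)
      show "mps_map ?ev u - 1 \<in> coeffs_in dual_max"
        unfolding ui by (simp add: coeffs_in_def \<epsilon>)
      show "\<gamma> \<in> coeffs_in dual_max"
        unfolding \<gamma>_def coeffs_in_def by (auto simp: mult.assoc intro!: is_idealD(7)[OF is_ideal_dual_max] \<epsilon>)
    qed
    moreover have "mps_map dual_eps (mps_map ?ev (\<phi> k)) = \<Xi> (e i) k" for k
      unfolding \<phi>i by (rule mps_eqI) (simp add: \<epsilon>_eps mps_coeff_monom)
    moreover have "mps_map dual_eps (mps_map ?ev u) = U (e i)"
      unfolding ui by (rule mps_eqI) (simp add: \<epsilon>_eps mps_coeff_one)
    moreover have "mps_map dual_eps \<gamma> = (\<Sum>k<l. mps_const (C (e i) k) * ?g k)"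
      unfolding \<gamma>_def by (rule mps_eqI) (simp add: dual_eps_sum \<epsilon>_eps)
    moreover have "mps_monom (e i) = (\<Sum>k\<in>UNIV. \<Xi> (e i) k * mps_pderiv k f) +
      (\<Sum>k<l. mps_const (C (e i) k) * ?g k) + U (e i) * f"
      using eY[OF ij(1)] by (intro solution) (simp add: Y_def)
    ultimately have "mps_map dual_eps (mps_map ?ev \<Theta>) = mps_monom (e i)"
      unfolding ev_\<Theta>[OF dc] Fi by simp
    from arg_cong[OF this, of "\<lambda>F. mps_coeff F (e j)"]
    have "dual_eps (?ev (mps_coeff \<Theta> (e j))) = mps_coeff (mps_monom (e i)) (e j)" by simp
    moreover have "mps_coeff (mps_monom (e i)) (e j) = (if i = j then 1 else 0 :: 'k)"
      using e_inj[OF ij(2,1)] by (auto simp: mps_coeff_monom)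
    ultimately show ?thesis
      unfolding 1 unfolding P_def by (simp add: ring_morphism.minus[OF ring_morphism.mpoly_eval_morphism[OF dc]] 2)
  qed

  let ?V = "{p. mpoly_at w p = 0}"
  let ?J = "\<lambda>i j. mpoly_pderiv (M + j) (P i)"
  have J: "?J i j \<in> ?R \<and> ?J i j - (if i = j then 1 else 0) \<in> ?V" if "i \<in> {..<N}" "j \<in> {..<N}" for i j
    using jac[of j i] that P_mem[of i] by (auto simp: mpoly_pderiv_mem at_simps)
  obtain L h1 where L: "\<forall>i j. i \<in> {..<N} \<longrightarrow> j \<in> {..<N} \<longrightarrow> L i j \<in> ?R" "h1 \<in> ?R" "h1 - 1 \<in> ?V"
    "\<forall>i\<in>{..<N}. \<forall>k\<in>{..<N}. (\<Sum>j<N. L i j * ?J j k) = (if i = k then h1 else 0)"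
    using near_identity_left_inverse[OF finite_lessThan mpolys_subring is_ideal_vanishing, of N ?J, OF J] by blast
  obtain R h2 where R: "\<forall>i j. i \<in> {..<N} \<longrightarrow> j \<in> {..<N} \<longrightarrow> R i j \<in> ?R" "h2 \<in> ?R" "h2 - 1 \<in> ?V"
    "\<forall>i\<in>{..<N}. \<forall>k\<in>{..<N}. (\<Sum>j<N. ?J i j * R j k) = (if i = k then h2 else 0)"
    using near_identity_right_inverse[OF finite_lessThan mpolys_subring is_ideal_vanishing, of N ?J, OF J] by blast
  \<comment> \<open>The substitution is the identity at \<open>w\<close>; where \<open>h3\<close>
    and \<open>h4\<close> below are nonzero its linear part stays invertible, so it is an
    automorphism.\<close>
  have lin: "linear_coeff \<phi> i j \<in> ?R \<and> linear_coeff \<phi> i j - (if i = j then 1 else 0) \<in> ?V" for i j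
  proof -
    have "mpoly_at w (linear_coeff \<phi> i j) = (if i = j then 1 else 0)"
      using arg_cong[OF w_\<phi>[of i], of "\<lambda>F. mps_coeff F (Poly_Mapping.single j (Suc 0))"]
      by (auto simp: linear_coeff_def mps_coeff_monom)
    then show ?thesis using linear_coeff_mem[OF \<phi>_mem] by (auto simp: at_simps)
  qed
  obtain L' h3 where L': "h3 \<in> ?R" "h3 - 1 \<in> ?V"
    "\<forall>i\<in>UNIV. \<forall>k\<in>UNIV. (\<Sum>j\<in>UNIV. L' i j * linear_coeff \<phi> j k) = (if i = k then h3 else 0)"
    using near_identity_left_inverse[OF finite_UNIV mpolys_subring is_ideal_vanishing, of "linear_coeff \<phi>", OF lin]
    by blast
  obtain R' h4 where R': "h4 \<in> ?R" "h4 - 1 \<in> ?V"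
    "\<forall>i\<in>UNIV. \<forall>k\<in>UNIV. (\<Sum>j\<in>UNIV. linear_coeff \<phi> i j * R' j k) = (if i = k then h4 else 0)"
    using near_identity_right_inverse[OF finite_UNIV mpolys_subring is_ideal_vanishing, of "linear_coeff \<phi>", OF lin]
    by blast
  define u0 where "u0 = mps_coeff u 0"
  have u0: "u0 \<in> ?R" "mpoly_at w u0 = 1"
    using u_mem arg_cong[OF w_u, of "\<lambda>F. mps_coeff F 0"]
    by (simp_all add: u0_def coeffs_in_def mps_coeff_one)
  \<comment> \<open>Shrinking ensures three things at every point: the uniform degree
    \<open>D\<close> for determinacy, bijectivity of the substitution, and invertibility of the
    factor \<open>u\<close>.\<close>
  define q where "q = hD * h3 * h4 * u0"
  have q_mem: "q \<in> ?R" unfolding q_def using hD(1) sub_MN by (intro mpolysD(4) L' R' u0) auto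
  have hD_w: "mpoly_at w hD = 1"
    using hD(2) mpoly_eval_cong[OF hD(1), of w s\<^sub>0] by (simp add: w_def)
  have h_w: "mpoly_at w h1 = 1" "mpoly_at w h2 = 1" "mpoly_at w h3 = 1" "mpoly_at w h4 = 1"
    using L(3) R(3) L'(2) R'(2) by (simp_all add: at_simps)

  interpret E: standard_etale M N P q L R h1 h2
    by standard (use P_mem q_mem L R in auto)
  let ?W = "E.cover S"
  \<comment> \<open>As this value is 1, the base point of the cover has 1 as its last coordinate,
    the inverse of \<open>E.h\<close>.\<close>
  have E_h: "mpoly_at w E.h = 1" unfolding E.h_def unfolding q_def by (simp add: at_simps hD_w h_w u0)
  define w\<^sub>0 where "w\<^sub>0 = w(M + N := 1)"
  have w\<^sub>0_cong: "mpoly_at w\<^sub>0 p = mpoly_at w p" if "p \<in> ?R" for p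
    using that by (rule mpoly_eval_cong) (simp add: w\<^sub>0_def)
  have w\<^sub>0_points: "w\<^sub>0 \<in> points ?W"
  proof -
    have "mpoly_at w\<^sub>0 p = 0" if p: "p \<in> E.equations S" for p
    proof -
      consider "p \<in> aideal S" | j where "j < N" "p = P j" | "p = mpoly_var (M + N) * E.h - 1"
        using p by (auto simp: E.equations_def)
      then show ?thesis
      proof cases
        case 1
        then have pM: "p \<in> mpolys M" using S by (auto simp: affine_variety_def)
        have "mpoly_at w\<^sub>0 p = mpoly_at s\<^sub>0 p"
          by (rule mpoly_eval_cong[OF pM]) (simp add: w\<^sub>0_def w_def)
        then show ?thesis using s\<^sub>0 1 by (simp add: points_def)
      next
        case 2
        have "mpoly_at w\<^sub>0 (P j) = mps_coeff (mps_map (mpoly_at w) \<Theta>) (e j) - mps_coeff (fibre H w) (e j)"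
          unfolding w\<^sub>0_cong[OF P_mem] by (simp add: P_def at_simps fibre_def)
        then show ?thesis using 2 by (simp add: w_\<Theta> H_w)
      next
        case 3
        have "mpoly_at w\<^sub>0 E.h = 1" using w\<^sub>0_cong[OF E.h_mem'] E_h by simp
        then show ?thesis unfolding 3 by (simp add: at_simps mpoly_at_var w\<^sub>0_def)
      qed
    qed
    then have "ideal_gen (E.equations S) \<subseteq> {p. mpoly_at w\<^sub>0 p = 0}"
      by (intro ideal_gen_minimal is_ideal_vanishing) auto
    moreover have "w\<^sub>0 i = 0" if "Suc (M + N) \<le> i" for i using that by (simp add: w\<^sub>0_def w_def)
    ultimately show ?thesis by (auto simp: points_def E.cover_def)
  qed
  have nbhd: "etale_neighbourhood ?W w\<^sub>0 S s\<^sub>0 mpoly_var"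
    unfolding etale_neighbourhood_def
  proof (intro conjI)
    show "morphism_at S mpoly_var w\<^sub>0 = s\<^sub>0"
      using s\<^sub>0_0 by (auto simp: morphism_at_def S(2) mpoly_at_var w\<^sub>0_def w_def)
  qed (fact E.cover_variety w\<^sub>0_points E.cover_etale[OF S])+
  have mor: "morphism ?W (affine_space l) \<tau>"
  proof -
    have "?R \<subseteq> mpolys (Suc (M + N))" by (rule mpolys_mono) simp
    then show ?thesis
      using \<tau>_mem E.cover_variety[of S]
      by (auto simp: morphism_def affine_space_def affine_variety_def
          ring_morphism.mpoly_eval_0[OF ring_morphism_mpoly_const])
  qed
  have base: "morphism_at (affine_space l) \<tau> w\<^sub>0 = (\<lambda>_. 0)"
    using w\<^sub>0_cong[OF \<tau>_mem] by (auto simp: morphism_at_def w_\<tau>)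
  have "G_equivalent G (fibre H (morphism_at S mpoly_var a))
      (fibre (linear_unfolding f l g) (morphism_at (affine_space l) \<tau> a))" if a: "a \<in> points ?W" for a
  proof -
    let ?s = "morphism_at S mpoly_var a" and ?t = "morphism_at (affine_space l) \<tau> a"
    have eqs: "mpoly_at a p = 0" if "p \<in> E.equations S" for p
      using a that E.equations_mem[OF S] by (auto simp: points_def)
    have s_a: "?s i = a i" if "i < M" for i using that by (simp add: morphism_at_def S(2) mpoly_at_var)
    have sS: "?s \<in> points S"
    proof -
      have "mpoly_at ?s p = 0" if p: "p \<in> aideal S" for p
      proof -
        have "p \<in> mpolys M" using S p by (auto simp: affine_variety_def)
        then have "mpoly_at ?s p = mpoly_at a p" by (rule mpoly_eval_cong) (rule s_a)
        then show ?thesis using eqs[of p] p by (simp add: E.equations_def)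
      qed
      then show ?thesis by (simp add: points_def morphism_at_def)
    qed
    have Hs: "fibre H ?s = fibre H a" by (rule fibre_cong[OF H s_a])
    have "mpoly_at a (mpoly_var (M + N) * E.h - 1) = 0" by (rule eqs) (simp add: E.equations_def)
    then have "a (M + N) * mpoly_at a E.h = 1" by (simp add: at_simps mpoly_at_var)
    then have "mpoly_at a E.h \<noteq> 0" by auto
    then have "mpoly_at a (q * h1 * h2) \<noteq> 0" unfolding E.h_def .
    then have nz: "mpoly_at a hD \<noteq> 0" "mpoly_at a h3 \<noteq> 0" "mpoly_at a h4 \<noteq> 0" "mpoly_at a u0 \<noteq> 0"
      by (auto simp: q_def at_simps)
    define \<phi>a where "\<phi>a = (\<lambda>i. mps_map (mpoly_at a) (\<phi> i))"
    define ua where "ua = mps_map (mpoly_at a) u"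
    have \<phi>a_max: "\<forall>i. \<phi>a i \<in> mps_max"
      using \<phi>_max by (simp add: \<phi>a_def mps_max_def at_simps)
    have lin_a: "linear_coeff \<phi>a i j = mpoly_at a (linear_coeff \<phi> i j)" for i j
      by (simp add: \<phi>a_def linear_coeff_def)
    have "bij (mps_subst \<phi>a)"
    proof (rule subst_bij[OF \<phi>a_max])
      fix i k
      have "mpoly_at a (\<Sum>j\<in>UNIV. L' i j * linear_coeff \<phi> j k) = (if i = k then mpoly_at a h3 else 0)"
        using L'(3) by (simp add: at_simps)
      then show "(\<Sum>j\<in>UNIV. (mpoly_at a (L' i j) / mpoly_at a h3) * linear_coeff \<phi>a j k) = (if i = k then 1 else 0)"
        using nz by (simp add: lin_a ring_morphism.sum[OF ring_morphism_mpoly_at] at_simps flip: sum_divide_distrib)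
      have "mpoly_at a (\<Sum>j\<in>UNIV. linear_coeff \<phi> i j * R' j k) = (if i = k then mpoly_at a h4 else 0)"
        using R'(3) by (simp add: at_simps)
      then show "(\<Sum>j\<in>UNIV. linear_coeff \<phi>a i j * (mpoly_at a (R' j k) / mpoly_at a h4)) = (if i = k then 1 else 0)"
        using nz by (simp add: lin_a ring_morphism.sum[OF ring_morphism_mpoly_at] at_simps flip: sum_divide_distrib)
    qed
    then have aut: "mps_subst \<phi>a \<in> mps_auts" by (rule subst_auts(1)[OF \<phi>a_max])
    let ?\<Theta> = "mps_map (mpoly_at a) \<Theta>"
    have Ft: "mps_map (mpoly_at a) F = fibre (linear_unfolding f l g) ?t"
      unfolding ev_F[OF ring_morphism_id] fibre_linear_unfolding linear_family_def
      by (simp add: morphism_at_def affine_space_def)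
    have \<Theta>_eq: "?\<Theta> = ua * mps_subst \<phi>a (fibre (linear_unfolding f l g) ?t)"
      unfolding ev_\<Theta>[OF ring_morphism_id] Ft[symmetric] by (simp add: \<phi>a_def ua_def)
    have "ua dvd 1"
      using nz(4) by (intro mps_unit[of "inverse (mpoly_at a u0)"]) (simp add: ua_def u0_def)
    moreover have "ua = 1" if "G = Right_Equiv"
      unfolding ua_def ev_u[OF ring_morphism_id] using U_Right[OF that] by (simp add: mps_map_ident)
    ultimately have "G_equivalent G (fibre (linear_unfolding f l g) ?t) ?\<Theta>"
      unfolding G_equivalent_def using aut \<Theta>_eq by blast
    \<comment> \<open>The equations of the cover only make the jets agree. The gap is closed by
      determinacy of the fibre of \<open>H\<close>, for which the bound \<open>D\<close> was
      established.\<close>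
    moreover have "G_equivalent G (fibre H ?s) ?\<Theta>"
    proof (rule finite_determinacy[OF D])
      show "tangent_deg G (fibre H ?s) D" using detD[OF nz(1)] Hs by simp
      have \<Theta>0: "mps_coeff ?\<Theta> 0 = 0"
        using linear_family_max[OF ring_morphism_id, of ?t] subst_coeff_0[OF \<phi>a_max]
        unfolding \<Theta>_eq fibre_linear_unfolding by (simp add: mps_coeff_mult_0 mps_max_def)
      have H0: "mps_coeff (fibre H ?s) 0 = 0" using H_max[OF sS] by (simp add: mps_max_def)
      have "mps_coeff (?\<Theta> - fibre H ?s) \<beta> = 0" if "mdeg \<beta> < 2 * D + 1" for \<beta>
      proof (cases "\<beta> = 0")
        case True
        then show ?thesis using \<Theta>0 H0 by simp
      next
        case False
        then have "\<beta> \<in> Y" using that by (simp add: Y_def)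
        then obtain j where j: "j < N" "\<beta> = e j" using e by (auto simp: bij_betw_def)
        have "mpoly_at a (P j) = 0" using j by (intro eqs) (simp add: E.equations_def)
        then show ?thesis using j(2) unfolding Hs by (simp add: P_def at_simps fibre_def)
      qed
      then show "?\<Theta> - fibre H ?s \<in> ord_ge (2 * D + 1)" by (simp add: ord_ge_def)
    qed
    ultimately show ?thesis using G_equivalent_sym G_equivalent_trans by blast
  qed
  then show ?thesis
    unfolding etale_pullback_def using nbhd mor base by blast
qed

lemma versal_complete:
  fixes f :: "('k :: field, 'v :: finite) mps"
  assumes "f \<in> mps_max" "finite_codim G f"
    and gens: "quot_generators mps_max (tangent_image G f) l (\<lambda>i. mps_of_mpoly (g i))"
  shows "unfolding_of f (affine_space l) (\<lambda>_. 0) (linear_unfolding f l g) \<and>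
    formally_versal TYPE('b :: comm_ring_1) TYPE('c :: comm_ring_1) G f
      mps_const (power_series_ring l) (formal_family (linear_unfolding f l g)) \<and>
    (quot_basis mps_max (tangent_image G f) l (\<lambda>i. mps_of_mpoly (g i)) \<longrightarrow>
      semi_universal TYPE('b) TYPE('c) G f
        mps_const (power_series_ring l) (formal_family (linear_unfolding f l g))) \<and>
    complete_unfolding G f (affine_space l) (\<lambda>_. 0) (linear_unfolding f l g)"
proof -
  obtain d where "1 \<le> d" "\<And>\<alpha>. mdeg \<alpha> = d \<Longrightarrow> mps_monom \<alpha> \<in> tangent_image G f"
    using finite_codim_monom[OF assms(2)] by blast
  then obtain \<Xi> C U where sol: "tangent_solution G f l (\<lambda>i. mps_of_mpoly (g i)) d \<Xi> C U"
    using ex_tangent_solution[OF assms(1) _ _ gens] by blast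
  have "unfolding_of f (affine_space l) (\<lambda>_. 0) (linear_unfolding f l g)"
    using gens by (intro unfolding_of_linear_unfolding assms) (simp add: quot_generators_def)
  then show ?thesis
    using formal_family_versal[OF sol, where 'b = 'b and 'c = 'c]
      formal_family_semi_universal[OF sol, where 'b = 'b and 'c = 'c]
      linear_unfolding_complete[OF sol] by (simp add: complete_unfolding_def)
qed

theorem proposition2p14:
  fixes f :: "('k :: alg_closed_field, 'n :: finite) mps"
    and l :: nat and g :: "nat \<Rightarrow> ('n \<Rightarrow>\<^sub>0 nat) \<Rightarrow>\<^sub>0 'k"
  assumes "f \<in> mps_max"
  shows
    "(let U = ideal_prod mps_max (jacobian_ideal f);
          F = linear_unfolding f l g
      in milnor_number f < \<infinity> \<and> quot_generators mps_max U l (\<lambda>i. mps_of_mpoly (g i)) \<longrightarrow>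
         unfolding_of f (affine_space l) (\<lambda>_. 0) F \<and>
         formally_versal TYPE('b :: comm_ring_1) TYPE('c :: comm_ring_1) Right_Equiv f
           mps_const (power_series_ring l) (formal_family F) \<and>
         (quot_basis mps_max U l (\<lambda>i. mps_of_mpoly (g i)) \<longrightarrow>
            semi_universal TYPE('b) TYPE('c) Right_Equiv f
              mps_const (power_series_ring l) (formal_family F)) \<and>
         complete_unfolding Right_Equiv f (affine_space l) (\<lambda>_. 0) F) \<and>
     (let U = ideal_gen ({f} \<union> ideal_prod mps_max (jacobian_ideal f));
          F = linear_unfolding f l g
      in tjurina_number f < \<infinity> \<and> quot_generators mps_max U l (\<lambda>i. mps_of_mpoly (g i)) \<longrightarrow>
         unfolding_of f (affine_space l) (\<lambda>_. 0) F \<and>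
         formally_versal TYPE('b) TYPE('c) Contact_Equiv f
           mps_const (power_series_ring l) (formal_family F) \<and>
         (quot_basis mps_max U l (\<lambda>i. mps_of_mpoly (g i)) \<longrightarrow>
            semi_universal TYPE('b) TYPE('c) Contact_Equiv f
              mps_const (power_series_ring l) (formal_family F)) \<and>
         complete_unfolding Contact_Equiv f (affine_space l) (\<lambda>_. 0) F)"
  using versal_complete[OF assms, where G = Right_Equiv and 'b = 'b and 'c = 'c]
    versal_complete[OF assms, where G = Contact_Equiv and 'b = 'b and 'c = 'c]
  unfolding Let_def finite_codim_def tangent_image_def equiv_kind.case by blast

end
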